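(* Suppose $H$ is a finitely generated class 2 nilpotent group with infinite cyclic derived subgroup. If a group $G$ contains $H$ as a finite index subgroup, then $G$ and $H$ have equivalent conjugacy growth functions, that is, $c_G\sim c_H$.
   Context: Conjugacy growth: for a group $G$ with finite generating set $S$, $|g|_S$ is word length with respect to $S\cup S^{-1}$; the length of a conjugacy class $\kappa$ is $|\kappa|_S=\min\{|g|_S : g\in\kappa\}$, and $c_{G,S}(n)$ is the number of conjugacy classes $\kappa$ with $|\kappa|_S\leq n$. Equivalence: for functions $f,g:\mathbb{N}\to\mathbb{N}$ ($\mathbb{N}$ the non-negative integers), $f\preccurlyeq g$ means there exists $\lambda>1$ (take it to be an integer so that $\lambda n\in\mathbb{N}$) with $f(n)\leq\lambda g(\lambda n)+\lambda$ for all $n\in\mathbb{N}$; $f\sim g$ means $f\preccurlyeq g$ and $g\preccurlyeq f$. The equivalence class of $c_{G,S}$ does not depend on the choice of finite generating set $S$, so one writes $c_G$. *)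

theory Defs
  imports "HOL-Algebra.Algebra"
begin

definition fin_gen_set :: "('a, 'b) monoid_scheme \<Rightarrow> 'a set \<Rightarrow> bool" where
  "fin_gen_set G S \<longleftrightarrow> finite S \<and> S \<subseteq> carrier G \<and> generate G S = carrier G"

definition finitely_generated :: "('a, 'b) monoid_scheme \<Rightarrow> bool" where
  "finitely_generated G \<longleftrightarrow> (\<exists>S. fin_gen_set G S)"

text \<open>The series is indexed from 0: the term at \<open>i\<close> is what is usually written
  \<open>\<gamma>\<^bsub>i+1\<^esub>(G)\<close>, so that class \<open>c\<close> means that the term at \<open>c\<close>
  is the first trivial one.\<close>

primrec lower_central :: "('a, 'b) monoid_scheme \<Rightarrow> nat \<Rightarrow> 'a set" where
  "lower_central G 0 = carrier G"
| "lower_central G (Suc i) =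
     generate G (\<Union>x \<in> lower_central G i. \<Union>y \<in> carrier G.
       {x \<otimes>\<^bsub>G\<^esub> y \<otimes>\<^bsub>G\<^esub> inv\<^bsub>G\<^esub> x \<otimes>\<^bsub>G\<^esub> inv\<^bsub>G\<^esub> y})"

definition nilpotent_of_class :: "('a, 'b) monoid_scheme \<Rightarrow> nat \<Rightarrow> bool" where
  "nilpotent_of_class G c \<longleftrightarrow>
     lower_central G c = {\<one>\<^bsub>G\<^esub>} \<and> (\<forall>i<c. lower_central G i \<noteq> {\<one>\<^bsub>G\<^esub>})"

text \<open>Only meaningful when \<open>S\<close> generates \<open>G\<close> and \<open>g\<close> lies in the carrier;
  otherwise no word need represent \<open>g\<close>.\<close>

definition word_length :: "('a, 'b) monoid_scheme \<Rightarrow> 'a set \<Rightarrow> 'a \<Rightarrow> nat" where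
  "word_length G S g =
     (LEAST n. \<exists>ws. set ws \<subseteq> S \<union> m_inv G ` S \<and> length ws = n \<and>
        foldr (\<otimes>\<^bsub>G\<^esub>) ws \<one>\<^bsub>G\<^esub> = g)"

definition conj_class :: "('a, 'b) monoid_scheme \<Rightarrow> 'a \<Rightarrow> 'a set" where
  "conj_class G g = {x \<otimes>\<^bsub>G\<^esub> g \<otimes>\<^bsub>G\<^esub> inv\<^bsub>G\<^esub> x | x. x \<in> carrier G}"

definition conj_classes :: "('a, 'b) monoid_scheme \<Rightarrow> 'a set set" where
  "conj_classes G = conj_class G ` carrier G"

definition conj_class_length :: "('a, 'b) monoid_scheme \<Rightarrow> 'a set \<Rightarrow> 'a set \<Rightarrow> nat" where
  "conj_class_length G S \<kappa> = (LEAST n. \<exists>g\<in>\<kappa>. word_length G S g = n)"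

definition conj_growth :: "('a, 'b) monoid_scheme \<Rightarrow> 'a set \<Rightarrow> nat \<Rightarrow> nat" where
  "conj_growth G S n = card {\<kappa> \<in> conj_classes G. conj_class_length G S \<kappa> \<le> n}"

definition growth_le :: "(nat \<Rightarrow> nat) \<Rightarrow> (nat \<Rightarrow> nat) \<Rightarrow> bool" where
  "growth_le f g \<longleftrightarrow> (\<exists>l::nat. l > 1 \<and> (\<forall>n. f n \<le> l * g (l * n) + l))"

definition growth_equiv :: "(nat \<Rightarrow> nat) \<Rightarrow> (nat \<Rightarrow> nat) \<Rightarrow> bool" where
  "growth_equiv f g \<longleftrightarrow> growth_le f g \<and> growth_le g f"

text \<open>The growth function of a group is only defined up to \<^const>\<open>growth_equiv\<close>, so two
  groups are compared through all their finite generating sets. Finite generation is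
  part of the definition, so that it never holds vacuously.\<close>

definition equiv_conj_growth ::
    "('a, 'b) monoid_scheme \<Rightarrow> ('c, 'd) monoid_scheme \<Rightarrow> bool" where
  "equiv_conj_growth G H \<longleftrightarrow>
     finitely_generated G \<and> finitely_generated H \<and>
     (\<forall>S T. fin_gen_set G S \<longrightarrow> fin_gen_set H T \<longrightarrow>
        growth_equiv (conj_growth G S) (conj_growth H T))"

end

(* For a finite index subgroup H of G the bound for c_H in terms of c_G is the easy one: a conjugacy
   class of G splits into at most [G:H] classes of H.  For the converse let w generate [H,H]. Pass
   to a normal subgroup N of finite index in G which lies in H and for which N/<z> is torsion-free,
   where <z> is the intersection of <w> with N; commutators in N are z^(om x y) for a form om with
   integer values.  Fix a coset tN, let psi be conjugation by t, and let k be such that all k-th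
   powers lie in N.  If psi inverts z, every element of tN/<z> carries at most two classes.
   Otherwise z commutes with tN.  Up to finitely many choices, g in tN is determined up to
   conjugacy and a factor z^j by the image of g^k in N/<z>, and |j| is at most quadratic in the
   length n.  To absorb j into elements of N of length O(n), use g^k u^p v^q with j = p(n+1) + q
   whenever om u v is nonzero and all the elements g^k pair equally with u, and with v; this works
   if psi acts nontrivially on N modulo its centre, and also for those g that commute with all the
   norms of N under psi.  For the remaining g the class only depends on j modulo some number of
   size O(n); then either g^k u^j with u = psi(y) y^-1 separates the classes or, if psi acts
   trivially on N/<z>, the H-class of g^(k^2) z^j does. *)
theory Submission
  imports Defs
begin

section \<open>Word balls and subgroups of finite index\<close>

text \<open>The obstacle is that the \<open>H\<close>-class of an \<open>x\<close> in
  \<open>N\<close> fixes the image of \<open>x\<close> in \<open>N/<z>\<close>, but the exponent of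
  \<open>z\<close> only modulo the commutators of \<open>x\<close> with \<open>H\<close>; so
  \<open>z^j\<close> alone cannot in general carry the offset \<open>j\<close>. It has to be encoded
  in the image modulo \<open><z>\<close>, on top of \<open>g^k\<close>, and then be separated from
  an unknown \<open>g^k\<close>. This dictates the auxiliary elements: either all \<open>g^k\<close>
  in question pair equally with them, or the norm of \<open>psi\<close> kills them while it
  multiplies \<open>g^k\<close> by \<open>k\<close>. The finitely many choices come from the
  cohomology of a finite cyclic group: two elements of \<open>tN\<close> with the same
  \<open>k\<close>-th power modulo \<open><z>\<close> differ by a vector of norm zero, and
  \<open>k\<close> times such a vector lies in the image of \<open>psi - 1\<close>. The conjugator
  found in this way is explicit and of length O(n). Since \<open><z>\<close> is at most
  quadratically distorted, this is the source of the quadratic bound on \<open>|j|\<close>.\<close>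

definition prods :: "('a, 'b) monoid_scheme \<Rightarrow> 'a set \<Rightarrow> nat \<Rightarrow> 'a set" where
  "prods G Y n = {foldr (\<otimes>\<^bsub>G\<^esub>) ws \<one>\<^bsub>G\<^esub> | ws. set ws \<subseteq> Y \<and> length ws \<le> n}"

definition word_ball :: "('a, 'b) monoid_scheme \<Rightarrow> 'a set \<Rightarrow> nat \<Rightarrow> 'a set" where
  "word_ball G S n = prods G (S \<union> m_inv G ` S) n"

text \<open>Representatives may repeat a coset. Only their finiteness matters for chains of
  subgroups, cores and Schreier generators, so no index is computed.\<close>

definition fin_idx :: "('a, 'b) monoid_scheme \<Rightarrow> 'a set \<Rightarrow> bool" where
  "fin_idx G K \<longleftrightarrow>
     (\<exists>R. finite R \<and> R \<subseteq> carrier G \<and> (\<forall>g\<in>carrier G. \<exists>r\<in>R. \<exists>x\<in>K. g = x \<otimes>\<^bsub>G\<^esub> r))"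

lemma prods_mono: "m \<le> n \<Longrightarrow> prods G Y m \<subseteq> prods G Y n"
  unfolding prods_def using le_trans by blast

lemma finite_prods: assumes "finite Y" shows "finite (prods G Y n)"
proof -
  have "prods G Y n = (\<lambda>ws. foldr (\<otimes>\<^bsub>G\<^esub>) ws \<one>\<^bsub>G\<^esub>) ` {ws. set ws \<subseteq> Y \<and> length ws \<le> n}"
    by (auto simp: prods_def)
  then show ?thesis using finite_lists_length_le[OF assms] by simp
qed

lemma finite_word_ball: "finite S \<Longrightarrow> finite (word_ball G S n)"
  by (simp add: word_ball_def finite_prods)

lemma word_ball_mono: "m \<le> n \<Longrightarrow> word_ball G S m \<subseteq> word_ball G S n"
  by (simp add: word_ball_def prods_mono)

context group
begin

lemma mult_inv_cancel: "x \<in> carrier G \<Longrightarrow> y \<in> carrier G \<Longrightarrow> x \<otimes> (inv x \<otimes> y) = y"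
  by (simp add: m_assoc[symmetric])

lemma inv_mult_cancel: "x \<in> carrier G \<Longrightarrow> y \<in> carrier G \<Longrightarrow> inv x \<otimes> (x \<otimes> y) = y"
  by (simp add: m_assoc[symmetric])

lemmas word_simps = m_assoc inv_mult_group mult_inv_cancel inv_mult_cancel

lemma foldr_mult_closed: "set xs \<subseteq> carrier G \<Longrightarrow> foldr (\<otimes>) xs \<one> \<in> carrier G"
  by (induction xs) auto

lemma foldr_mult_append:
  "set xs \<subseteq> carrier G \<Longrightarrow> set ys \<subseteq> carrier G \<Longrightarrow>
   foldr (\<otimes>) (xs @ ys) \<one> = foldr (\<otimes>) xs \<one> \<otimes> foldr (\<otimes>) ys \<one>"
proof (induction xs)
  case Nil
  then show ?case using foldr_mult_closed[of ys] by simp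
next
  case (Cons a xs)
  then show ?case using foldr_mult_closed[of ys] foldr_mult_closed[of xs] by (simp add: m_assoc)
qed

lemma prods_closed: "Y \<subseteq> carrier G \<Longrightarrow> x \<in> prods G Y n \<Longrightarrow> x \<in> carrier G"
  using foldr_mult_closed by (auto simp: prods_def)

lemma one_in_prods: "\<one> \<in> prods G Y n"
proof -
  have "\<one> = foldr (\<otimes>) [] \<one> \<and> set [] \<subseteq> Y \<and> length ([]::'a list) \<le> n" by simp
  then show ?thesis unfolding prods_def by blast
qed

lemma prods_incl: assumes "Y \<subseteq> carrier G" "y \<in> Y" "n \<ge> 1" shows "y \<in> prods G Y n"
proof -
  have "y = foldr (\<otimes>) [y] \<one> \<and> set [y] \<subseteq> Y \<and> length [y] \<le> n" using assms by auto
  then show ?thesis unfolding prods_def by blast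
qed

lemma prods_mult:
  assumes "Y \<subseteq> carrier G" "x \<in> prods G Y m" "y \<in> prods G Y n"
  shows "x \<otimes> y \<in> prods G Y (m + n)"
proof -
  obtain xs where xs: "x = foldr (\<otimes>) xs \<one>" "set xs \<subseteq> Y" "length xs \<le> m"
    using assms by (auto simp: prods_def)
  obtain ys where ys: "y = foldr (\<otimes>) ys \<one>" "set ys \<subseteq> Y" "length ys \<le> n"
    using assms by (auto simp: prods_def)
  have "x \<otimes> y = foldr (\<otimes>) (xs @ ys) \<one> \<and> set (xs @ ys) \<subseteq> Y \<and> length (xs @ ys) \<le> m + n"
    using xs ys assms(1) foldr_mult_append[of xs ys] by (auto simp del: foldr_append)
  then show ?thesis unfolding prods_def by blast
qed

lemma prods_Suc_cases:
  assumes "Y \<subseteq> carrier G" "x \<in> prods G Y (Suc n)"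
  obtains "x \<in> prods G Y n" | x' y where "x' \<in> prods G Y n" "y \<in> Y" "x = x' \<otimes> y"
proof -
  obtain ws where ws: "x = foldr (\<otimes>) ws \<one>" "set ws \<subseteq> Y" "length ws \<le> Suc n"
    using assms by (auto simp: prods_def)
  show thesis
  proof (cases ws rule: rev_cases)
    case Nil
    then show thesis using ws one_in_prods that(1) by simp
  next
    case (snoc vs v)
    have "x = foldr (\<otimes>) vs \<one> \<otimes> v"
      using ws snoc assms(1) foldr_mult_append[of vs "[v]"] by (auto simp del: foldr_append)
    moreover have "foldr (\<otimes>) vs \<one> \<in> prods G Y n" using ws snoc by (auto simp: prods_def)
    ultimately show thesis using that(2) ws snoc by auto
  qed
qed

text \<open>The case \<open>mono\<close> is there because \<open>prods\<close> bounds the length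
  from above: an element of radius \<open>Suc n\<close> either has a last letter to split off or is
  already of radius \<open>n\<close>.\<close>

lemma prods_induct [consumes 2, case_names one step mono]:
  assumes "Y \<subseteq> carrier G" "x \<in> prods G Y n"
    and "\<And>n. P n \<one>"
    and "\<And>n x y. x \<in> prods G Y n \<Longrightarrow> P n x \<Longrightarrow> y \<in> Y \<Longrightarrow> P (Suc n) (x \<otimes> y)"
    and mono: "\<And>n x. P n x \<Longrightarrow> P (Suc n) x"
  shows "P n x"
  using assms(2)
proof (induction n arbitrary: x)
  case 0
  then have "x = \<one>" by (auto simp: prods_def)
  then show ?case using assms(3) by simp
next
  case (Suc n)
  show ?case
    by (rule prods_Suc_cases[OF assms(1) Suc.prems]) (use Suc.IH assms(4) mono in auto)
qed

lemma word_ball_gens: "S \<subseteq> carrier G \<Longrightarrow> S \<union> m_inv G ` S \<subseteq> carrier G"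
  by auto

lemma word_ball_closed: "S \<subseteq> carrier G \<Longrightarrow> x \<in> word_ball G S n \<Longrightarrow> x \<in> carrier G"
  unfolding word_ball_def using prods_closed[OF word_ball_gens] by blast

lemma one_in_word_ball: "\<one> \<in> word_ball G S n"
  by (simp add: word_ball_def one_in_prods)

lemma word_ball_mult:
  "S \<subseteq> carrier G \<Longrightarrow> x \<in> word_ball G S m \<Longrightarrow> y \<in> word_ball G S n \<Longrightarrow>
   x \<otimes> y \<in> word_ball G S (m + n)"
  unfolding word_ball_def using prods_mult[OF word_ball_gens] by blast

lemma word_ball_inv:
  assumes "S \<subseteq> carrier G" "x \<in> word_ball G S n"
  shows "inv x \<in> word_ball G S n"
  using word_ball_gens[OF assms(1)] assms(2)[unfolded word_ball_def]
proof (induction rule: prods_induct)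
  case (one n)
  then show ?case by (simp add: one_in_word_ball)
next
  case (step n x y)
  have c: "x \<in> carrier G" "y \<in> carrier G"
    using step assms(1) prods_closed[OF word_ball_gens[OF assms(1)]] by auto
  have "inv y \<in> S \<union> m_inv G ` S" using step assms(1) by auto
  then have "inv y \<in> word_ball G S 1" unfolding word_ball_def
    using prods_incl[OF word_ball_gens[OF assms(1)]] by auto
  then have "inv y \<otimes> inv x \<in> word_ball G S (1 + n)" using step word_ball_mult assms(1) by blast
  then show ?case using c by (simp add: inv_mult_group)
next
  case (mono n x)
  then show ?case using word_ball_mono[of n "Suc n" G S] by auto
qed

lemma word_ball_pow:
  assumes "S \<subseteq> carrier G" "x \<in> word_ball G S m"
  shows "x [^] (i::nat) \<in> word_ball G S (m * i)"
proof (induction i)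
  case 0
  then show ?case by (simp add: one_in_word_ball)
next
  case (Suc i)
  then show ?case using word_ball_mult[OF assms(1) Suc assms(2)] by (simp add: add.commute)
qed

lemma word_ball_int_pow:
  assumes "S \<subseteq> carrier G" "x \<in> word_ball G S m"
  shows "x [^] (i::int) \<in> word_ball G S (m * nat \<bar>i\<bar>)"
proof (cases "i \<ge> 0")
  case True
  then obtain k where "i = int k" using nonneg_int_cases by blast
  then show ?thesis using word_ball_pow[OF assms, of k] by (simp add: int_pow_int)
next
  case False
  then obtain k where "i = - int k" by (metis int_cases4 nle_le of_nat_0_le_iff)
  then show ?thesis
    using word_ball_inv[OF assms(1) word_ball_pow[OF assms, of k]] word_ball_closed[OF assms]
    by (simp add: int_pow_neg_int)
qed

lemma ex_word_ball:
  assumes "S \<subseteq> carrier G" "x \<in> generate G S"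
  shows "\<exists>n. x \<in> word_ball G S n"
  using assms(2)
proof (induction rule: generate.induct)
  case one
  then show ?case using one_in_word_ball by blast
next
  case (incl h)
  then show ?case unfolding word_ball_def
    using prods_incl[OF word_ball_gens[OF assms(1)], of h 1] by blast
next
  case (inv h)
  then show ?case unfolding word_ball_def
    using prods_incl[OF word_ball_gens[OF assms(1)], of "inv h" 1] by blast
next
  case (eng h1 h2)
  then show ?case using word_ball_mult[OF assms(1)] by blast
qed

lemma ex_word_ball_finite:
  assumes "S \<subseteq> carrier G" "generate G S = carrier G" "finite A" "A \<subseteq> carrier G"
  shows "\<exists>n. A \<subseteq> word_ball G S n"
  using assms(3,4)
proof (induction rule: finite_induct)
  case empty
  then show ?case by simp
next
  case (insert x A)
  then obtain n where n: "A \<subseteq> word_ball G S n" by auto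
  obtain m where m: "x \<in> word_ball G S m"
    using ex_word_ball[OF assms(1), of x] assms(2) insert.prems by auto
  show ?case
    using n m word_ball_mono[of n "max m n" G S] word_ball_mono[of m "max m n" G S]
    by (intro exI[of _ "max m n"]) auto
qed

section \<open>Conjugacy growth as a count over word balls\<close>

lemma word_length_le_iff:
  assumes "S \<subseteq> carrier G" "generate G S = carrier G" "g \<in> carrier G"
  shows "word_length G S g \<le> n \<longleftrightarrow> g \<in> word_ball G S n"
proof -
  let ?P = "\<lambda>n. \<exists>ws. set ws \<subseteq> S \<union> m_inv G ` S \<and> length ws = n \<and> foldr (\<otimes>) ws \<one> = g"
  have ball: "g \<in> word_ball G S n \<longleftrightarrow> (\<exists>m\<le>n. ?P m)" for n
    by (auto simp: word_ball_def prods_def)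
  obtain m where "?P m" using ex_word_ball[OF assms(1)] assms(2,3) ball by blast
  then have "?P (word_length G S g)" unfolding word_length_def by (rule LeastI)
  moreover have "word_length G S g \<le> m" if "?P m" for m
    unfolding word_length_def using that by (rule Least_le)
  ultimately show ?thesis using ball le_trans by blast
qed

lemma conj_class_self: assumes "g \<in> carrier G" shows "g \<in> conj_class G g"
proof -
  have "g = \<one> \<otimes> g \<otimes> inv \<one>" using assms by simp
  then show ?thesis unfolding conj_class_def by blast
qed

lemma conj_class_subset: "g \<in> carrier G \<Longrightarrow> conj_class G g \<subseteq> carrier G"
  by (auto simp: conj_class_def)

lemma conj_class_eq_iff:
  assumes "g \<in> carrier G" "h \<in> carrier G"
  shows "conj_class G g = conj_class G h \<longleftrightarrow> (\<exists>x\<in>carrier G. h = x \<otimes> g \<otimes> inv x)"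
proof
  assume "conj_class G g = conj_class G h"
  then show "\<exists>x\<in>carrier G. h = x \<otimes> g \<otimes> inv x"
    using conj_class_self[OF assms(2)] by (auto simp: conj_class_def)
next
  assume "\<exists>x\<in>carrier G. h = x \<otimes> g \<otimes> inv x"
  then obtain x where x: "x \<in> carrier G" "h = x \<otimes> g \<otimes> inv x" by blast
  have 1: "y \<otimes> h \<otimes> inv y = (y \<otimes> x) \<otimes> g \<otimes> inv (y \<otimes> x)" if "y \<in> carrier G" for y
    using x that assms by (simp add: m_assoc inv_mult_group)
  have 2: "y \<otimes> g \<otimes> inv y = (y \<otimes> inv x) \<otimes> h \<otimes> inv (y \<otimes> inv x)" if "y \<in> carrier G" for y
    using x that assms by (simp add: word_simps)
  show "conj_class G g = conj_class G h"
  proof (intro equalityI subsetI)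
    fix u assume "u \<in> conj_class G g"
    then obtain y where "y \<in> carrier G" "u = y \<otimes> g \<otimes> inv y" by (auto simp: conj_class_def)
    then show "u \<in> conj_class G h" using 2[of y] x(1) unfolding conj_class_def by auto
  next
    fix u assume "u \<in> conj_class G h"
    then obtain y where "y \<in> carrier G" "u = y \<otimes> h \<otimes> inv y" by (auto simp: conj_class_def)
    then show "u \<in> conj_class G g" using 1[of y] x(1) unfolding conj_class_def by auto
  qed
qed

text \<open>The minimum that defines the length of a class is attained, so a class has length at
  most \<open>n\<close> exactly if it meets the ball of radius \<open>n\<close>. From here on only
  balls are used, no lengths.\<close>

lemma conj_growth_eq:
  assumes "fin_gen_set G S"
  shows "conj_growth G S n = card (conj_class G ` word_ball G S n)"
proof -
  have S: "S \<subseteq> carrier G" "generate G S = carrier G" using assms by (auto simp: fin_gen_set_def)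
  have len: "conj_class_length G S (conj_class G g) \<le> n \<longleftrightarrow>
      (\<exists>h\<in>conj_class G g. h \<in> word_ball G S n)" if g: "g \<in> carrier G" for g
  proof
    assume le: "conj_class_length G S (conj_class G g) \<le> n"
    have "\<exists>m. \<exists>h\<in>conj_class G g. word_length G S h = m" using conj_class_self[OF g] by blast
    then have "\<exists>h\<in>conj_class G g. word_length G S h = conj_class_length G S (conj_class G g)"
      unfolding conj_class_length_def by (rule LeastI_ex)
    then obtain h where "h \<in> conj_class G g" "word_length G S h \<le> n" using le by auto
    then show "\<exists>h\<in>conj_class G g. h \<in> word_ball G S n"
      using word_length_le_iff[OF S] conj_class_subset[OF g] by blast
  next
    assume "\<exists>h\<in>conj_class G g. h \<in> word_ball G S n"
    then obtain h where h: "h \<in> conj_class G g" "word_length G S h \<le> n"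
      using word_length_le_iff[OF S] conj_class_subset[OF g] by blast
    then have "conj_class_length G S (conj_class G g) \<le> word_length G S h"
      unfolding conj_class_length_def by (intro Least_le) blast
    then show "conj_class_length G S (conj_class G g) \<le> n" using h by simp
  qed
  have "{\<kappa> \<in> conj_classes G. conj_class_length G S \<kappa> \<le> n} = conj_class G ` word_ball G S n"
  proof (intro equalityI subsetI)
    fix \<kappa> assume "\<kappa> \<in> {\<kappa> \<in> conj_classes G. conj_class_length G S \<kappa> \<le> n}"
    then obtain g where g: "g \<in> carrier G" "\<kappa> = conj_class G g" "conj_class_length G S \<kappa> \<le> n"
      by (auto simp: conj_classes_def)
    then obtain h where h: "h \<in> conj_class G g" "h \<in> word_ball G S n" using len by blast
    then have "conj_class G g = conj_class G h"
      using conj_class_eq_iff[OF g(1)] conj_class_subset[OF g(1)] by (auto simp: conj_class_def)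
    then show "\<kappa> \<in> conj_class G ` word_ball G S n" using g h by blast
  next
    fix \<kappa> assume "\<kappa> \<in> conj_class G ` word_ball G S n"
    then obtain g where g: "g \<in> word_ball G S n" "\<kappa> = conj_class G g" by blast
    then have "g \<in> carrier G" using word_ball_closed[OF S(1)] by blast
    then show "\<kappa> \<in> {\<kappa> \<in> conj_classes G. conj_class_length G S \<kappa> \<le> n}"
      using len conj_class_self g by (auto simp: conj_classes_def)
  qed
  then show ?thesis by (simp add: conj_growth_def)
qed

lemma word_ball_subgroup:
  assumes "subgroup H G" "T \<subseteq> H"
  shows "word_ball (G\<lparr>carrier := H\<rparr>) T n = word_ball G T n"
proof -
  have "m_inv (G\<lparr>carrier := H\<rparr>) ` T = m_inv G ` T"
    using m_inv_consistent[OF assms(1)] assms(2) by (intro image_cong) auto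
  then show ?thesis by (simp add: word_ball_def prods_def)
qed

lemma conj_class_subgroup:
  assumes "subgroup H G"
  shows "conj_class (G\<lparr>carrier := H\<rparr>) x = (\<lambda>h. h \<otimes> x \<otimes> inv h) ` H"
proof -
  have "conj_class (G\<lparr>carrier := H\<rparr>) x = (\<lambda>h. h \<otimes> x \<otimes> inv\<^bsub>G\<lparr>carrier := H\<rparr>\<^esub> h) ` H"
    unfolding conj_class_def by (simp add: setcompr_eq_image)
  also have "\<dots> = (\<lambda>h. h \<otimes> x \<otimes> inv h) ` H"
    by (rule image_cong) (simp_all add: m_inv_consistent[OF assms])
  finally show ?thesis .
qed

section \<open>Finite index: Schreier generators, powers and the normal core\<close>

lemma fin_idx_rcosets:
  assumes "subgroup H G" "finite (rcosets H)"
  shows "fin_idx G H"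
proof -
  let ?R = "(\<lambda>C. SOME r. r \<in> C) ` (rcosets H)"
  have rep: "(SOME r. r \<in> C) \<in> C" if C: "C \<in> rcosets H" for C
  proof -
    obtain a where "a \<in> carrier G" "C = H #> a" using C by (auto simp: RCOSETS_def)
    then have "a \<in> C" using rcos_self[OF _ assms(1)] by blast
    then show ?thesis by (rule someI)
  qed
  have sub: "C \<subseteq> carrier G" if "C \<in> rcosets H" for C
    using that r_coset_subset_G[OF subgroup.subset[OF assms(1)]] by (auto simp: RCOSETS_def)
  have "\<exists>r\<in>?R. \<exists>x\<in>H. g = x \<otimes> r" if g: "g \<in> carrier G" for g
  proof -
    let ?C = "H #> g"
    let ?r = "SOME r. r \<in> ?C"
    have C: "?C \<in> rcosets H" using g by (auto simp: RCOSETS_def)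
    then obtain x where x: "x \<in> H" "?r = x \<otimes> g" using rep[OF C] by (auto simp: r_coset_def)
    have "g = inv x \<otimes> ?r"
      using x g subgroup.mem_carrier[OF assms(1)] by (simp add: word_simps)
    then show ?thesis using C x subgroup.m_inv_closed[OF assms(1)] by blast
  qed
  then show ?thesis unfolding fin_idx_def using assms(2) rep sub
    by (intro exI[of _ ?R]) blast
qed

lemma fin_idx_finite_map:
  assumes "subgroup K G" "finite (f ` carrier G)"
    and "\<And>g h. g \<in> carrier G \<Longrightarrow> h \<in> carrier G \<Longrightarrow> f g = f h \<Longrightarrow> g \<otimes> inv h \<in> K"
  shows "fin_idx G K"
proof -
  define r where "r c = (SOME g. g \<in> carrier G \<and> f g = c)" for c
  have r: "r (f g) \<in> carrier G \<and> f (r (f g)) = f g" if "g \<in> carrier G" for g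
    unfolding r_def by (rule someI[of _ g]) (use that in auto)
  have "\<exists>s\<in>r ` (f ` carrier G). \<exists>x\<in>K. g = x \<otimes> s" if g: "g \<in> carrier G" for g
  proof -
    have "g \<otimes> inv (r (f g)) \<in> K" using assms(3) r g by simp
    moreover have "g = (g \<otimes> inv (r (f g))) \<otimes> r (f g)" using r g by (simp add: m_assoc)
    ultimately show ?thesis using g by blast
  qed
  then show ?thesis unfolding fin_idx_def using assms(2) r
    by (intro exI[of _ "r ` (f ` carrier G)"]) auto
qed

lemma fin_idx_trans:
  assumes "subgroup H G" "fin_idx G H" "K \<subseteq> H" "finite R" "R \<subseteq> H"
    and "\<And>h. h \<in> H \<Longrightarrow> \<exists>r\<in>R. \<exists>x\<in>K. h = x \<otimes> r"
  shows "fin_idx G K"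
proof -
  obtain Q where Q: "finite Q" "Q \<subseteq> carrier G"
    "\<And>g. g \<in> carrier G \<Longrightarrow> \<exists>r\<in>Q. \<exists>x\<in>H. g = x \<otimes> r"
    using assms(2) by (auto simp: fin_idx_def)
  have HG: "H \<subseteq> carrier G" using assms(1) by (rule subgroup.subset)
  let ?R = "(\<lambda>(r, q). r \<otimes> q) ` (R \<times> Q)"
  have "\<exists>r\<in>?R. \<exists>x\<in>K. g = x \<otimes> r" if g: "g \<in> carrier G" for g
  proof -
    obtain q h where q: "q \<in> Q" "h \<in> H" "g = h \<otimes> q" using Q(3)[OF g] by blast
    obtain r x where r: "r \<in> R" "x \<in> K" "h = x \<otimes> r" using assms(6)[OF q(2)] by blast
    have c: "q \<in> carrier G" "r \<in> carrier G" "x \<in> carrier G"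
      using q r Q(2) HG assms(3,5) by auto
    have "g = x \<otimes> (r \<otimes> q)" using q(3) r(3) c by (simp add: m_assoc)
    then show ?thesis using q(1) r(1,2) by force
  qed
  then show ?thesis unfolding fin_idx_def using assms(4) Q(1,2) assms(5) HG
    by (intro exI[of _ ?R]) (auto intro!: m_closed)
qed

text \<open>Rewriting a word from left to right produces one Schreier generator
  \<open>r s r'^-1\<close> per letter and leaves a coset representative at the end. If the whole
  word lies in \<open>K\<close>, so does this last representative; it is the additional letter in
  \<open>Suc n\<close>, and the reason why \<open>Y\<close> also contains the representatives in
  \<open>K\<close>.\<close>

lemma schreier:
  assumes K: "subgroup K G" "fin_idx G K" and S: "finite S" "S \<subseteq> carrier G"
  shows "\<exists>Y. finite Y \<and> Y \<subseteq> K \<and> (\<forall>n. K \<inter> word_ball G S n \<subseteq> prods G Y (Suc n))"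
proof -
  obtain R0 where R0: "finite R0" "R0 \<subseteq> carrier G"
    "\<And>g. g \<in> carrier G \<Longrightarrow> \<exists>r\<in>R0. \<exists>x\<in>K. g = x \<otimes> r"
    using K(2) by (auto simp: fin_idx_def)
  define R where "R = insert \<one> R0"
  let ?S = "S \<union> m_inv G ` S"
  define Y where "Y = K \<inter> (R \<union> (\<lambda>(r, s, r'). r \<otimes> s \<otimes> inv r') ` (R \<times> ?S \<times> R))"
  have R: "finite R" "R \<subseteq> carrier G" using R0 by (auto simp: R_def)
  have finY: "finite Y" unfolding Y_def using R S by auto
  have YK: "Y \<subseteq> K" by (auto simp: Y_def)
  have KG: "K \<subseteq> carrier G" using K(1) by (rule subgroup.subset)
  then have YG: "Y \<subseteq> carrier G" using YK by auto
  have key: "\<exists>r\<in>R. \<exists>h\<in>prods G Y n. g = h \<otimes> r" if "g \<in> word_ball G S n" for g n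
    using word_ball_gens[OF S(2)] that[unfolded word_ball_def]
  proof (induction rule: prods_induct)
    case (one n)
    then show ?case using one_in_prods by (force simp: R_def)
  next
    case (step n x s)
    then obtain r h where rh: "r \<in> R" "h \<in> prods G Y n" "x = h \<otimes> r" by blast
    have c: "r \<in> carrier G" "s \<in> carrier G" "h \<in> carrier G"
      using rh R step S prods_closed[OF YG] by auto
    obtain r' y where r': "r' \<in> R0" "y \<in> K" "r \<otimes> s = y \<otimes> r'" using R0(3)[of "r \<otimes> s"] c by auto
    have c': "r' \<in> carrier G" "y \<in> carrier G" using r' R0 KG by auto
    have "y = r \<otimes> s \<otimes> inv r'" using r' c c' by (simp add: m_assoc)
    moreover have "r' \<in> R" using r' by (simp add: R_def)
    ultimately have "y \<in> Y" unfolding Y_def using rh step r'(2) by force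
    then have "h \<otimes> y \<in> prods G Y (n + 1)" using prods_mult[OF YG rh(2) prods_incl[OF YG, of y 1]] by simp
    moreover have "x \<otimes> s = (h \<otimes> y) \<otimes> r'" using rh r' c c' by (simp add: m_assoc)
    ultimately show ?case using \<open>r' \<in> R\<close> by auto
  next
    case (mono n x)
    then show ?case using prods_mono[of n "Suc n" G Y] by auto
  qed
  have "K \<inter> word_ball G S n \<subseteq> prods G Y (Suc n)" for n
  proof
    fix g assume g: "g \<in> K \<inter> word_ball G S n"
    then obtain r h where rh: "r \<in> R" "h \<in> prods G Y n" "g = h \<otimes> r" using key by blast
    have hK: "h \<in> K" using YG rh(2)
    proof (induction rule: prods_induct)
      case (step n x y)
      then show ?case using YK subgroup.m_closed[OF K(1)] by blast
    qed (use subgroup.one_closed[OF K(1)] in auto)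
    have c: "r \<in> carrier G" "h \<in> carrier G" using rh R hK KG by auto
    have "r = inv h \<otimes> g" using rh c by (simp add: m_assoc[symmetric])
    then have "r \<in> K" using g hK subgroup.m_closed[OF K(1)] subgroup.m_inv_closed[OF K(1)] by auto
    then have "r \<in> Y" using rh by (simp add: Y_def)
    then show "g \<in> prods G Y (Suc n)" using prods_mult[OF YG rh(2) prods_incl[OF YG, of r 1]] rh by simp
  qed
  then show ?thesis using finY YK by blast
qed

text \<open>Subgroups of finite index are undistorted: the finitely many Schreier generators have
  bounded length over \<open>T\<close>, and at most \<open>n + 1\<close> of them are
  multiplied.\<close>

lemma word_ball_fin_idx_compare:
  assumes H: "subgroup H G" "fin_idx G H" and S: "finite S" "S \<subseteq> carrier G"
    and T: "T \<subseteq> H" "generate G T = H"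
  shows "\<exists>C. \<forall>n. H \<inter> word_ball G S n \<subseteq> word_ball G T (C * Suc n)"
proof -
  obtain Y where Y: "finite Y" "Y \<subseteq> H" "\<And>n. H \<inter> word_ball G S n \<subseteq> prods G Y (Suc n)"
    using schreier[OF H S] by blast
  have TG: "T \<subseteq> carrier G" using T subgroup.subset[OF H(1)] by auto
  have YG: "Y \<subseteq> carrier G" using Y subgroup.subset[OF H(1)] by auto
  have "\<exists>C. Y' \<subseteq> word_ball G T C" if "Y' \<subseteq> Y" for Y'
  proof -
    have "finite Y'" using that Y(1) finite_subset by blast
    then show ?thesis using that
    proof (induction rule: finite_induct)
      case (insert x A)
      then obtain n where n: "A \<subseteq> word_ball G T n" by auto
      have "x \<in> generate G T" using insert Y(2) T(2) by auto
      then obtain m where m: "x \<in> word_ball G T m" using ex_word_ball[OF TG] by blast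
      show ?case
        using n m word_ball_mono[of n "max m n" G T] word_ball_mono[of m "max m n" G T]
        by (intro exI[of _ "max m n"]) auto
    qed simp
  qed
  then obtain C where C: "Y \<subseteq> word_ball G T C" by blast
  have "x \<in> word_ball G T (C * n)" if "x \<in> prods G Y n" for x n
    using YG that
  proof (induction rule: prods_induct)
    case (one n)
    then show ?case by (rule one_in_word_ball)
  next
    case (step n x y)
    then show ?case using word_ball_mult[OF TG, of x "C * n" y C] C by (auto simp: add.commute)
  next
    case (mono n x)
    then show ?case using word_ball_mono[of "C * n" "C * Suc n" G T] by auto
  qed
  then show ?thesis using Y(3) by blast
qed

text \<open>By the pigeonhole principle two of the powers \<open>g^0, ..., g^(card R)\<close> lie in
  the same coset, so \<open>g^d\<close> is in \<open>K\<close> for some positive \<open>d\<close> up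
  to \<open>card R\<close>. The factorial is a common multiple of all these \<open>d\<close>, hence
  independent of \<open>g\<close>.\<close>

lemma fin_idx_power:
  assumes K: "subgroup K G" "fin_idx G K"
  shows "\<exists>k::nat. k > 0 \<and> (\<forall>g\<in>carrier G. g [^] k \<in> K)"
proof -
  obtain R where R: "finite R" "R \<subseteq> carrier G"
    "\<And>g. g \<in> carrier G \<Longrightarrow> \<exists>r\<in>R. \<exists>x\<in>K. g = x \<otimes> r"
    using K(2) by (auto simp: fin_idx_def)
  have KG: "K \<subseteq> carrier G" using K(1) by (rule subgroup.subset)
  have "g [^] (fact (card R) :: nat) \<in> K" if g: "g \<in> carrier G" for g
  proof -
    have "\<forall>i::nat. \<exists>r\<in>R. \<exists>x\<in>K. g [^] i = x \<otimes> r" using R(3) g by simp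
    then obtain \<rho> where \<rho>: "\<And>i::nat. \<rho> i \<in> R" "\<And>i::nat. \<exists>x\<in>K. g [^] i = x \<otimes> \<rho> i" by metis
    have "\<not> inj_on \<rho> {0..card R}"
    proof
      assume "inj_on \<rho> {0..card R}"
      then have "card {0..card R} \<le> card R"
        using card_inj_on_le[of \<rho> "{0..card R}" R] \<rho>(1) R(1) by auto
      then show False by simp
    qed
    then obtain i j where ij: "i < j" "j \<le> card R" "\<rho> i = \<rho> j"
      unfolding inj_on_def by (metis atLeastAtMost_iff linorder_neqE_nat)
    obtain x y where xy: "x \<in> K" "g [^] i = x \<otimes> \<rho> i" "y \<in> K" "g [^] j = y \<otimes> \<rho> i"
      using \<rho>(2) ij(3) by metis
    have c: "x \<in> carrier G" "y \<in> carrier G" "\<rho> i \<in> carrier G" using xy KG \<rho>(1) R by auto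
    have "g [^] j = g [^] (j - i) \<otimes> g [^] i" using nat_pow_mult[OF g, of "j - i" i] ij by simp
    then have "g [^] (j - i) \<otimes> x \<otimes> \<rho> i = y \<otimes> \<rho> i" using xy c g by (simp add: m_assoc)
    then have "g [^] (j - i) \<otimes> x = y" using c g by (simp add: r_cancel)
    then have "g [^] (j - i) = y \<otimes> inv x" using c g by (metis inv_solve_right nat_pow_closed)
    then have gi: "g [^] (j - i) \<in> K"
      using xy subgroup.m_closed[OF K(1)] subgroup.m_inv_closed[OF K(1)] by auto
    have "j - i dvd fact (card R)" using ij by (intro dvd_fact) auto
    then obtain m where m: "(fact (card R) :: nat) = (j - i) * m" by (auto elim: dvdE)
    have "(g [^] (j - i)) [^] m \<in> K" for m :: nat
      using gi by (induction m) (auto intro: subgroup.m_closed[OF K(1)] subgroup.one_closed[OF K(1)])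
    then show ?thesis using m g by (simp add: nat_pow_pow)
  qed
  then show ?thesis by (intro exI[of _ "fact (card R)"]) auto
qed

text \<open>The normal core, that is the intersection of all conjugates of \<open>K\<close>.\<close>

definition core :: "'a set \<Rightarrow> 'a set" where
  "core K = {x \<in> carrier G. \<forall>g\<in>carrier G. g \<otimes> x \<otimes> inv g \<in> K}"

lemma core_subset: assumes "subgroup K G" shows "core K \<subseteq> K"
proof
  fix x assume "x \<in> core K"
  then have "x \<in> carrier G" "\<one> \<otimes> x \<otimes> inv \<one> \<in> K" by (simp_all only: core_def) blast+
  then show "x \<in> K" by simp
qed

lemma subgroup_core: assumes K: "subgroup K G" shows "subgroup (core K) G"
proof
  show "core K \<subseteq> carrier G" by (auto simp: core_def)
  show "\<one> \<in> core K" using subgroup.one_closed[OF K] by (auto simp: core_def)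
next
  fix x y assume xy: "x \<in> core K" "y \<in> core K"
  have xyc: "x \<in> carrier G" "y \<in> carrier G" using xy by (auto simp: core_def)
  have "g \<otimes> (x \<otimes> y) \<otimes> inv g \<in> K" if "g \<in> carrier G" for g
  proof -
    have "g \<otimes> (x \<otimes> y) \<otimes> inv g = (g \<otimes> x \<otimes> inv g) \<otimes> (g \<otimes> y \<otimes> inv g)"
      using xyc that by (simp add: word_simps)
    then show ?thesis using xy that subgroup.m_closed[OF K] by (simp add: core_def)
  qed
  then show "x \<otimes> y \<in> core K" using xy by (simp add: core_def)
next
  fix x assume x: "x \<in> core K"
  have xc: "x \<in> carrier G" using x by (auto simp: core_def)
  have "g \<otimes> inv x \<otimes> inv g \<in> K" if "g \<in> carrier G" for g
  proof -
    have "g \<otimes> inv x \<otimes> inv g = inv (g \<otimes> x \<otimes> inv g)"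
      using xc that by (simp add: word_simps)
    then show ?thesis using x that subgroup.m_inv_closed[OF K] by (simp add: core_def)
  qed
  then show "inv x \<in> core K" using x by (simp add: core_def)
qed

lemma core_conj:
  assumes "x \<in> core K" "g \<in> carrier G"
  shows "g \<otimes> x \<otimes> inv g \<in> core K"
proof -
  have x: "x \<in> carrier G" using assms by (auto simp: core_def)
  have "h \<otimes> (g \<otimes> x \<otimes> inv g) \<otimes> inv h = (h \<otimes> g) \<otimes> x \<otimes> inv (h \<otimes> g)" if "h \<in> carrier G" for h
    using x assms(2) that by (simp add: word_simps)
  then show ?thesis using assms x by (simp add: core_def)
qed

text \<open>\<open>f g\<close> records how right multiplication by \<open>g\<close> permutes the
  cosets, in terms of the finite set \<open>R\<close>, so only finitely many values occur. If
  \<open>g\<close> and \<open>h\<close> act alike, then \<open>g h^-1\<close> is moved into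
  \<open>K\<close> by every conjugation with an \<open>r\<close> in \<open>R\<close>, hence by every
  conjugation.\<close>

lemma fin_idx_core:
  assumes K: "subgroup K G" "fin_idx G K"
  shows "fin_idx G (core K)"
proof -
  obtain R where R: "finite R" "R \<subseteq> carrier G"
    "\<And>g. g \<in> carrier G \<Longrightarrow> \<exists>r\<in>R. \<exists>x\<in>K. g = x \<otimes> r"
    using K(2) by (auto simp: fin_idx_def)
  have KG: "K \<subseteq> carrier G" using K(1) by (rule subgroup.subset)
  define \<rho> where "\<rho> g = (SOME r. r \<in> R \<and> (\<exists>x\<in>K. g = x \<otimes> r))" for g
  have \<rho>: "\<rho> g \<in> R \<and> (\<exists>x\<in>K. g = x \<otimes> \<rho> g)" if "g \<in> carrier G" for g
    unfolding \<rho>_def by (rule someI_ex) (use R(3)[OF that] in blast)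
  define f where "f g = (\<lambda>r\<in>R. \<rho> (r \<otimes> g))" for g
  have "f ` carrier G \<subseteq> (\<Pi>\<^sub>E r\<in>R. R)"
    using \<rho> R(2) unfolding f_def by auto
  then have fin: "finite (f ` carrier G)" using R(1) finite_PiE[of R "\<lambda>_. R"] finite_subset by blast
  have quot: "g \<otimes> inv h \<in> K" if gh: "g \<in> carrier G" "h \<in> carrier G" "\<rho> g = \<rho> h" for g h
  proof -
    obtain r where r: "r = \<rho> g" "r \<in> carrier G" using \<rho>[OF gh(1)] R(2) by blast
    obtain x where x: "x \<in> K" "g = x \<otimes> r" using \<rho>[OF gh(1)] r(1) by blast
    obtain y where y: "y \<in> K" "h = y \<otimes> r" using \<rho>[OF gh(2)] r(1) gh(3) by metis
    have c: "x \<in> carrier G" "y \<in> carrier G" using x y KG by auto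
    have "g \<otimes> inv h = x \<otimes> inv y" using c r(2) unfolding x(2) y(2) by (simp add: word_simps)
    then show ?thesis using x y subgroup.m_closed[OF K(1)] subgroup.m_inv_closed[OF K(1)] by auto
  qed
  have "g \<otimes> inv h \<in> core K" if gh: "g \<in> carrier G" "h \<in> carrier G" "f g = f h" for g h
  proof -
    have r: "r \<otimes> (g \<otimes> inv h) \<otimes> inv r \<in> K" if "r \<in> R" for r
    proof -
      have "\<rho> (r \<otimes> g) = \<rho> (r \<otimes> h)" using gh(3) that by (metis f_def restrict_apply')
      then have "(r \<otimes> g) \<otimes> inv (r \<otimes> h) \<in> K" using quot that R(2) gh by auto
      moreover have "(r \<otimes> g) \<otimes> inv (r \<otimes> h) = r \<otimes> (g \<otimes> inv h) \<otimes> inv r"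
        using that R(2) gh by (simp add: subset_iff inv_mult_group m_assoc)
      ultimately show ?thesis by simp
    qed
    have "a \<otimes> (g \<otimes> inv h) \<otimes> inv a \<in> K" if a: "a \<in> carrier G" for a
    proof -
      obtain r x where x: "r \<in> R" "x \<in> K" "a = x \<otimes> r" using R(3)[OF a] by blast
      have c: "x \<in> carrier G" "r \<in> carrier G" using x KG R by auto
      have "a \<otimes> (g \<otimes> inv h) \<otimes> inv a = x \<otimes> (r \<otimes> (g \<otimes> inv h) \<otimes> inv r) \<otimes> inv x"
        using x(3) c gh by (simp add: inv_mult_group m_assoc)
      then show ?thesis using r[OF x(1)] x subgroup.m_closed[OF K(1)] subgroup.m_inv_closed[OF K(1)] by auto
    qed
    then show ?thesis using gh by (simp add: core_def)
  qed
  then show ?thesis using fin_idx_finite_map[OF subgroup_core[OF K(1)] fin] by blast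
qed

end

section \<open>Coordinates in class 2 groups with cyclic commutators\<close>

text \<open>The order of the factors is that of the list, while exponents are indexed by the group
  elements and not by positions. This is why lists are required to be \<open>distinct\<close>
  later.\<close>

primrec prodpow :: "('a, 'b) monoid_scheme \<Rightarrow> 'a list \<Rightarrow> ('a \<Rightarrow> int) \<Rightarrow> 'a" where
  "prodpow G [] e = \<one>\<^bsub>G\<^esub>"
| "prodpow G (u # us) e = u [^]\<^bsub>G\<^esub> e u \<otimes>\<^bsub>G\<^esub> prodpow G us e"

lemma abs_sum_list_le:
  fixes e g :: "'a \<Rightarrow> int"
  assumes "\<And>v. v \<in> set vs \<Longrightarrow> \<bar>g v\<bar> \<le> C"
  shows "\<bar>\<Sum>v\<leftarrow>vs. e v * g v\<bar> \<le> C * (\<Sum>v\<leftarrow>vs. \<bar>e v\<bar>)"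
  using assms
proof (induction vs)
  case (Cons v vs)
  have "\<bar>e v * g v\<bar> \<le> \<bar>e v\<bar> * C" using Cons.prems by (simp add: abs_mult mult_left_mono)
  moreover have "\<bar>\<Sum>v\<leftarrow>vs. e v * g v\<bar> \<le> C * (\<Sum>v\<leftarrow>vs. \<bar>e v\<bar>)" using Cons by simp
  ultimately show ?case by (simp add: algebra_simps)
qed simp

context group
begin

lemma subgroup_nat_pow: "subgroup K G \<Longrightarrow> x \<in> K \<Longrightarrow> x [^] (i::nat) \<in> K"
  by (induction i) (auto intro: subgroup.m_closed subgroup.one_closed)

lemma subgroup_int_pow: "subgroup K G \<Longrightarrow> x \<in> K \<Longrightarrow> x [^] (i::int) \<in> K"
  by (metis subgroup_nat_pow int_pow_def2 subgroup.m_inv_closed)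

lemma prodpow_in_subgroup:
  assumes "subgroup K G" "\<And>u. u \<in> set us \<Longrightarrow> u [^] e u \<in> K"
  shows "prodpow G us e \<in> K"
  using assms(2) by (induction us) (auto intro: subgroup.m_closed[OF assms(1)] subgroup.one_closed[OF assms(1)])

lemma prodpow_cong: "(\<And>u. u \<in> set us \<Longrightarrow> e u = e' u) \<Longrightarrow> prodpow G us e = prodpow G us e'"
  by (induction us) auto

lemma prodpow_zero: "(\<And>u. u \<in> set us \<Longrightarrow> e u = 0) \<Longrightarrow> prodpow G us e = \<one>"
  by (induction us) auto

lemma prodpow_single:
  "distinct us \<Longrightarrow> t \<in> set us \<Longrightarrow> set us \<subseteq> carrier G \<Longrightarrow>
   prodpow G us (\<lambda>u. if u = t then a else 0) = t [^] a"
proof (induction us)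
  case (Cons u us)
  show ?case
  proof (cases "u = t")
    case True
    then have "prodpow G us (\<lambda>u. if u = t then a else 0) = \<one>"
      using Cons.prems by (intro prodpow_zero) auto
    then show ?thesis using True Cons.prems by simp
  next
    case False
    then have "t [^] a \<in> carrier G" using Cons.prems by auto
    then show ?thesis using False Cons by simp
  qed
qed simp

lemma prodpow_word_ball:
  assumes "S \<subseteq> carrier G" "\<And>u. u \<in> set us \<Longrightarrow> u \<in> word_ball G S C"
  shows "prodpow G us e \<in> word_ball G S (C * nat (\<Sum>u\<leftarrow>us. \<bar>e u\<bar>))"
  using assms(2)
proof (induction us)
  case Nil
  then show ?case by (simp add: one_in_word_ball)
next
  case (Cons u us)
  have nn: "0 \<le> (\<Sum>u\<leftarrow>us. \<bar>e u\<bar>)" by (rule sum_list_nonneg) auto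
  have "u [^] e u \<otimes> prodpow G us e \<in> word_ball G S (C * nat \<bar>e u\<bar> + C * nat (\<Sum>u\<leftarrow>us. \<bar>e u\<bar>))"
    using Cons word_ball_mult[OF assms(1)] word_ball_int_pow[OF assms(1)] by simp
  then show ?case using nn by (simp add: nat_add_distrib algebra_simps)
qed

text \<open>A homomorphism to the integers is bounded on the finitely many Schreier generators,
  hence Lipschitz for the word length of the ambient group, although it is defined on
  \<open>K\<close> only.\<close>

lemma hom_word_bound:
  fixes \<chi> :: "'a \<Rightarrow> int"
  assumes K: "subgroup K G" "fin_idx G K" and S: "finite S" "S \<subseteq> carrier G"
    and hom: "\<And>x y. x \<in> K \<Longrightarrow> y \<in> K \<Longrightarrow> \<chi> (x \<otimes> y) = \<chi> x + \<chi> y"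
  shows "\<exists>C::nat. \<forall>n. \<forall>x \<in> K \<inter> word_ball G S n. \<bar>\<chi> x\<bar> \<le> int (C * Suc n)"
proof -
  obtain Y where Y: "finite Y" "Y \<subseteq> K" "\<And>n. K \<inter> word_ball G S n \<subseteq> prods G Y (Suc n)"
    using schreier[OF K S] by blast
  have YG: "Y \<subseteq> carrier G" using Y subgroup.subset[OF K(1)] by auto
  define C where "C = (\<Sum>y\<in>Y. nat \<bar>\<chi> y\<bar>)"
  have C: "\<bar>\<chi> y\<bar> \<le> int C" if "y \<in> Y" for y
  proof -
    have "nat \<bar>\<chi> y\<bar> \<le> C" unfolding C_def using that Y(1) by (intro member_le_sum) auto
    then show ?thesis by linarith
  qed
  have "x \<in> K \<and> \<bar>\<chi> x\<bar> \<le> int (C * n)" if "x \<in> prods G Y n" for x n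
    using YG that
  proof (induction rule: prods_induct)
    case (one n)
    have "\<chi> (\<one> \<otimes> \<one>) = \<chi> \<one> + \<chi> \<one>" using hom subgroup.one_closed[OF K(1)] by blast
    then show ?case using subgroup.one_closed[OF K(1)] by simp
  next
    case (step n x y)
    have "y \<in> K" using step Y by auto
    moreover have "\<bar>\<chi> x + \<chi> y\<bar> \<le> int (C * n) + int C" using step C[of y] by linarith
    ultimately show ?case using step hom[of x y] subgroup.m_closed[OF K(1)] by (simp add: algebra_simps)
  next
    case (mono n x)
    then show ?case by (auto simp: algebra_simps intro: order_trans)
  qed
  then show ?thesis using Y(3) by blast
qed

end

text \<open>\<open>N\<close> is a subgroup of an ambient \<open>G\<close> so that the locale serves
  twice: for \<open>H\<close> with a generator \<open>w\<close> of its derived subgroup, and for a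
  smaller subgroup with a power of \<open>w\<close>. The commutators need only lie in
  \<open><z>\<close>, and \<open>z\<close> is central in \<open>N\<close> but not in
  \<open>G\<close>, where it may be inverted.\<close>

locale class2 = group G for G (structure) +
  fixes N :: "'a set" and z :: 'a
  assumes N: "subgroup N G"
    and z_in: "z \<in> N"
    and z_central: "x \<in> N \<Longrightarrow> x \<otimes> z = z \<otimes> x"
    and z_inf: "z [^] (i::int) = \<one> \<Longrightarrow> i = 0"
    and ex_comm: "x \<in> N \<Longrightarrow> y \<in> N \<Longrightarrow> \<exists>i::int. x \<otimes> y = y \<otimes> x \<otimes> z [^] i"
begin

lemma N_carrier [simp, intro]: "x \<in> N \<Longrightarrow> x \<in> carrier G"
  using subgroup.mem_carrier[OF N] .

lemma N_mult [simp, intro]: "x \<in> N \<Longrightarrow> y \<in> N \<Longrightarrow> x \<otimes> y \<in> N"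
  using subgroup.m_closed[OF N] .

lemma N_inv [simp, intro]: "x \<in> N \<Longrightarrow> inv x \<in> N"
  using subgroup.m_inv_closed[OF N] .

lemma N_one [simp, intro]: "\<one> \<in> N"
  using subgroup.one_closed[OF N] .

lemma N_nat_pow [simp, intro]: "x \<in> N \<Longrightarrow> x [^] (i::nat) \<in> N"
  using subgroup_nat_pow[OF N] .

lemma N_int_pow [simp, intro]: "x \<in> N \<Longrightarrow> x [^] (i::int) \<in> N"
  using subgroup_int_pow[OF N] .

lemma z_carrier [simp, intro]: "z \<in> carrier G"
  using z_in by simp

abbreviation zp :: "int \<Rightarrow> 'a" where "zp i \<equiv> z [^] i"

lemma zp_in [simp, intro]: "zp i \<in> N"
  using z_in by simp

lemma zp_add: "zp i \<otimes> zp j = zp (i + j)"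
  by (simp add: int_pow_mult)

lemma zp_inj: "zp i = zp j \<longleftrightarrow> i = j"
proof
  assume "zp i = zp j"
  then have "zp (i - j) = \<one>" by (simp add: int_pow_diff)
  then show "i = j" using z_inf by fastforce
qed simp

lemma zp_commute: assumes "x \<in> N" shows "zp i \<otimes> x = x \<otimes> zp i"
proof -
  have nat: "z [^] (m::nat) \<otimes> x = x \<otimes> z [^] m" for m
    using assms z_central[OF assms] by (intro group_commutes_pow) auto
  show ?thesis
  proof (cases "i \<ge> 0")
    case True
    then obtain m where "i = int m" using nonneg_int_cases by blast
    then show ?thesis using nat by (simp only: int_pow_int)
  next
    case False
    then obtain m where m: "i = - int m" by (metis int_cases4 nle_le of_nat_0_le_iff)
    have "inv (z [^] m) \<otimes> x = inv (z [^] m) \<otimes> (x \<otimes> z [^] m) \<otimes> inv (z [^] m)"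
      using assms by (simp add: word_simps)
    also have "\<dots> = inv (z [^] m) \<otimes> (z [^] m \<otimes> x) \<otimes> inv (z [^] m)" by (simp only: nat)
    also have "\<dots> = x \<otimes> inv (z [^] m)" using assms by (simp add: word_simps)
    finally show ?thesis by (simp add: m int_pow_neg_int)
  qed
qed

lemma mult_zp: assumes "x \<in> N" "y \<in> N" shows "(x \<otimes> zp i) \<otimes> (y \<otimes> zp j) = (x \<otimes> y) \<otimes> zp (i + j)"
proof -
  have "(x \<otimes> zp i) \<otimes> (y \<otimes> zp j) = x \<otimes> (zp i \<otimes> y) \<otimes> zp j" using assms by (simp add: m_assoc)
  also have "\<dots> = x \<otimes> (y \<otimes> zp i) \<otimes> zp j" using assms(2) by (simp only: zp_commute)
  also have "\<dots> = (x \<otimes> y) \<otimes> (zp i \<otimes> zp j)" using assms by (simp add: m_assoc)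
  finally show ?thesis by (simp only: zp_add)
qed

section \<open>The alternating commutator form with integer values\<close>

definition om :: "'a \<Rightarrow> 'a \<Rightarrow> int" where
  "om x y = (THE i. x \<otimes> y = y \<otimes> x \<otimes> zp i)"

lemma om_eqI:
  assumes "x \<in> N" "y \<in> N" "x \<otimes> y = y \<otimes> x \<otimes> zp i" shows "om x y = i"
  unfolding om_def
proof (rule the_equality)
  fix j assume "x \<otimes> y = y \<otimes> x \<otimes> zp j"
  then have "y \<otimes> x \<otimes> zp j = y \<otimes> x \<otimes> zp i" using assms by simp
  then have "zp j = zp i" using assms by (simp del: int_pow_closed add: l_cancel N_carrier)
  then show "j = i" by (simp add: zp_inj)
qed (fact assms(3))

lemma om: assumes "x \<in> N" "y \<in> N" shows "x \<otimes> y = y \<otimes> x \<otimes> zp (om x y)"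
  using ex_comm[OF assms] om_eqI[OF assms] by metis

lemma om_mult_left:
  assumes "x \<in> N" "x' \<in> N" "y \<in> N" shows "om (x \<otimes> x') y = om x y + om x' y"
proof (rule om_eqI)
  have "(x \<otimes> x') \<otimes> y = x \<otimes> (x' \<otimes> y)" using assms by (simp add: m_assoc)
  also have "\<dots> = (x \<otimes> y) \<otimes> (x' \<otimes> zp (om x' y))" using assms by (simp add: om[of x' y] m_assoc)
  also have "\<dots> = (y \<otimes> x \<otimes> zp (om x y)) \<otimes> (x' \<otimes> zp (om x' y))"
    using om[of x y] assms by simp
  also have "\<dots> = (y \<otimes> x \<otimes> x') \<otimes> zp (om x y + om x' y)" using assms by (simp only: mult_zp N_mult)
  finally show "(x \<otimes> x') \<otimes> y = y \<otimes> (x \<otimes> x') \<otimes> zp (om x y + om x' y)" using assms by (simp add: m_assoc)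
qed (use assms in auto)

lemma om_anti: assumes "x \<in> N" "y \<in> N" shows "om y x = - om x y"
proof (rule om_eqI)
  have "x \<otimes> y \<otimes> zp (- om x y) = y \<otimes> x \<otimes> zp (om x y) \<otimes> zp (- om x y)" by (simp only: om[OF assms])
  also have "\<dots> = y \<otimes> x" using assms by (simp add: m_assoc zp_add)
  finally show "y \<otimes> x = x \<otimes> y \<otimes> zp (- om x y)" by simp
qed (use assms in auto)

lemma om_mult_right:
  assumes "x \<in> N" "x' \<in> N" "y \<in> N" shows "om y (x \<otimes> x') = om y x + om y x'"
  using assms om_mult_left[of x x' y] om_anti[of x y] om_anti[of x' y] om_anti[of "x \<otimes> x'" y] by simp

lemma om_zp_left: "x \<in> N \<Longrightarrow> om (zp i) x = 0"
  by (rule om_eqI) (simp_all add: zp_commute)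

lemma om_one_left [simp]: "x \<in> N \<Longrightarrow> om \<one> x = 0"
  by (rule om_eqI) simp_all

lemma om_one_right [simp]: "x \<in> N \<Longrightarrow> om x \<one> = 0"
  by (rule om_eqI) simp_all

lemma om_inv_left: assumes "x \<in> N" "y \<in> N" shows "om (inv x) y = - om x y"
  using om_mult_left[of x "inv x" y] assms by simp

lemma om_inv_right: assumes "x \<in> N" "y \<in> N" shows "om y (inv x) = - om y x"
  using om_mult_right[of x "inv x" y] assms by simp

lemma om_nat_pow_left: "x \<in> N \<Longrightarrow> y \<in> N \<Longrightarrow> om (x [^] (m::nat)) y = int m * om x y"
  by (induction m) (simp_all add: om_mult_left algebra_simps)

lemma om_int_pow_left: assumes "x \<in> N" "y \<in> N" shows "om (x [^] (m::int)) y = m * om x y"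
proof (cases "m \<ge> 0")
  case True
  then obtain k where "m = int k" using nonneg_int_cases by blast
  then show ?thesis using om_nat_pow_left[OF assms] by (simp add: int_pow_int)
next
  case False
  then obtain k where "m = - int k" by (metis int_cases4 nle_le of_nat_0_le_iff)
  then show ?thesis using om_nat_pow_left[OF assms] assms by (simp add: int_pow_neg_int om_inv_left)
qed

lemma om_int_pow_right: "x \<in> N \<Longrightarrow> y \<in> N \<Longrightarrow> om y (x [^] (m::int)) = m * om y x"
  using om_int_pow_left[of x y m] om_anti[of "x [^] m" y] om_anti[of x y] by simp

lemma om_nat_pow_right: "x \<in> N \<Longrightarrow> y \<in> N \<Longrightarrow> om y (x [^] (m::nat)) = int m * om y x"
  using om_int_pow_right[of x y "int m"] by (simp add: int_pow_int)

lemma prodpow_in: "set us \<subseteq> N \<Longrightarrow> prodpow G us e \<in> N"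
  by (rule prodpow_in_subgroup[OF N]) auto

lemma om_prodpow_left:
  "set us \<subseteq> N \<Longrightarrow> y \<in> N \<Longrightarrow> om (prodpow G us e) y = (\<Sum>u\<leftarrow>us. e u * om u y)"
  by (induction us) (simp_all add: om_mult_left om_int_pow_left prodpow_in)

text \<open>Collecting equal letters moves each \<open>u^(e' u)\<close> to the left past the rest of
  the first product. By bilinearity each such move costs a power of \<open>z\<close> bounded by a
  product of exponents, which adds up to the product of the two l1 norms. This estimate is the
  source of the quadratic distortion of \<open><z>\<close>.\<close>

lemma prodpow_mult:
  assumes "set us \<subseteq> N" "\<And>u v. u \<in> set us \<Longrightarrow> v \<in> set us \<Longrightarrow> \<bar>om u v\<bar> \<le> C"
  shows "\<exists>b. prodpow G us e \<otimes> prodpow G us e' = prodpow G us (\<lambda>u. e u + e' u) \<otimes> zp b \<and>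
    \<bar>b\<bar> \<le> C * (\<Sum>u\<leftarrow>us. \<bar>e u\<bar>) * (\<Sum>u\<leftarrow>us. \<bar>e' u\<bar>)"
  using assms
proof (induction us)
  case Nil
  then show ?case by (intro exI[of _ 0]) simp
next
  case (Cons u us)
  let ?x = "prodpow G us e" and ?y = "prodpow G us e'" and ?w = "prodpow G us (\<lambda>u. e u + e' u)"
  let ?a = "e u" and ?b = "e' u"
  obtain b where b: "?x \<otimes> ?y = ?w \<otimes> zp b"
    "\<bar>b\<bar> \<le> C * (\<Sum>u\<leftarrow>us. \<bar>e u\<bar>) * (\<Sum>u\<leftarrow>us. \<bar>e' u\<bar>)" using Cons by auto
  have c: "u \<in> N" "?x \<in> N" "?y \<in> N" "?w \<in> N" using Cons.prems prodpow_in by auto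
  define m where "m = om ?x (u [^] ?b)"
  have "(u [^] ?a \<otimes> ?x) \<otimes> (u [^] ?b \<otimes> ?y) = u [^] ?a \<otimes> (?x \<otimes> u [^] ?b) \<otimes> ?y"
    using c by (simp add: m_assoc)
  also have "?x \<otimes> u [^] ?b = u [^] ?b \<otimes> ?x \<otimes> zp m" unfolding m_def using c by (intro om) auto
  also have "u [^] ?a \<otimes> (u [^] ?b \<otimes> ?x \<otimes> zp m) \<otimes> ?y
      = (u [^] ?a \<otimes> u [^] ?b) \<otimes> ((?x \<otimes> zp m) \<otimes> (?y \<otimes> zp 0))" using c by (simp add: m_assoc)
  also have "\<dots> = u [^] (?a + ?b) \<otimes> ((?x \<otimes> ?y) \<otimes> zp m)"
    using c by (simp only: mult_zp) (simp add: int_pow_mult)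
  also have "\<dots> = (u [^] (?a + ?b) \<otimes> ?w) \<otimes> zp (b + m)"
    unfolding b(1) using c by (simp add: m_assoc zp_add)
  finally have eq: "prodpow G (u # us) e \<otimes> prodpow G (u # us) e' =
      prodpow G (u # us) (\<lambda>u. e u + e' u) \<otimes> zp (b + m)" by simp
  have nn: "0 \<le> (\<Sum>u\<leftarrow>us. \<bar>f u\<bar>)" for f :: "'a \<Rightarrow> int" by (rule sum_list_nonneg) auto
  have "\<bar>om u u\<bar> \<le> C" using Cons.prems(2) by simp
  then have C0: "0 \<le> C" by linarith
  have "\<bar>om v u\<bar> \<le> C" if "v \<in> set us" for v using Cons.prems(2) that by simp
  then have "\<bar>\<Sum>v\<leftarrow>us. e v * om v u\<bar> \<le> C * (\<Sum>u\<leftarrow>us. \<bar>e u\<bar>)" by (rule abs_sum_list_le)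
  then have "\<bar>om ?x u\<bar> \<le> C * (\<Sum>u\<leftarrow>us. \<bar>e u\<bar>)"
    using om_prodpow_left[of us u e] Cons.prems(1) by simp
  then have "\<bar>?b\<bar> * \<bar>om ?x u\<bar> \<le> \<bar>?b\<bar> * (C * (\<Sum>u\<leftarrow>us. \<bar>e u\<bar>))" by (rule mult_left_mono) simp
  then have "\<bar>m\<bar> \<le> \<bar>?b\<bar> * (C * (\<Sum>u\<leftarrow>us. \<bar>e u\<bar>))"
    unfolding m_def om_int_pow_right[OF c(1,2)] by (simp only: abs_mult)
  then have "\<bar>b + m\<bar> \<le> C * (\<Sum>u\<leftarrow>us. \<bar>e u\<bar>) * (\<bar>?b\<bar> + (\<Sum>u\<leftarrow>us. \<bar>e' u\<bar>))"
    using b(2) by (simp add: algebra_simps)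
  also have "\<dots> \<le> C * (\<bar>?a\<bar> + (\<Sum>u\<leftarrow>us. \<bar>e u\<bar>)) * (\<bar>?b\<bar> + (\<Sum>u\<leftarrow>us. \<bar>e' u\<bar>))"
    using nn[of e] nn[of e'] C0 by (intro mult_right_mono mult_left_mono) auto
  finally show ?case using eq by (intro exI[of _ "b + m"]) simp
qed

lemma ex_om_bound: "finite U \<Longrightarrow> \<exists>C. \<forall>u\<in>U. \<forall>v\<in>U. \<bar>om u v\<bar> \<le> C"
proof -
  assume "finite U"
  then have fin: "finite ((\<lambda>(u, v). \<bar>om u v\<bar>) ` (U \<times> U))" by auto
  have "\<bar>om u v\<bar> \<le> Max ((\<lambda>(u, v). \<bar>om u v\<bar>) ` (U \<times> U))" if "u \<in> U" "v \<in> U" for u v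
    using that by (intro Max_ge[OF fin]) force
  then show ?thesis by blast
qed

lemma prodpow_mult_ex:
  assumes "set us \<subseteq> N"
  shows "\<exists>b. prodpow G us e \<otimes> prodpow G us e' = prodpow G us (\<lambda>u. e u + e' u) \<otimes> zp b"
proof -
  obtain C where "\<forall>u\<in>set us. \<forall>v\<in>set us. \<bar>om u v\<bar> \<le> C" using ex_om_bound[of "set us"] by blast
  then show ?thesis using prodpow_mult[OF assms, of C e e'] by auto
qed

section \<open>Lattices over \<open><z>\<close> and their coordinates\<close>

definition zlat :: "'a list \<Rightarrow> 'a set" where
  "zlat us = {prodpow G us e \<otimes> zp j | e j. True}"

lemma zlatI: "prodpow G us e \<otimes> zp j \<in> zlat us"
  by (auto simp: zlat_def)

lemma zlat_subset: "set us \<subseteq> N \<Longrightarrow> zlat us \<subseteq> N"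
  using prodpow_in by (auto simp: zlat_def)

lemma zp_zlat: "zp j \<in> zlat us"
  using zlatI[of us "\<lambda>_. 0" j] by (simp add: prodpow_zero)

lemma subgroup_zlat:
  assumes us: "set us \<subseteq> N" shows "subgroup (zlat us) G"
proof
  show "zlat us \<subseteq> carrier G" using zlat_subset[OF us] by auto
  show "\<one> \<in> zlat us" using zp_zlat[of 0] by simp
next
  fix x y assume "x \<in> zlat us" "y \<in> zlat us"
  then obtain e j e' j' where xy: "x = prodpow G us e \<otimes> zp j" "y = prodpow G us e' \<otimes> zp j'"
    by (auto simp: zlat_def)
  obtain b where b: "prodpow G us e \<otimes> prodpow G us e' = prodpow G us (\<lambda>u. e u + e' u) \<otimes> zp b"
    using prodpow_mult_ex[OF us] by blast
  have "x \<otimes> y = (prodpow G us e \<otimes> prodpow G us e') \<otimes> zp (j + j')"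
    unfolding xy using us by (simp only: mult_zp prodpow_in)
  also have "\<dots> = prodpow G us (\<lambda>u. e u + e' u) \<otimes> zp (b + (j + j'))"
    unfolding b using us by (simp add: m_assoc zp_add prodpow_in)
  finally show "x \<otimes> y \<in> zlat us" using zlatI by simp
next
  fix x assume "x \<in> zlat us"
  then obtain e j where x: "x = prodpow G us e \<otimes> zp j" by (auto simp: zlat_def)
  obtain b where b: "prodpow G us e \<otimes> prodpow G us (\<lambda>u. - e u) = prodpow G us (\<lambda>u. e u + - e u) \<otimes> zp b"
    using prodpow_mult_ex[OF us] by blast
  have z: "prodpow G us (\<lambda>u. e u + - e u) = \<one>" by (rule prodpow_zero) simp
  have "x \<otimes> (prodpow G us (\<lambda>u. - e u) \<otimes> zp (- j - b)) = \<one>"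
    unfolding x using us b z by (simp only: mult_zp prodpow_in) (simp add: zp_add)
  then have "inv x = prodpow G us (\<lambda>u. - e u) \<otimes> zp (- j - b)"
    using us x by (intro inv_equality[OF inv_comm]) (auto simp: prodpow_in)
  then show "inv x \<in> zlat us" using zlatI by simp
qed

text \<open>Linear independence over the integers of the images in the abelian group
  \<open>N/<z>\<close>, so \<open>zlat us\<close> modulo \<open><z>\<close> is free abelian on
  \<open>us\<close>.\<close>

definition indep :: "'a list \<Rightarrow> bool" where
  "indep us \<longleftrightarrow> distinct us \<and> set us \<subseteq> N \<and>
     (\<forall>e j. prodpow G us e = zp j \<longrightarrow> (\<forall>u\<in>set us. e u = 0))"

lemma indep_unique:
  assumes "indep us" "prodpow G us e \<otimes> zp i = prodpow G us e' \<otimes> zp j"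
  shows "(\<forall>u\<in>set us. e u = e' u) \<and> i = j"
proof -
  have us: "set us \<subseteq> N" using assms(1) by (simp add: indep_def)
  let ?m = "\<lambda>u. - e' u"
  obtain b where b: "prodpow G us e \<otimes> prodpow G us ?m = prodpow G us (\<lambda>u. e u + ?m u) \<otimes> zp b"
    using prodpow_mult_ex[OF us] by blast
  obtain b' where b': "prodpow G us e' \<otimes> prodpow G us ?m = prodpow G us (\<lambda>u. e' u + ?m u) \<otimes> zp b'"
    using prodpow_mult_ex[OF us] by blast
  have z: "prodpow G us (\<lambda>u. e' u + ?m u) = \<one>" by (rule prodpow_zero) simp
  have c: "prodpow G us f \<in> N" for f using prodpow_in[OF us] .
  have "(prodpow G us e \<otimes> zp i) \<otimes> (prodpow G us ?m \<otimes> zp 0) =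
      (prodpow G us e' \<otimes> zp j) \<otimes> (prodpow G us ?m \<otimes> zp 0)" using assms(2) by simp
  then have "(prodpow G us (\<lambda>u. e u + ?m u) \<otimes> zp b) \<otimes> zp i = zp b' \<otimes> zp j"
    using c z by (simp only: mult_zp b b') (simp add: zp_add)
  then have "prodpow G us (\<lambda>u. e u + ?m u) \<otimes> zp (b + i) = zp (b' + j)"
    using c by (simp add: m_assoc zp_add)
  then have "prodpow G us (\<lambda>u. e u + ?m u) \<otimes> zp (b + i) \<otimes> zp (-(b + i)) = zp (b' + j) \<otimes> zp (-(b + i))" by simp
  then have "prodpow G us (\<lambda>u. e u + ?m u) = zp (b' + j + - (b + i))"
    using c by (simp only: m_assoc zp_add N_carrier zp_in) simp
  then have e: "\<forall>u\<in>set us. e u = e' u" using assms(1) unfolding indep_def by fastforce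
  then have "prodpow G us e = prodpow G us e'" by (intro prodpow_cong) auto
  then have "zp i = zp j" using assms(2) c by simp
  then show ?thesis using e by (simp add: zp_inj)
qed

lemma generate_zlat:
  assumes "set ts \<subseteq> N" "distinct ts"
  shows "generate G (set ts) \<subseteq> zlat ts"
proof (rule generate_subgroup_incl[OF _ subgroup_zlat[OF assms(1)]])
  show "set ts \<subseteq> zlat ts"
  proof
    fix t assume t: "t \<in> set ts"
    then have "prodpow G ts (\<lambda>u. if u = t then 1 else 0) \<otimes> zp 0 = t"
      using prodpow_single[of ts t 1] assms by (auto simp: subset_iff)
    then show "t \<in> zlat ts" using zlatI by metis
  qed
qed

text \<open>Take a longest independent list in \<open>T\<close>. Adding any other \<open>s\<close>
  creates a relation in which \<open>s\<close> has a nonzero exponent, so a power of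
  \<open>s\<close> falls into the lattice. The product of these exponents over \<open>T\<close>
  works for all elements at once.\<close>

lemma ex_maximal_indep:
  assumes T: "finite T" "T \<subseteq> N"
  shows "\<exists>us m. indep us \<and> set us \<subseteq> T \<and> m > 0 \<and> (\<forall>t\<in>T. t [^] (m::int) \<in> zlat us)"
proof -
  let ?P = "\<lambda>us. indep us \<and> set us \<subseteq> T"
  have "?P []" by (simp add: indep_def)
  moreover have "\<forall>us. ?P us \<longrightarrow> length us < Suc (card T)"
    using T by (metis card_mono distinct_card indep_def le_imp_less_Suc)
  ultimately obtain us where us: "?P us" "\<And>vs. ?P vs \<Longrightarrow> length vs \<le> length us"
    using ex_has_greatest_nat[of ?P "[]" length "Suc (card T)"] by blast
  have usN: "set us \<subseteq> N" using us by (simp add: indep_def)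
  have "\<exists>m::int. m > 0 \<and> s [^] m \<in> zlat us" if s: "s \<in> T" for s
  proof (cases "s \<in> set us")
    case True
    then have "s \<in> zlat us"
      using generate_zlat[OF usN] us(1) generate.incl[of s "set us" G] by (auto simp: indep_def)
    then show ?thesis using s T by (intro exI[of _ 1]) auto
  next
    case False
    have sN: "s \<in> N" using s T by auto
    have "\<not> indep (s # us)" using us(2)[of "s # us"] us(1) s by auto
    then obtain e j u where e: "prodpow G (s # us) e = zp j" "u \<in> set (s # us)" "e u \<noteq> 0"
      using False us(1) sN usN by (auto simp: indep_def)
    have es: "e s \<noteq> 0"
    proof
      assume "e s = 0"
      then have "prodpow G us e = zp j" using e(1) prodpow_in[OF usN, of e] by simp
      then show False using e us(1) \<open>e s = 0\<close> by (auto simp: indep_def)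
    qed
    have L: "subgroup (zlat us) G" by (rule subgroup_zlat[OF usN])
    have "prodpow G us e \<otimes> zp 0 \<in> zlat us" by (rule zlatI)
    then have W: "prodpow G us e \<in> zlat us" using prodpow_in[OF usN, of e] by simp
    have "s [^] e s = zp j \<otimes> inv (prodpow G us e)"
      using e(1) sN prodpow_in[OF usN, of e] by (auto simp: inv_solve_right)
    then have *: "s [^] e s \<in> zlat us"
      using W zp_zlat L subgroup.m_closed subgroup.m_inv_closed by metis
    have "s [^] \<bar>e s\<bar> \<in> zlat us"
    proof (cases "e s \<ge> 0")
      case False
      then have "s [^] \<bar>e s\<bar> = inv (s [^] e s)" using sN by (simp add: int_pow_neg)
      then show ?thesis using * subgroup.m_inv_closed[OF L] by simp
    qed (use * in simp)
    then show ?thesis using es by (intro exI[of _ "\<bar>e s\<bar>"]) simp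
  qed
  then obtain m :: "'a \<Rightarrow> int" where m: "\<And>s. s \<in> T \<Longrightarrow> m s > 0 \<and> s [^] m s \<in> zlat us" by metis
  have "t [^] (\<Prod>s\<in>T. m s) \<in> zlat us" if t: "t \<in> T" for t
  proof -
    have "(\<Prod>s\<in>T. m s) = m t * (\<Prod>s\<in>T-{t}. m s)" using t T by (simp add: prod.remove)
    then have "t [^] (\<Prod>s\<in>T. m s) = (t [^] m t) [^] (\<Prod>s\<in>T-{t}. m s)"
      using t T by (simp add: int_pow_pow subset_iff)
    then show ?thesis using m[OF t] subgroup_int_pow[OF subgroup_zlat[OF usN]] by simp
  qed
  moreover have "(\<Prod>s\<in>T. m s) > 0" using m by (intro prod_pos) auto
  ultimately show ?thesis using us(1) by blast
qed

text \<open>Divide all exponents over \<open>T\<close> by \<open>m\<close> with remainder: the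
  multiples of \<open>m\<close> give an element of the lattice, and there are only finitely many
  vectors of remainders to serve as representatives.\<close>

lemma fin_idx_zlat:
  assumes T: "finite T" "T \<subseteq> N" "generate G T = N" and fin: "fin_idx G N"
    and us: "set us \<subseteq> N" "(m::int) > 0" "\<And>t. t \<in> T \<Longrightarrow> t [^] m \<in> zlat us"
  shows "fin_idx G (zlat us)"
proof -
  obtain ts where ts: "set ts = T" "distinct ts" using T(1) finite_distinct_list by blast
  have tsN: "set ts \<subseteq> N" using ts T by simp
  have L: "subgroup (zlat us) G" by (rule subgroup_zlat[OF us(1)])
  let ?R = "prodpow G ts ` (\<Pi>\<^sub>E t\<in>T. {0..<m})"
  have "\<exists>r\<in>?R. \<exists>x\<in>zlat us. h = x \<otimes> r" if h: "h \<in> N" for h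
  proof -
    obtain e j where e: "h = prodpow G ts e \<otimes> zp j"
      using generate_zlat[OF tsN ts(2)] ts T(3) h by (auto simp: zlat_def)
    define r where "r = (\<lambda>t\<in>T. e t mod m)"
    define f where "f t = m * (e t div m)" for t
    have r: "r \<in> (\<Pi>\<^sub>E t\<in>T. {0..<m})" using us(2) by (auto simp: r_def)
    obtain b where b: "prodpow G ts f \<otimes> prodpow G ts r = prodpow G ts (\<lambda>u. f u + r u) \<otimes> zp b"
      using prodpow_mult_ex[OF tsN] by blast
    have eq: "prodpow G ts (\<lambda>u. f u + r u) = prodpow G ts e"
      by (rule prodpow_cong) (simp add: r_def f_def ts)
    have "prodpow G ts f \<in> zlat us"
    proof (rule prodpow_in_subgroup[OF L])
      fix t assume t: "t \<in> set ts"
      then have "t [^] f t = (t [^] m) [^] (e t div m)"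
        using tsN by (simp add: f_def int_pow_pow subset_iff)
      then show "t [^] f t \<in> zlat us" using us(3) t ts subgroup_int_pow[OF L] by simp
    qed
    then have "prodpow G ts f \<otimes> zp (j - b) \<in> zlat us" using zp_zlat subgroup.m_closed[OF L] by blast
    moreover have "(prodpow G ts f \<otimes> zp (j - b)) \<otimes> (prodpow G ts r \<otimes> zp 0) = h"
      unfolding e using tsN by (simp only: mult_zp prodpow_in b eq) (simp add: m_assoc zp_add prodpow_in)
    ultimately show ?thesis using r prodpow_in[OF tsN, of r]
      by (intro bexI[of _ "prodpow G ts r"] bexI[of _ "prodpow G ts f \<otimes> zp (j - b)"]) auto
  qed
  moreover have "finite ?R" using T(1) by (intro finite_imageI finite_PiE) auto
  moreover have "?R \<subseteq> N" using prodpow_in[OF tsN] by auto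
  ultimately show ?thesis using fin_idx_trans[OF N fin zlat_subset[OF us(1)]] by blast
qed

text \<open>The choice is made to vanish outside \<open>us\<close>, so that having the same image
  modulo \<open><z>\<close> becomes an equality of functions.\<close>

definition coord :: "'a list \<Rightarrow> 'a \<Rightarrow> 'a \<Rightarrow> int" where
  "coord us x = (SOME e. (\<forall>u. u \<notin> set us \<longrightarrow> e u = 0) \<and> (\<exists>j. x = prodpow G us e \<otimes> zp j))"

definition zcoord :: "'a list \<Rightarrow> 'a \<Rightarrow> int" where
  "zcoord us x = (SOME j. x = prodpow G us (coord us x) \<otimes> zp j)"

lemma coord_support: assumes "x \<in> zlat us"
  shows "\<forall>u. u \<notin> set us \<longrightarrow> coord us x u = 0"
    and coord_zcoord: "x = prodpow G us (coord us x) \<otimes> zp (zcoord us x)"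
proof -
  obtain e j where e: "x = prodpow G us e \<otimes> zp j" using assms by (auto simp: zlat_def)
  have "prodpow G us e = prodpow G us (\<lambda>u. if u \<in> set us then e u else 0)" by (rule prodpow_cong) simp
  then have "\<exists>e. (\<forall>u. u \<notin> set us \<longrightarrow> e u = 0) \<and> (\<exists>j. x = prodpow G us e \<otimes> zp j)"
    using e by (intro exI[of _ "\<lambda>u. if u \<in> set us then e u else 0"]) auto
  then have *: "(\<forall>u. u \<notin> set us \<longrightarrow> coord us x u = 0) \<and> (\<exists>j. x = prodpow G us (coord us x) \<otimes> zp j)"
    unfolding coord_def by (rule someI_ex)
  then show "\<forall>u. u \<notin> set us \<longrightarrow> coord us x u = 0" by blast
  show "x = prodpow G us (coord us x) \<otimes> zp (zcoord us x)"
    unfolding zcoord_def using * by (intro someI_ex[of "\<lambda>j. x = prodpow G us (coord us x) \<otimes> zp j"]) blast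
qed

lemma coord_eqI:
  assumes "indep us" "x = prodpow G us e \<otimes> zp j"
  shows "u \<in> set us \<Longrightarrow> coord us x u = e u" and "zcoord us x = j"
proof -
  have "x \<in> zlat us" using assms(2) by (auto simp: zlat_def)
  then have "prodpow G us (coord us x) \<otimes> zp (zcoord us x) = prodpow G us e \<otimes> zp j"
    using coord_zcoord assms(2) by metis
  then show "u \<in> set us \<Longrightarrow> coord us x u = e u" and "zcoord us x = j"
    using indep_unique[OF assms(1)] by auto
qed

lemma coord_mult:
  assumes us: "indep us" and C: "\<And>u v. u \<in> set us \<Longrightarrow> v \<in> set us \<Longrightarrow> \<bar>om u v\<bar> \<le> C"
    and x: "x \<in> zlat us" and y: "y \<in> zlat us"
  shows "coord us (x \<otimes> y) u = coord us x u + coord us y u"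
    and "\<bar>zcoord us (x \<otimes> y) - zcoord us x - zcoord us y\<bar> \<le>
      C * (\<Sum>u\<leftarrow>us. \<bar>coord us x u\<bar>) * (\<Sum>u\<leftarrow>us. \<bar>coord us y u\<bar>)"
proof -
  have usN: "set us \<subseteq> N" using us by (simp add: indep_def)
  let ?e = "coord us x" and ?f = "coord us y" and ?i = "zcoord us x" and ?j = "zcoord us y"
  obtain b where b: "prodpow G us ?e \<otimes> prodpow G us ?f = prodpow G us (\<lambda>u. ?e u + ?f u) \<otimes> zp b"
    "\<bar>b\<bar> \<le> C * (\<Sum>u\<leftarrow>us. \<bar>?e u\<bar>) * (\<Sum>u\<leftarrow>us. \<bar>?f u\<bar>)"
    using prodpow_mult[OF usN C] by blast
  have "x \<otimes> y = (prodpow G us ?e \<otimes> zp ?i) \<otimes> (prodpow G us ?f \<otimes> zp ?j)"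
    using coord_zcoord[OF x] coord_zcoord[OF y] by simp
  also have "\<dots> = prodpow G us (\<lambda>u. ?e u + ?f u) \<otimes> zp (b + (?i + ?j))"
    using prodpow_in[OF usN] by (simp only: mult_zp b) (simp add: m_assoc zp_add)
  finally have eq: "x \<otimes> y = prodpow G us (\<lambda>u. ?e u + ?f u) \<otimes> zp (b + (?i + ?j))" .
  have xy: "x \<otimes> y \<in> zlat us" using subgroup.m_closed[OF subgroup_zlat[OF usN] x y] .
  show "coord us (x \<otimes> y) u = coord us x u + coord us y u"
  proof (cases "u \<in> set us")
    case True
    then show ?thesis using coord_eqI(1)[OF us eq] by simp
  next
    case False
    then show ?thesis using coord_support(1)[OF x] coord_support(1)[OF y] coord_support(1)[OF xy] by simp
  qed
  show "\<bar>zcoord us (x \<otimes> y) - zcoord us x - zcoord us y\<bar> \<le>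
      C * (\<Sum>u\<leftarrow>us. \<bar>?e u\<bar>) * (\<Sum>u\<leftarrow>us. \<bar>?f u\<bar>)"
    using coord_eqI(2)[OF us eq] b(2) by simp
qed

lemma coord_zero_iff:
  assumes us: "indep us" and x: "x \<in> zlat us"
  shows "(\<forall>u. coord us x u = 0) \<longleftrightarrow> (\<exists>j. x = zp j)"
proof
  assume "\<forall>u. coord us x u = 0"
  then have "prodpow G us (coord us x) = \<one>" by (intro prodpow_zero) simp
  then have "x = zp (zcoord us x)" using coord_zcoord[OF x] by simp
  then show "\<exists>j. x = zp j" by blast
next
  assume "\<exists>j. x = zp j"
  then obtain j where "x = prodpow G us (\<lambda>_. 0) \<otimes> zp j" by (auto simp: prodpow_zero)
  then show "\<forall>u. coord us x u = 0" using coord_eqI(1)[OF us] coord_support(1)[OF x] by metis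
qed

lemma coord_bound:
  assumes us: "indep us" "fin_idx G (zlat us)" and S: "finite S" "S \<subseteq> carrier G"
  shows "\<exists>C::nat. \<forall>n. \<forall>x\<in>zlat us \<inter> word_ball G S n. (\<Sum>u\<leftarrow>us. \<bar>coord us x u\<bar>) \<le> int (C * Suc n)"
proof -
  have usN: "set us \<subseteq> N" using us by (simp add: indep_def)
  obtain C0 where C0: "\<forall>u\<in>set us. \<forall>v\<in>set us. \<bar>om u v\<bar> \<le> C0" using ex_om_bound[of "set us"] by blast
  have hom: "coord us (x \<otimes> y) u = coord us x u + coord us y u"
    if "x \<in> zlat us" "y \<in> zlat us" for x y u
    using coord_mult(1)[OF us(1) _ that] C0 by blast
  have "\<exists>C::nat. \<forall>n. \<forall>x\<in>zlat us \<inter> word_ball G S n. (\<Sum>u\<leftarrow>vs. \<bar>coord us x u\<bar>) \<le> int (C * Suc n)" for vs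
  proof (induction vs)
    case Nil
    then show ?case by simp
  next
    case (Cons v vs)
    then obtain C where C: "\<And>n x. x \<in> zlat us \<inter> word_ball G S n \<Longrightarrow>
        (\<Sum>u\<leftarrow>vs. \<bar>coord us x u\<bar>) \<le> int (C * Suc n)" by blast
    obtain C' :: nat where C': "\<And>n x. x \<in> zlat us \<inter> word_ball G S n \<Longrightarrow> \<bar>coord us x v\<bar> \<le> int (C' * Suc n)"
      using hom_word_bound[OF subgroup_zlat[OF usN] us(2) S, of "\<lambda>x. coord us x v"] hom by blast
    have "(\<Sum>u\<leftarrow>v # vs. \<bar>coord us x u\<bar>) \<le> int ((C' + C) * Suc n)"
      if "x \<in> zlat us \<inter> word_ball G S n" for n x
      using C[OF that] C'[OF that] by (simp add: algebra_simps)
    then show ?case by blast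
  qed
  then show ?thesis .
qed

text \<open>Along a word the coordinates grow linearly. Each new letter changes the
  \<open>z\<close>-coordinate by a constant plus a constant multiple of the norm reached so far, so
  the total is quadratic.\<close>

lemma zp_word_bound:
  assumes us: "indep us" "fin_idx G (zlat us)" and S: "finite S" "S \<subseteq> carrier G"
  shows "\<exists>C::nat. \<forall>n j. zp j \<in> word_ball G S n \<longrightarrow> \<bar>j\<bar> \<le> int (C * (Suc n)\<^sup>2)"
proof -
  have usN: "set us \<subseteq> N" using us by (simp add: indep_def)
  have L: "subgroup (zlat us) G" by (rule subgroup_zlat[OF usN])
  obtain C0 where C0: "\<And>u v. u \<in> set us \<Longrightarrow> v \<in> set us \<Longrightarrow> \<bar>om u v\<bar> \<le> C0"
    using ex_om_bound[of "set us"] by blast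
  obtain Y where Y: "finite Y" "Y \<subseteq> zlat us" "\<And>n. zlat us \<inter> word_ball G S n \<subseteq> prods G Y (Suc n)"
    using schreier[OF L us(2) S] by blast
  have YG: "Y \<subseteq> carrier G" using Y subgroup.subset[OF L] by auto
  define nrm where "nrm x = (\<Sum>u\<leftarrow>us. \<bar>coord us x u\<bar>)" for x
  have nrm0: "nrm x \<ge> 0" for x unfolding nrm_def by (rule sum_list_nonneg) auto
  define A where "A = (\<Sum>y\<in>Y. nrm y + \<bar>zcoord us y\<bar>)"
  have A: "nrm y + \<bar>zcoord us y\<bar> \<le> A" if "y \<in> Y" for y
    unfolding A_def using that Y(1) nrm0 by (intro member_le_sum) (auto simp: add_nonneg_nonneg)
  have A0: "A \<ge> 0" unfolding A_def using nrm0 by (intro sum_nonneg) (auto simp: add_nonneg_nonneg)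
  have nrm_mult: "nrm (x \<otimes> y) \<le> nrm x + nrm y" if "x \<in> zlat us" "y \<in> zlat us" for x y
  proof -
    have "nrm (x \<otimes> y) = (\<Sum>u\<leftarrow>us. \<bar>coord us x u + coord us y u\<bar>)"
      unfolding nrm_def using coord_mult(1)[OF us(1) C0 that] by simp
    also have "\<dots> \<le> (\<Sum>u\<leftarrow>us. \<bar>coord us x u\<bar> + \<bar>coord us y u\<bar>)"
      by (intro sum_list_mono) auto
    finally show ?thesis by (simp add: nrm_def sum_list_addf)
  qed
  let ?C = "\<bar>C0\<bar>"
  \<comment> \<open>Chosen to dominate both \<open>A\<close> and \<open>?C * A * A\<close>, so that
    one step adds at most \<open>D + D * n\<close>, which fits between \<open>D * n^2\<close> and
    \<open>D * (n + 1)^2\<close>.\<close>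
  define D where "D = A + ?C * A * A"
  have D0: "D \<ge> 0" using A0 by (simp add: D_def)
  have one: "coord us \<one> = (\<lambda>_. 0)" "zcoord us \<one> = 0"
  proof -
    have o: "\<one> = prodpow G us (\<lambda>_. 0) \<otimes> zp 0" by (simp add: prodpow_zero)
    have "\<one> \<in> zlat us" using subgroup.one_closed[OF L] .
    then show "coord us \<one> = (\<lambda>_. 0)"
      using coord_eqI(1)[OF us(1) o] coord_support(1) by (intro ext) metis
    show "zcoord us \<one> = 0" using coord_eqI(2)[OF us(1) o] .
  qed
  have "x \<in> zlat us \<and> nrm x \<le> A * int n \<and> \<bar>zcoord us x\<bar> \<le> D * (int n)\<^sup>2" if "x \<in> prods G Y n" for x n
    using YG that
  proof (induction rule: prods_induct)
    case (one n)
    then show ?case using subgroup.one_closed[OF L] \<open>coord us \<one> = (\<lambda>_. 0)\<close> \<open>zcoord us \<one> = 0\<close> A0 D0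
      by (simp add: nrm_def)
  next
    case (step n x y)
    have y: "y \<in> zlat us" "nrm y \<le> A" "\<bar>zcoord us y\<bar> \<le> A"
      using step Y A[of y] nrm0[of y] by auto
    have x: "x \<in> zlat us" "nrm x \<le> A * int n" "\<bar>zcoord us x\<bar> \<le> D * (int n)\<^sup>2" using step by auto
    have "\<bar>zcoord us (x \<otimes> y) - zcoord us x - zcoord us y\<bar> \<le> C0 * nrm x * nrm y"
      unfolding nrm_def using coord_mult(2)[OF us(1) C0 x(1) y(1)] .
    also have "\<dots> \<le> ?C * nrm x * nrm y" using nrm0 by (intro mult_right_mono) auto
    also have "\<dots> \<le> ?C * (A * int n) * A" using x y nrm0 A0 by (intro mult_mono) auto
    finally have "\<bar>zcoord us (x \<otimes> y)\<bar> \<le> D * (int n)\<^sup>2 + A + ?C * A * A * int n"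
      using x(3) y(3) by (simp add: algebra_simps)
    also have "\<dots> \<le> D * (int n)\<^sup>2 + D + D * int n"
    proof -
      have "?C * A * A * int n \<le> D * int n" using A0 by (intro mult_right_mono) (auto simp: D_def)
      moreover have "A \<le> D" using A0 by (simp add: D_def)
      ultimately show ?thesis by linarith
    qed
    also have "\<dots> \<le> D * (int (Suc n))\<^sup>2" using D0 by (simp add: power2_eq_square algebra_simps)
    finally have "\<bar>zcoord us (x \<otimes> y)\<bar> \<le> D * (int (Suc n))\<^sup>2" by simp
    moreover have "nrm (x \<otimes> y) \<le> A * int (Suc n)" using nrm_mult[OF x(1) y(1)] x y by (simp add: algebra_simps)
    ultimately show ?case using subgroup.m_closed[OF L] x y by blast
  next
    case (mono n x)
    have "A * int n \<le> A * int (Suc n)" using A0 by (intro mult_left_mono) auto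
    moreover have "D * (int n)\<^sup>2 \<le> D * (int (Suc n))\<^sup>2" using D0 by (intro mult_left_mono power_mono) auto
    ultimately show ?case using mono by linarith
  qed
  then have *: "\<bar>zcoord us x\<bar> \<le> D * (int (Suc n))\<^sup>2" if "x \<in> zlat us \<inter> word_ball G S n" for x n
    using Y(3) that by blast
  have "\<bar>j\<bar> \<le> int (nat D * (Suc n)\<^sup>2)" if "zp j \<in> word_ball G S n" for n j
  proof -
    have "zp j = prodpow G us (\<lambda>_. 0) \<otimes> zp j" by (simp add: prodpow_zero)
    then have "zcoord us (zp j) = j" using coord_eqI(2)[OF us(1)] by blast
    then show ?thesis using *[of "zp j" n] that zp_zlat[of j us] D0 by simp
  qed
  then show ?thesis by blast
qed

end

context group
begin

lemma conj_int_pow: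
  assumes "a \<in> carrier G" "x \<in> carrier G"
  shows "inv a \<otimes> x [^] (i::int) \<otimes> a = (inv a \<otimes> x \<otimes> a) [^] i"
proof -
  have "(\<lambda>x. inv a \<otimes> x \<otimes> a) \<in> hom G G"
    using assms(1) by (auto simp: hom_def word_simps)
  from hom_int_pow[OF this assms(2) is_group is_group] show ?thesis .
qed

lemma conj_class_subgroup_eq_iff:
  assumes "subgroup H G" "g \<in> H" "h \<in> H" 
  shows "conj_class (G\<lparr>carrier := H\<rparr>) g = conj_class (G\<lparr>carrier := H\<rparr>) h \<longleftrightarrow> (\<exists>x\<in>H. h = x \<otimes> g \<otimes> inv x)"
proof -
  have GH: "group (G\<lparr>carrier := H\<rparr>)" using subgroup_imp_group[OF assms(1)] .
  have "h \<in> conj_class (G\<lparr>carrier := H\<rparr>) g \<longleftrightarrow> (\<exists>x\<in>H. h = x \<otimes> g \<otimes> inv x)"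
    unfolding conj_class_subgroup[OF assms(1)] by blast
  moreover have "(\<exists>x\<in>H. h = x \<otimes> g \<otimes> inv x) \<longleftrightarrow> (\<exists>x\<in>H. h = x \<otimes> g \<otimes> inv\<^bsub>G\<lparr>carrier := H\<rparr>\<^esub> x)"
    by (rule bex_cong) (simp_all add: m_inv_consistent[OF assms(1)])
  ultimately show ?thesis using group.conj_class_eq_iff[OF GH, of g h] assms(2,3) by simp
qed

end

section \<open>Counting conjugacy classes coset by coset\<close>

text \<open>\<open>E\<close> is a homomorphism with kernel \<open><z>\<close> into a free abelian group, written pointwise; \<open>D\<close> records
  it modulo a fixed integer, so that differences of elements with the same \<open>D\<close> are \<open>k\<close>-th powers mod \<open>z\<close>.\<close>

locale conj_setup = class2 G N z for G (structure) and N z +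
  fixes H S :: "'a set" and E :: "'a \<Rightarrow> 'a \<Rightarrow> int" and k :: nat and D :: "'a \<Rightarrow> 'd"
  assumes S: "finite S" "S \<subseteq> carrier G"
    and ex_ball: "g \<in> carrier G \<Longrightarrow> \<exists>n. g \<in> word_ball G S n"
    and H: "subgroup H G" "N \<subseteq> H"
    and normal: "g \<in> carrier G \<Longrightarrow> x \<in> N \<Longrightarrow> g \<otimes> x \<otimes> inv g \<in> N"
    and E_mult: "x \<in> N \<Longrightarrow> y \<in> N \<Longrightarrow> E (x \<otimes> y) u = E x u + E y u"
    and E_zero: "x \<in> N \<Longrightarrow> (\<forall>u. E x u = 0) \<longleftrightarrow> (\<exists>i. x = z [^] (i::int))"
    and E_conj: "h \<in> H \<Longrightarrow> x \<in> N \<Longrightarrow> E (h \<otimes> x \<otimes> inv h) u = E x u"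
    and z_H: "h \<in> H \<Longrightarrow> h \<otimes> z = z \<otimes> h"
    and k: "0 < k" "g \<in> carrier G \<Longrightarrow> g [^] k \<in> N"
    and fin_N: "fin_idx G N"
    and z_bound: "\<exists>C::nat. \<forall>n (i::int). z [^] i \<in> word_ball G S n \<longrightarrow> \<bar>i\<bar> \<le> int (C * (Suc n)\<^sup>2)"
    and D_fin: "finite (D ` N)"
    and D_root: "\<exists>C. \<forall>n. \<forall>x\<in>N \<inter> word_ball G S n. \<forall>y\<in>N \<inter> word_ball G S n. D x = D y \<longrightarrow>
      (\<exists>c\<in>N \<inter> word_ball G S (C * Suc n). \<forall>u. E x u = E y u + int k * E c u)"
    and nonabelian: "\<exists>x\<in>N. \<exists>y\<in>N. om x y \<noteq> 0"
begin

section \<open>Families of elements with boundedly many classes\<close>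

abbreviation B :: "nat \<Rightarrow> 'a set" where "B \<equiv> word_ball G S"

lemma B_mult: "x \<in> B m \<Longrightarrow> y \<in> B n \<Longrightarrow> x \<otimes> y \<in> B (m + n)"
  by (rule word_ball_mult[OF S(2)])

lemma B_carrier: "x \<in> B n \<Longrightarrow> x \<in> carrier G"
  by (rule word_ball_closed[OF S(2)])

lemma B_mono: "x \<in> B m \<Longrightarrow> m \<le> n \<Longrightarrow> x \<in> B n"
  using word_ball_mono[of m n G S] by blast

definition gconj :: "'a \<Rightarrow> 'a \<Rightarrow> bool" where
  "gconj g h \<longleftrightarrow> (\<exists>x\<in>carrier G. h = x \<otimes> g \<otimes> inv x)"

definition hconj :: "'a \<Rightarrow> 'a \<Rightarrow> bool" where
  "hconj g h \<longleftrightarrow> (\<exists>x\<in>H. h = x \<otimes> g \<otimes> inv x)"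

abbreviation GH where "GH \<equiv> G\<lparr>carrier := H\<rparr>"

lemma H_carrier: "h \<in> H \<Longrightarrow> h \<in> carrier G"
  by (rule subgroup.mem_carrier[OF H(1)])

lemma gconj_iff: "g \<in> carrier G \<Longrightarrow> h \<in> carrier G \<Longrightarrow> gconj g h \<longleftrightarrow> conj_class G g = conj_class G h"
  unfolding gconj_def by (rule conj_class_eq_iff[symmetric])

lemma hconj_iff: "g \<in> H \<Longrightarrow> h \<in> H \<Longrightarrow> hconj g h \<longleftrightarrow> conj_class GH g = conj_class GH h"
  unfolding hconj_def by (rule conj_class_subgroup_eq_iff[OF H(1), symmetric])

lemma gconj_trans:
  "g \<in> carrier G \<Longrightarrow> h \<in> carrier G \<Longrightarrow> l \<in> carrier G \<Longrightarrow> gconj g h \<Longrightarrow> gconj h l \<Longrightarrow> gconj g l"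
  by (simp add: gconj_iff)

text \<open>The classes are those of the whole of \<open>H\<close>, since they are to be compared
  with the growth of \<open>H\<close>, but lengths are still taken in \<open>G\<close>. All elements
  used as codes lie in \<open>N\<close>, so only classes that meet \<open>N\<close> are
  counted.\<close>

definition H_count :: "nat \<Rightarrow> nat" where
  "H_count n = card (conj_class GH ` (N \<inter> B n))"

definition bdd :: "'a set \<Rightarrow> bool" where
  "bdd \<Gamma> \<longleftrightarrow> (\<exists>C. \<forall>n. card (conj_class G ` (\<Gamma> \<inter> B n)) \<le> C * H_count (C * Suc n))"

lemma finite_B: "finite (B n)"
  using finite_word_ball[OF S(1)] .

lemma H_count_mono: assumes "m \<le> n" shows "H_count m \<le> H_count n"
proof -
  have "N \<inter> B m \<subseteq> N \<inter> B n" using B_mono[OF _ assms] by blast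
  then show ?thesis unfolding H_count_def
    by (intro card_mono finite_imageI image_mono finite_Int disjI2 finite_B)
qed

lemma bdd_subset: assumes "bdd \<Gamma>" "\<Delta> \<subseteq> \<Gamma>" shows "bdd \<Delta>"
proof -
  obtain C where C: "\<And>n. card (conj_class G ` (\<Gamma> \<inter> B n)) \<le> C * H_count (C * Suc n)"
    using assms(1) unfolding bdd_def by blast
  have "card (conj_class G ` (\<Delta> \<inter> B n)) \<le> card (conj_class G ` (\<Gamma> \<inter> B n))" for n
    using assms(2) by (intro card_mono finite_imageI finite_Int disjI2 finite_B image_mono) blast
  then show ?thesis unfolding bdd_def using C le_trans by blast
qed

lemma bdd_Un: assumes "bdd \<Gamma>" "bdd \<Delta>" shows "bdd (\<Gamma> \<union> \<Delta>)"
proof -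
  obtain C where C: "\<And>n. card (conj_class G ` (\<Gamma> \<inter> B n)) \<le> C * H_count (C * Suc n)"
    using assms(1) unfolding bdd_def by blast
  obtain C' where C': "\<And>n. card (conj_class G ` (\<Delta> \<inter> B n)) \<le> C' * H_count (C' * Suc n)"
    using assms(2) unfolding bdd_def by blast
  have "card (conj_class G ` ((\<Gamma> \<union> \<Delta>) \<inter> B n)) \<le> (C + C') * H_count ((C + C') * Suc n)" for n
  proof -
    have "conj_class G ` ((\<Gamma> \<union> \<Delta>) \<inter> B n) = conj_class G ` (\<Gamma> \<inter> B n) \<union> conj_class G ` (\<Delta> \<inter> B n)" by auto
    then have "card (conj_class G ` ((\<Gamma> \<union> \<Delta>) \<inter> B n)) \<le>
        card (conj_class G ` (\<Gamma> \<inter> B n)) + card (conj_class G ` (\<Delta> \<inter> B n))"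
      using card_Un_le by simp
    moreover have "C * H_count (C * Suc n) \<le> C * H_count ((C + C') * Suc n)"
      by (intro mult_left_mono H_count_mono mult_right_mono) auto
    moreover have "C' * H_count (C' * Suc n) \<le> C' * H_count ((C + C') * Suc n)"
      by (intro mult_left_mono H_count_mono mult_right_mono) auto
    ultimately show ?thesis using C[of n] C'[of n] unfolding distrib_right[of C C' "H_count _"] by linarith
  qed
  then show ?thesis unfolding bdd_def by blast
qed

lemma bdd_empty: "bdd {}"
  by (simp add: bdd_def)

text \<open>The counting scheme behind all cases: encode \<open>g\<close> by a finite label
  \<open>d g\<close> and an element \<open>x g\<close> of \<open>N\<close> of linear length, so that
  the label and the \<open>H\<close>-class of \<open>x g\<close> determine the
  \<open>G\<close>-class of \<open>g\<close>. The encoding may depend on \<open>n\<close>, because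
  representatives are chosen inside the ball; \<open>F\<close> and \<open>C\<close> may not.\<close>

lemma bddI:
  assumes F: "finite F"
    and inj: "\<And>n. \<exists>x d. \<forall>g\<in>\<Gamma> \<inter> B n. x g \<in> N \<inter> B (C * Suc n) \<and> d g \<in> F \<and>
      (\<forall>g'\<in>\<Gamma> \<inter> B n. d g = d g' \<longrightarrow> hconj (x g) (x g') \<longrightarrow> gconj g g')"
  shows "bdd \<Gamma>"
proof -
  have "card (conj_class G ` (\<Gamma> \<inter> B n)) \<le> card F * H_count (C * Suc n)" for n
  proof -
    obtain x d where xd: "\<And>g. g \<in> \<Gamma> \<inter> B n \<Longrightarrow> x g \<in> N \<inter> B (C * Suc n) \<and> d g \<in> F"
      "\<And>g g'. g \<in> \<Gamma> \<inter> B n \<Longrightarrow> g' \<in> \<Gamma> \<inter> B n \<Longrightarrow> d g = d g' \<Longrightarrow> hconj (x g) (x g') \<Longrightarrow> gconj g g'"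
      using inj[of n] by blast
    define r where "r \<kappa> = (SOME g. g \<in> \<Gamma> \<inter> B n \<and> conj_class G g = \<kappa>)" for \<kappa>
    have r: "r \<kappa> \<in> \<Gamma> \<inter> B n \<and> conj_class G (r \<kappa>) = \<kappa>" if \<kappa>: "\<kappa> \<in> conj_class G ` (\<Gamma> \<inter> B n)" for \<kappa>
      unfolding r_def by (rule someI_ex) (use \<kappa> in auto)
    let ?f = "\<lambda>\<kappa>. (d (r \<kappa>), conj_class GH (x (r \<kappa>)))"
    have "inj_on ?f (conj_class G ` (\<Gamma> \<inter> B n))"
    proof (rule inj_onI)
      fix \<kappa> \<kappa>' assume a: "\<kappa> \<in> conj_class G ` (\<Gamma> \<inter> B n)" "\<kappa>' \<in> conj_class G ` (\<Gamma> \<inter> B n)" "?f \<kappa> = ?f \<kappa>'"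
      note r1 = r[OF a(1)] and r2 = r[OF a(2)]
      have "x (r \<kappa>) \<in> H" "x (r \<kappa>') \<in> H" using xd(1) r1 r2 H(2) by blast+
      then have "hconj (x (r \<kappa>)) (x (r \<kappa>'))" using a(3) hconj_iff by auto
      then have "gconj (r \<kappa>) (r \<kappa>')" using xd(2) r1 r2 a(3) by simp
      moreover have "r \<kappa> \<in> carrier G" "r \<kappa>' \<in> carrier G" using r1 r2 B_carrier by auto
      ultimately show "\<kappa> = \<kappa>'" using r1 r2 gconj_iff by simp
    qed
    moreover have "?f ` (conj_class G ` (\<Gamma> \<inter> B n)) \<subseteq> F \<times> (conj_class GH ` (N \<inter> B (C * Suc n)))"
      using r xd(1) by blast
    moreover have "finite (F \<times> (conj_class GH ` (N \<inter> B (C * Suc n))))"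
      by (intro finite_cartesian_product F finite_imageI finite_Int disjI2 finite_B)
    ultimately have "card (conj_class G ` (\<Gamma> \<inter> B n)) \<le> card (F \<times> (conj_class GH ` (N \<inter> B (C * Suc n))))"
      by (rule card_inj_on_le)
    then show ?thesis by (simp add: card_cartesian_product H_count_def)
  qed
  then have *: "card (conj_class G ` (\<Gamma> \<inter> B n)) \<le> (card F + C) * H_count ((card F + C) * Suc n)" for n
  proof -
    have "card F * H_count (C * Suc n) \<le> (card F + C) * H_count ((card F + C) * Suc n)"
      by (intro mult_mono H_count_mono mult_right_mono) auto
    then show ?thesis using \<open>\<And>n. card (conj_class G ` (\<Gamma> \<inter> B n)) \<le> card F * H_count (C * Suc n)\<close> le_trans by blast
  qed
  then show ?thesis unfolding bdd_def by blast
qed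

lemma normal': "g \<in> carrier G \<Longrightarrow> x \<in> N \<Longrightarrow> inv g \<otimes> x \<otimes> g \<in> N"
  using normal[of "inv g" x] by simp

lemma E_one [simp]: "E \<one> u = 0"
  using E_mult[of \<one> \<one> u] by simp

lemma E_inv [simp]: "x \<in> N \<Longrightarrow> E (inv x) u = - E x u"
  using E_mult[of x "inv x" u] by simp

lemma E_nat_pow [simp]: "x \<in> N \<Longrightarrow> E (x [^] (m::nat)) u = int m * E x u"
  by (induction m) (simp_all add: E_mult algebra_simps)

lemma E_int_pow [simp]: assumes "x \<in> N" shows "E (x [^] (m::int)) u = m * E x u"
proof (cases "m \<ge> 0")
  case True
  then obtain l where "m = int l" using nonneg_int_cases by blast
  then show ?thesis using assms by (simp add: int_pow_int)
next
  case False
  then obtain l where "m = - int l" by (metis int_cases4 nle_le of_nat_0_le_iff)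
  then show ?thesis using assms by (simp add: int_pow_neg_int)
qed

lemma E_zp [simp]: "E (zp i) u = 0"
  using E_zero[OF zp_in, of i] by blast

lemma E_eq_iff: assumes "x \<in> N" "y \<in> N" shows "E x = E y \<longleftrightarrow> (\<exists>i. x = y \<otimes> zp i)"
proof
  assume "E x = E y"
  then have "\<forall>u. E (inv y \<otimes> x) u = 0" using assms by (simp add: E_mult)
  then obtain i where i: "inv y \<otimes> x = zp i" using E_zero[of "inv y \<otimes> x"] assms by auto
  have "x = y \<otimes> (inv y \<otimes> x)" using assms by (simp add: word_simps)
  then show "\<exists>i. x = y \<otimes> zp i" unfolding i by blast
next
  assume "\<exists>i. x = y \<otimes> zp i"
  then show "E x = E y" using assms by (auto simp: E_mult fun_eq_iff)
qed

lemma om_E_left: assumes "x \<in> N" "x' \<in> N" "y \<in> N" "E x = E x'" shows "om x y = om x' y"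
proof -
  obtain i where "x = x' \<otimes> zp i" using E_eq_iff assms by blast
  then show ?thesis using assms by (simp add: om_mult_left om_zp_left)
qed

text \<open>Apply conjugation to a nontrivial commutator \<open>z^m\<close> of two elements of
  \<open>N\<close>. The result is again a commutator in \<open>N\<close>, so \<open>E\<close>
  vanishes on it, that is \<open>m\<close> times \<open>E\<close> of the conjugate of
  \<open>z\<close> is zero. Hence the conjugate lies in \<open><z>\<close>, say with exponent
  \<open>i\<close>; for \<open>g^-1\<close> this gives an exponent \<open>j\<close>, and
  \<open>j * i = 1\<close>.\<close>

lemma z_conj: assumes g: "g \<in> carrier G"
  shows "inv g \<otimes> z \<otimes> g = z \<or> inv g \<otimes> z \<otimes> g = inv z"
proof -
  obtain x y where xy: "x \<in> N" "y \<in> N" "om x y \<noteq> 0" using nonabelian by blast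
  have conj: "\<exists>i. inv g \<otimes> z \<otimes> g = zp i" if g: "g \<in> carrier G" for g
  proof -
    let ?c = "\<lambda>a. inv g \<otimes> a \<otimes> g"
    have c_mult: "?c (a \<otimes> b) = ?c a \<otimes> ?c b" if "a \<in> carrier G" "b \<in> carrier G" for a b
      using that g by (simp add: word_simps)
    have cN: "?c a \<in> N" if "a \<in> N" for a using normal'[OF g that] .
    have "?c x \<otimes> ?c y = ?c (y \<otimes> x \<otimes> zp (om x y))"
      using c_mult[of x y] xy om[OF xy(1,2)] by simp
    also have "\<dots> = ?c y \<otimes> ?c x \<otimes> ?c (zp (om x y))"
      using c_mult[of "y \<otimes> x" "zp (om x y)"] c_mult[of y x] xy by simp
    finally have e: "?c x \<otimes> ?c y = ?c y \<otimes> ?c x \<otimes> ?c z [^] (om x y)"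
      using conj_int_pow[OF g z_carrier] by simp
    have "\<forall>u. om x y * E (?c z) u = 0"
    proof
      fix u
      have "E (?c x \<otimes> ?c y) u = E (?c y \<otimes> ?c x \<otimes> ?c z [^] (om x y)) u" using e by simp
      then show "om x y * E (?c z) u = 0" using cN[OF xy(1)] cN[OF xy(2)] cN[OF z_in] by (simp add: E_mult)
    qed
    then show ?thesis using xy(3) E_zero[OF cN[OF z_in]] by simp
  qed
  obtain i where i: "inv g \<otimes> z \<otimes> g = zp i" using conj[OF g] by blast
  obtain j where j: "g \<otimes> z \<otimes> inv g = zp j" using conj[of "inv g"] g by auto
  have "zp j [^] i = g \<otimes> zp i \<otimes> inv g" using conj_int_pow[of "inv g" z i] g j by simp
  also have "\<dots> = z" unfolding i[symmetric] using g by (simp add: word_simps)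
  finally have "zp (j * i) = zp 1" by (simp add: int_pow_pow)
  then have "j * i = 1" by (simp only: zp_inj)
  then have "i = 1 \<or> i = -1" by (metis mult.commute zmult_eq_1_iff)
  then show ?thesis using i by (auto simp: int_pow_neg)
qed

lemma E_conj_N: assumes "a \<in> N" "x \<in> N" shows "E (inv a \<otimes> x \<otimes> a) u = E x u"
  using assms by (simp add: E_mult)

lemma hconj_E: assumes "hconj x y" "x \<in> N" shows "E x = E y"
proof -
  obtain h where "h \<in> H" "y = h \<otimes> x \<otimes> inv h" using assms(1) by (auto simp: hconj_def)
  then show ?thesis using E_conj[OF _ assms(2)] by (auto simp: fun_eq_iff)
qed

lemma om_self: assumes "x \<in> N" shows "om x x = 0"
  using om_anti[OF assms assms] by simp

lemma zp_conj_commute: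
  assumes "g \<in> carrier G" "inv g \<otimes> z \<otimes> g = zp e"
  shows "zp i \<otimes> g = g \<otimes> zp (e * i)"
proof -
  have "zp i \<otimes> g = g \<otimes> (inv g \<otimes> zp i \<otimes> g)" using assms(1) by (simp add: word_simps)
  also have "\<dots> = g \<otimes> zp (e * i)" using conj_int_pow[OF assms(1) z_carrier, of i] assms(2)
    by (simp add: int_pow_pow)
  finally show ?thesis .
qed

section \<open>Cosets on which conjugation inverts \<open>z\<close>\<close>

definition cos :: "'a \<Rightarrow> 'a set" where
  "cos t = {g \<in> carrier G. inv t \<otimes> g \<in> N}"

lemma cos_carrier: "g \<in> cos t \<Longrightarrow> g \<in> carrier G"
  by (simp add: cos_def)

lemma cos_eq: assumes "t \<in> carrier G" "g \<in> cos t" shows "t \<otimes> (inv t \<otimes> g) = g"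
  using assms by (simp add: cos_def word_simps)

lemma cos_conj_z:
  assumes t: "t \<in> carrier G" "inv t \<otimes> z \<otimes> t = zp e" and g: "g \<in> cos t"
  shows "inv g \<otimes> z \<otimes> g = zp e"
proof -
  define h where "h = inv t \<otimes> g"
  have h: "h \<in> N" "g = t \<otimes> h" using g cos_eq[OF t(1) g] by (auto simp: h_def cos_def)
  have "inv g \<otimes> z \<otimes> g = inv h \<otimes> (inv t \<otimes> z \<otimes> t) \<otimes> h"
    unfolding h(2) using h(1) t(1) by (simp add: word_simps)
  also have "\<dots> = inv h \<otimes> (zp e \<otimes> h)" unfolding t(2) using h by (simp add: m_assoc)
  also have "\<dots> = zp e" using h zp_commute[OF h(1)] by (simp add: word_simps)
  finally show ?thesis .
qed

text \<open>Conjugating \<open>r z^a\<close> by \<open>z^i\<close> gives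
  \<open>r z^(a - 2 i)\<close>, so above a given image modulo \<open><z>\<close> only the parity of
  the exponent matters, and it becomes the label.\<close>

lemma bdd_cos_inverting:
  assumes t: "t \<in> carrier G" "inv t \<otimes> z \<otimes> t = inv z"
  shows "bdd (cos t)"
proof -
  obtain m where m: "t \<in> B m" using ex_ball t(1) by blast
  have tz: "inv t \<otimes> z \<otimes> t = zp (-1)" using t(2) by (simp add: int_pow_neg)
  have "\<exists>x d. \<forall>g\<in>cos t \<inter> B n. x g \<in> N \<inter> B ((m + 1) * Suc n) \<and> d g \<in> {0, 1::int} \<and>
      (\<forall>g'\<in>cos t \<inter> B n. d g = d g' \<longrightarrow> hconj (x g) (x g') \<longrightarrow> gconj g g')" for n
  proof -
    define x where "x g = inv t \<otimes> g" for g
    \<comment> \<open>The base point depends on the image modulo \<open><z>\<close> alone, so that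
      exponents of different \<open>g\<close> over the same image can be compared.\<close>
    define \<rho> where "\<rho> e = (SOME g. g \<in> cos t \<and> E (x g) = e)" for e
    have \<rho>: "\<rho> (E (x g)) \<in> cos t \<and> E (x (\<rho> (E (x g)))) = E (x g)" if "g \<in> cos t" for g
      unfolding \<rho>_def by (rule someI[of _ g]) (use that in auto)
    define j where "j g = (SOME j. g = \<rho> (E (x g)) \<otimes> zp j)" for g
    have xN: "x g \<in> N" if "g \<in> cos t" for g using that by (simp add: x_def cos_def)
    have j: "g = \<rho> (E (x g)) \<otimes> zp (j g)" if g: "g \<in> cos t" for g
    proof -
      let ?r = "\<rho> (E (x g))"
      have r: "?r \<in> cos t" "E (x g) = E (x ?r)" using \<rho>[OF g] by auto
      then obtain i where "x g = x ?r \<otimes> zp i" using E_eq_iff[OF xN[OF g] xN[OF r(1)]] by blast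
      then have "t \<otimes> x g = (t \<otimes> x ?r) \<otimes> zp i" using t xN[OF r(1)] by (simp add: m_assoc)
      then have "g = ?r \<otimes> zp i" using cos_eq[OF t(1)] g r(1) by (simp add: x_def)
      then show ?thesis unfolding j_def by (rule someI)
    qed
    have ball: "x g \<in> B ((m + 1) * Suc n)" if "g \<in> B n" for g
      unfolding x_def by (rule B_mono[OF B_mult[OF word_ball_inv[OF S(2) m] that]]) simp
    have "gconj g g'" if g: "g \<in> cos t" and g': "g' \<in> cos t" and d: "j g mod 2 = j g' mod 2"
      and h: "hconj (x g) (x g')" for g g'
    proof -
      have e: "E (x g) = E (x g')" using hconj_E[OF h xN[OF g]] .
      define r where "r = \<rho> (E (x g))"
      have r: "r \<in> cos t" using \<rho>[OF g] by (simp add: r_def)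
      define a where "a = j g"
      define b where "b = j g'"
      have gr: "g = r \<otimes> zp a" "g' = r \<otimes> zp b"
        using j[OF g] j[OF g'] e by (simp_all add: r_def a_def b_def)
      have "2 dvd a - b" using d by (simp add: a_def b_def mod_eq_dvd_iff)
      then obtain i where "a - b = 2 * i" by (rule dvdE)
      then have i: "b = a - 2 * i" by simp
      have rc: "r \<in> carrier G" using cos_carrier[OF r] .
      have "zp i \<otimes> g \<otimes> inv (zp i) = (zp i \<otimes> r) \<otimes> (zp a \<otimes> zp (-i))"
        unfolding gr(1) using rc by (simp add: m_assoc int_pow_neg)
      also have "\<dots> = r \<otimes> (zp (-1 * i) \<otimes> (zp a \<otimes> zp (-i)))"
        unfolding zp_conj_commute[OF rc cos_conj_z[OF t(1) tz r], of i] using rc by (simp add: m_assoc)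
      also have "\<dots> = g'" unfolding zp_add gr(2) i by simp
      finally show ?thesis unfolding gconj_def by (intro bexI[of _ "zp i"]) auto
    qed
    then have *: "\<forall>g\<in>cos t \<inter> B n. x g \<in> N \<inter> B ((m + 1) * Suc n) \<and> j g mod 2 \<in> {0, 1::int} \<and>
      (\<forall>g'\<in>cos t \<inter> B n. j g mod 2 = j g' mod 2 \<longrightarrow> hconj (x g) (x g') \<longrightarrow> gconj g g')"
      using xN ball by (simp only: Int_iff) auto
    show ?thesis by (rule exI[of _ x], rule exI[of _ "\<lambda>g. j g mod 2"], rule *)
  qed
  then show ?thesis by (intro bddI[of "{0, 1::int}" "cos t" "m + 1"]) simp
qed

lemma Lip:
  fixes \<chi> :: "'a \<Rightarrow> int"
  assumes "\<And>x y. x \<in> N \<Longrightarrow> y \<in> N \<Longrightarrow> \<chi> (x \<otimes> y) = \<chi> x + \<chi> y"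
  shows "\<exists>C::nat. \<forall>n. \<forall>x \<in> N \<inter> B n. \<bar>\<chi> x\<bar> \<le> int (C * Suc n)"
  using hom_word_bound[OF N fin_N S, of \<chi>] assms by blast

end

section \<open>Cosets that commute with \<open>z\<close>: the automorphism \<open>psi\<close> and
  its norm\<close>

locale coset_setup = conj_setup +
  fixes t
  assumes t: "t \<in> carrier G" and tz: "inv t \<otimes> z \<otimes> t = z"
begin

definition psi :: "'a \<Rightarrow> 'a" where "psi x = inv t \<otimes> x \<otimes> t"

lemma psi_in [simp, intro]: "x \<in> N \<Longrightarrow> psi x \<in> N"
  unfolding psi_def using normal'[OF t] .

lemma psi_mult: "x \<in> carrier G \<Longrightarrow> y \<in> carrier G \<Longrightarrow> psi (x \<otimes> y) = psi x \<otimes> psi y"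
  unfolding psi_def using t by (simp add: word_simps)

lemma psi_zp: "psi (zp i) = zp i"
  unfolding psi_def using conj_int_pow[OF t z_carrier, of i] tz by simp

lemma psi_cong: assumes "x \<in> N" "y \<in> N" "E x = E y" shows "E (psi x) = E (psi y)"
proof -
  obtain i where i: "x = y \<otimes> zp i" using E_eq_iff assms by blast
  have "psi x = psi y \<otimes> zp i" unfolding i using assms psi_mult[of y "zp i"] psi_zp by simp
  then show ?thesis using E_eq_iff assms by blast
qed

lemma om_psi: assumes "x \<in> N" "y \<in> N" shows "om (psi x) (psi y) = om x y"
proof (rule om_eqI)
  have "psi x \<otimes> psi y = psi (x \<otimes> y)" using assms psi_mult[of x y] by simp
  also have "\<dots> = psi (y \<otimes> x \<otimes> zp (om x y))" by (subst om[OF assms]) (rule refl)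
  also have "\<dots> = psi y \<otimes> psi x \<otimes> zp (om x y)"
    using assms psi_mult[of "y \<otimes> x" "zp (om x y)"] psi_mult[of y x] psi_zp by simp
  finally show "psi x \<otimes> psi y = psi y \<otimes> psi x \<otimes> zp (om x y)" .
qed (use assms in auto)

lemma zp_cos: assumes "g \<in> cos t" shows "zp i \<otimes> g = g \<otimes> zp i"
proof -
  have "inv t \<otimes> z \<otimes> t = zp 1" using tz by simp
  then show ?thesis using zp_conj_commute[OF cos_carrier[OF assms] cos_conj_z[OF t _ assms], of 1 i] by simp
qed

definition tr :: "'a \<Rightarrow> 'a" where "tr g = inv t \<otimes> g"

lemma tr_in: "g \<in> cos t \<Longrightarrow> tr g \<in> N"
  by (simp add: cos_def tr_def)

lemma tr_eq: "g \<in> cos t \<Longrightarrow> g = t \<otimes> tr g"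
  unfolding tr_def using cos_eq[OF t] by simp

text \<open>Written additively in \<open>N/<z>\<close>, \<open>pp i x\<close> is the sum of the \<open>psi\<^sup>l x\<close> with \<open>l < i\<close>, so that \<open>pp k\<close> is
  the norm, and \<open>psi (qq i x) - qq i x = pp i x - i x\<close>.\<close>

primrec pp :: "nat \<Rightarrow> 'a \<Rightarrow> 'a" where
  "pp 0 x = \<one>"
| "pp (Suc i) x = psi (pp i x) \<otimes> x"

primrec qq :: "nat \<Rightarrow> 'a \<Rightarrow> 'a" where
  "qq 0 x = \<one>"
| "qq (Suc i) x = qq i x \<otimes> pp i x"

lemma pp_in [simp, intro]: "x \<in> N \<Longrightarrow> pp i x \<in> N"
  by (induction i) auto

lemma qq_in [simp, intro]: "x \<in> N \<Longrightarrow> qq i x \<in> N"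
  by (induction i) auto

lemma pow_pp: assumes x: "x \<in> N" shows "(t \<otimes> x) [^] i = t [^] i \<otimes> pp i x"
proof (induction i)
  case (Suc i)
  have c: "x \<in> carrier G" "pp i x \<in> carrier G" using x by auto
  have "(t \<otimes> x) [^] Suc i = t [^] i \<otimes> pp i x \<otimes> (t \<otimes> x)" using Suc by simp
  also have "\<dots> = t [^] i \<otimes> t \<otimes> (inv t \<otimes> pp i x \<otimes> t \<otimes> x)" using c t by (simp add: word_simps)
  finally show ?case by (simp add: psi_def)
qed simp

lemma E_psi_mult: "x \<in> N \<Longrightarrow> y \<in> N \<Longrightarrow> E (psi (x \<otimes> y)) u = E (psi x) u + E (psi y) u"
  using psi_mult[of x y] E_mult[of "psi x" "psi y"] by simp

lemma E_pp_mult: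
  assumes "x \<in> N" "y \<in> N" shows "E (pp i (x \<otimes> y)) u = E (pp i x) u + E (pp i y) u"
proof (induction i arbitrary: u)
  case (Suc i)
  have "E (pp i (x \<otimes> y)) = E (pp i x \<otimes> pp i y)" using Suc assms by (auto simp: fun_eq_iff E_mult)
  then have "E (psi (pp i (x \<otimes> y))) = E (psi (pp i x \<otimes> pp i y))" using assms by (intro psi_cong) auto
  then show ?case using assms by (simp add: E_mult E_psi_mult)
qed simp

lemma E_pp_cong: assumes "x \<in> N" "y \<in> N" "E x = E y" shows "E (pp i x) = E (pp i y)"
proof (induction i)
  case (Suc i)
  have "E (psi (pp i x)) = E (psi (pp i y))" using Suc assms by (intro psi_cong) auto
  then show ?case using assms by (auto simp: fun_eq_iff E_mult)
qed simp

lemma E_pp_pow: assumes "x \<in> N" shows "E (pp i (x [^] (m::nat))) u = int m * E (pp i x) u"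
proof (induction m)
  case 0
  have "E (pp i \<one>) = E \<one>"
  proof (induction i)
    case (Suc i)
    have "E (psi (pp i \<one>)) = E (psi \<one>)" using Suc by (intro psi_cong) auto
    then show ?case using t by (simp add: fun_eq_iff E_mult psi_def)
  qed simp
  then show ?case by (simp add: fun_eq_iff)
next
  case (Suc m)
  then show ?case using assms E_pp_mult[of "x [^] m" x] by (simp add: algebra_simps)
qed

lemma E_pp_psi: assumes "x \<in> N" shows "E (pp i (psi x)) = E (psi (pp i x))"
proof (induction i)
  case 0
  then show ?case using t by (simp add: psi_def)
next
  case (Suc i)
  have "E (psi (pp i (psi x))) = E (psi (psi (pp i x)))" using Suc assms by (intro psi_cong) auto
  then show ?case using assms by (auto simp: fun_eq_iff E_mult E_psi_mult)
qed

lemma psi_funpow: assumes "x \<in> carrier G" shows "(psi ^^ i) x = inv (t [^] i) \<otimes> x \<otimes> t [^] i"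
proof (induction i)
  case (Suc i)
  have "t [^] Suc i = t [^] i \<otimes> t" by simp
  then show ?case using Suc assms t by (simp add: psi_def word_simps)
qed (use assms in simp)

lemma psi_funpow_in: "x \<in> N \<Longrightarrow> (psi ^^ i) x \<in> N"
  by (induction i) auto

lemma E_pp_telescope: assumes "x \<in> N" shows "E (psi (pp i x)) u + E x u = E (pp i x) u + E ((psi ^^ i) x) u"
proof (induction i arbitrary: u)
  case 0
  then show ?case using t by (simp add: psi_def)
next
  case (Suc i)
  have p: "(psi ^^ i) x \<in> N" using psi_funpow_in[OF assms] .
  have "E (psi (pp i x) \<otimes> x) = E (pp i x \<otimes> (psi ^^ i) x)"
    using Suc assms p by (auto simp: fun_eq_iff E_mult)
  then have "E (psi (psi (pp i x) \<otimes> x)) = E (psi (pp i x \<otimes> (psi ^^ i) x))" using assms p by (intro psi_cong) auto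
  then show ?case using assms p by (simp add: fun_eq_iff E_mult E_psi_mult)
qed

text \<open>The sum telescopes: \<open>psi\<close> changes the norm by \<open>psi^k x - x\<close>,
  and \<open>psi^k\<close> is conjugation by \<open>t^k\<close>, an element of \<open>N\<close>,
  which is trivial modulo \<open><z>\<close>.\<close>

lemma E_psi_pp_k: assumes "x \<in> N" shows "E (psi (pp k x)) = E (pp k x)"
proof
  fix u
  have "E ((psi ^^ k) x) u = E x u"
    using psi_funpow[of x k] assms E_conj_N[OF k(2)[OF t] assms] by simp
  then show "E (psi (pp k x)) u = E (pp k x) u" using E_pp_telescope[OF assms, of k u] by simp
qed

lemma E_qq: assumes "x \<in> N" shows "E (psi (qq i x)) u + int i * E x u = E (qq i x) u + E (pp i x) u"
proof (induction i)
  case 0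
  then show ?case using t by (simp add: psi_def)
next
  case (Suc i)
  then show ?case using assms by (simp add: E_mult E_psi_mult algebra_simps)
qed

text \<open>The form is invariant under \<open>psi\<close>, so each summand \<open>psi^l x\<close>
  pairs with an element that is fixed modulo \<open><z>\<close> exactly as \<open>x\<close>
  does.\<close>

lemma om_pp_fixed:
  assumes "y \<in> N" "x \<in> N" "E (psi y) = E y" shows "om y (pp i x) = int i * om y x"
proof (induction i)
  case 0
  then show ?case using assms by simp
next
  case (Suc i)
  have "om y (psi (pp i x)) = om (psi y) (psi (pp i x))"
    by (rule om_E_left) (use assms in auto)
  then show ?case using Suc assms om_psi[of y "pp i x"] by (simp add: om_mult_right algebra_simps)
qed

lemma E_pp_fixed:
  assumes "x \<in> N" "E (psi x) = E x" shows "E (pp i x) u = int i * E x u"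
proof (induction i arbitrary: u)
  case (Suc i)
  have "E (pp i x) = E (x [^] i)" using Suc assms by (auto simp: fun_eq_iff)
  then have "E (psi (pp i x)) = E (psi (x [^] i))" using assms by (intro psi_cong) auto
  moreover have "E (psi (x [^] i)) v = int i * E x v" for v
    using assms by (induction i) (simp_all add: E_psi_mult algebra_simps, simp add: psi_def t)
  ultimately show ?case using assms by (simp add: E_mult algebra_simps)
qed simp

lemma cos_pow_in: "g \<in> cos t \<Longrightarrow> g [^] k \<in> N"
  using k(2) cos_carrier by blast

lemma E_cos_pow: assumes "g \<in> cos t" shows "E (g [^] k) u = E (t [^] k) u + E (pp k (tr g)) u"
proof -
  have "g [^] k = (t \<otimes> tr g) [^] k" using tr_eq[OF assms] by simp
  also have "\<dots> = t [^] k \<otimes> pp k (tr g)" using pow_pp tr_in[OF assms] by blast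
  finally show ?thesis using k(2)[OF t] tr_in[OF assms] by (simp add: E_mult)
qed

lemma om_cos_pow:
  assumes "g \<in> cos t" "x \<in> N" shows "om (g [^] k) x = om (t [^] k) x + om (pp k (tr g)) x"
proof -
  have "g [^] k = (t \<otimes> tr g) [^] k" using tr_eq[OF assms(1)] by simp
  also have "\<dots> = t [^] k \<otimes> pp k (tr g)" using pow_pp tr_in[OF assms(1)] by blast
  finally show ?thesis using k(2)[OF t] tr_in[OF assms(1)] assms(2) by (simp add: om_mult_left)
qed

text \<open>\<open>g\<close> commutes with its own power, and \<open>t\<close> differs from
  \<open>g\<close> by an element of \<open>N\<close>, which acts trivially on
  \<open>N/<z>\<close>.\<close>

lemma E_psi_cos_pow: assumes g: "g \<in> cos t" shows "E (psi (g [^] k)) = E (g [^] k)"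
proof
  fix u
  define h where "h = tr g"
  have h: "h \<in> N" "g = t \<otimes> h" using tr_in[OF g] tr_eq[OF g] by (auto simp: h_def)
  have gc: "g \<in> carrier G" using cos_carrier[OF g] .
  have p: "g [^] k \<in> N" using cos_pow_in[OF g] .
  have th: "t = g \<otimes> inv h" using h t by (simp add: word_simps)
  have comm: "g [^] k \<otimes> g = g \<otimes> g [^] k" using group_commutes_pow[OF refl gc gc] .
  have it: "inv t = h \<otimes> inv g" unfolding th using h(1) gc by (simp add: word_simps)
  have "psi (g [^] k) = (h \<otimes> inv g) \<otimes> g [^] k \<otimes> (g \<otimes> inv h)"
    unfolding psi_def by (subst it, subst th, rule refl)
  also have "\<dots> = h \<otimes> inv g \<otimes> (g [^] k \<otimes> g) \<otimes> inv h" using h(1) gc by (simp add: word_simps)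
  also have "\<dots> = h \<otimes> g [^] k \<otimes> inv h" unfolding comm using h(1) gc by (simp add: word_simps)
  finally show "E (psi (g [^] k)) u = E (g [^] k) u" using h(1) p by (simp add: E_mult)
qed

section \<open>Conjugacy inside a coset up to powers of \<open>z\<close>\<close>

lemma pp_ball:
  assumes "t \<in> B m" "x \<in> B n" shows "pp i x \<in> B (i * (2 * m + n))"
proof (induction i)
  case 0
  then show ?case by (simp add: one_in_word_ball)
next
  case (Suc i)
  have "inv t \<otimes> pp i x \<otimes> t \<otimes> x \<in> B (m + i * (2 * m + n) + m + n)"
    using B_mult[OF B_mult[OF B_mult[OF word_ball_inv[OF S(2) assms(1)] Suc] assms(1)] assms(2)] .
  then show ?case by (simp add: psi_def algebra_simps)
qed

lemma qq_ball:
  assumes "t \<in> B m" "x \<in> B n" shows "qq i x \<in> B (i * i * (2 * m + n))"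
proof (induction i)
  case 0
  then show ?case by (simp add: one_in_word_ball)
next
  case (Suc i)
  have "qq i x \<otimes> pp i x \<in> B (i * i * (2 * m + n) + i * (2 * m + n))"
    by (rule B_mult[OF Suc pp_ball[OF assms]])
  then show ?case by (simp only: qq.simps) (rule B_mono, assumption, simp add: algebra_simps)
qed

text \<open>Comparing \<open>k\<close>-th powers shows that \<open>k\<close> times the norm of
  \<open>c\<close> vanishes modulo \<open><z>\<close>, hence so does the norm, as \<open>E\<close>
  takes integer values. Then \<open>k c\<close> equals \<open>x - psi x\<close> for
  \<open>x = qq k c\<close>, which cancels exactly the change of \<open>tr g\<close> caused by
  conjugating with \<open>x\<close>.\<close>

lemma conj_mod_z:
  assumes g: "g \<in> cos t" and g': "g' \<in> cos t" and c: "c \<in> N"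
    and tr: "\<And>u. E (tr g) u = E (tr g') u + int k * E c u" and pow: "E (g [^] k) = E (g' [^] k)"
  shows "\<exists>j. qq k c \<otimes> g \<otimes> inv (qq k c) = g' \<otimes> zp j"
proof -
  define h where "h = tr g"
  define h' where "h' = tr g'"
  have h: "h \<in> N" "g = t \<otimes> h" using tr_in[OF g] tr_eq[OF g] by (auto simp: h_def)
  have h': "h' \<in> N" "g' = t \<otimes> h'" using tr_in[OF g'] tr_eq[OF g'] by (auto simp: h'_def)
  have "E h = E (h' \<otimes> c [^] k)" using tr h'(1) c by (auto simp: fun_eq_iff E_mult h_def h'_def)
  then have "E (pp k h) = E (pp k (h' \<otimes> c [^] k))" using h h' c by (intro E_pp_cong) auto
  then have eq: "E (pp k h) u = E (pp k h') u + int k * E (pp k c) u" for u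
    using h'(1) c by (simp add: E_pp_mult E_pp_pow)
  have "E (pp k h) u = E (pp k h') u" for u
    using E_cos_pow[OF g, of u] E_cos_pow[OF g', of u] pow by (simp add: h_def h'_def)
  then have pc: "E (pp k c) u = 0" for u using eq[of u] k(1) by simp
  define x where "x = qq k c"
  have x: "x \<in> N" using c by (simp add: x_def)
  have px: "E (psi x) u + int k * E c u = E x u" for u
    using E_qq[OF c, of k u] pc[of u] by (simp add: x_def)
  have "E (psi x \<otimes> h \<otimes> inv x) u = E h' u" for u
    using x h(1) tr[of u] px[of u]
    by (simp add: E_mult h_def h'_def)
  then have "E (psi x \<otimes> h \<otimes> inv x) = E h'" by (rule ext)
  then obtain j where j: "psi x \<otimes> h \<otimes> inv x = h' \<otimes> zp j"
    using E_eq_iff[of "psi x \<otimes> h \<otimes> inv x" h'] x h(1) h'(1) by auto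
  have "x \<otimes> g \<otimes> inv x = t \<otimes> (psi x \<otimes> h \<otimes> inv x)"
    unfolding h(2) psi_def using x h(1) t by (simp add: word_simps)
  also have "\<dots> = g' \<otimes> zp j" unfolding j h'(2) using h'(1) t by (simp add: m_assoc)
  finally show ?thesis unfolding x_def by blast
qed

text \<open>The conjugator \<open>qq k c\<close> has length O(n) because \<open>c\<close> has, so
  \<open>z^j\<close>, written as \<open>g'^-1 x g x^-1\<close>, lies in a ball of linear radius. The
  distortion bound for \<open><z>\<close> then makes \<open>j\<close> quadratic.\<close>

lemma conj_bound:
  "\<exists>C::nat. \<forall>n. \<forall>g\<in>cos t \<inter> B n. \<forall>g'\<in>cos t \<inter> B n.
     D (tr g) = D (tr g') \<longrightarrow> E (g [^] k) = E (g' [^] k) \<longrightarrow>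
     (\<exists>j. \<bar>j\<bar> \<le> int (C * (Suc n)\<^sup>2) \<and> gconj g (g' \<otimes> zp j))"
proof -
  obtain m where m: "t \<in> B m" using ex_ball[OF t] by blast
  obtain C1 where C1: "\<And>n x y. x \<in> N \<inter> B n \<Longrightarrow> y \<in> N \<inter> B n \<Longrightarrow> D x = D y \<Longrightarrow>
      \<exists>c\<in>N \<inter> B (C1 * Suc n). \<forall>u. E x u = E y u + int k * E c u" using D_root by metis
  obtain C2 :: nat where C2: "\<And>n i. zp i \<in> B n \<Longrightarrow> \<bar>i\<bar> \<le> int (C2 * (Suc n)\<^sup>2)" using z_bound by metis
  \<comment> \<open>The word for \<open>z^j\<close> has length at most \<open>2 * n + 2 * L\<close>
    with \<open>L\<close> the bound for the conjugator; the 3 covers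
    \<open>2 * n + 1\<close>.\<close>
  define A where "A = 3 + 2 * (k * k * (2 * m + C1 * Suc m))"
  have "\<exists>j. \<bar>j\<bar> \<le> int (C2 * A\<^sup>2 * (Suc n)\<^sup>2) \<and> gconj g (g' \<otimes> zp j)"
    if g: "g \<in> cos t" "g \<in> B n" and g': "g' \<in> cos t" "g' \<in> B n"
      and D: "D (tr g) = D (tr g')" and pow: "E (g [^] k) = E (g' [^] k)" for n g g'
  proof -
    have "tr g \<in> N \<inter> B (m + n)" "tr g' \<in> N \<inter> B (m + n)"
      using tr_in[OF g(1)] tr_in[OF g'(1)] B_mult[OF word_ball_inv[OF S(2) m] g(2)]
        B_mult[OF word_ball_inv[OF S(2) m] g'(2)] by (simp_all add: tr_def)
    then obtain c where c: "c \<in> N" "c \<in> B (C1 * Suc (m + n))"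
      "\<And>u. E (tr g) u = E (tr g') u + int k * E c u" using C1 D by blast
    define x where "x = qq k c"
    define L where "L = k * k * (2 * m + C1 * Suc (m + n))"
    have x: "x \<in> N" "x \<in> B L" using c(1) qq_ball[OF m c(2), of k] by (simp_all add: x_def L_def)
    obtain j where j: "x \<otimes> g \<otimes> inv x = g' \<otimes> zp j"
      using conj_mod_z[OF g(1) g'(1) c(1) c(3) pow] by (auto simp: x_def)
    have gc: "g' \<in> carrier G" "g \<in> carrier G" using cos_carrier[OF g'(1)] cos_carrier[OF g(1)] by auto
    have "zp j = inv g' \<otimes> (x \<otimes> g \<otimes> inv x)" unfolding j using gc by (simp add: word_simps)
    also have "\<dots> \<in> B (n + (L + n + L))"
      using B_mult[OF word_ball_inv[OF S(2) g'(2)] B_mult[OF B_mult[OF x(2) g(2)] word_ball_inv[OF S(2) x(2)]]] .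
    finally have "zp j \<in> B (n + (L + n + L))" .
    then have bj: "\<bar>j\<bar> \<le> int (C2 * (Suc (n + (L + n + L)))\<^sup>2)" by (rule C2)
    have "Suc (m + n) \<le> Suc m * Suc n" by simp
    then have "2 * m + C1 * Suc (m + n) \<le> 2 * m * Suc n + C1 * (Suc m * Suc n)"
      by (intro add_mono mult_left_mono) auto
    also have "\<dots> = (2 * m + C1 * Suc m) * Suc n" by (simp add: algebra_simps)
    finally have le: "2 * m + C1 * Suc (m + n) \<le> (2 * m + C1 * Suc m) * Suc n" .
    define Q where "Q = k * k * ((2 * m + C1 * Suc m) * Suc n)"
    have "L \<le> Q" unfolding L_def Q_def using le by (rule mult_left_mono) simp
    moreover have "A * Suc n = 3 * Suc n + 2 * Q"
      unfolding A_def Q_def by (simp only: distrib_right mult.assoc)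
    ultimately have "Suc (n + (L + n + L)) \<le> A * Suc n" by simp
    then have "C2 * (Suc (n + (L + n + L)))\<^sup>2 \<le> C2 * (A * Suc n)\<^sup>2" by (intro mult_left_mono power_mono) auto
    then have "\<bar>j\<bar> \<le> int (C2 * A\<^sup>2 * (Suc n)\<^sup>2)"
      using bj by (simp only: power_mult_distrib mult.assoc)
    moreover have "gconj g (g' \<otimes> zp j)" unfolding gconj_def using j x(1) by (intro bexI[of _ x]) auto
    ultimately show ?thesis by blast
  qed
  then show ?thesis by (intro exI[of _ "C2 * A\<^sup>2"]) blast
qed

text \<open>\<open>\<rho>\<close> is constant on elements that agree in the label
  \<open>D (tr g)\<close> and in \<open>E (g [^] k)\<close>. Its values stay in
  \<open>\<Gamma>\<close> because the properties that define \<open>\<Gamma>\<close> are applied to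
  \<open>\<rho> g\<close>, and in the ball because its powers serve as codes. The bound on
  \<open>j\<close> is kept apart: it is quadratic at first and linear after a further
  reduction.\<close>

definition normalizes :: "'a set \<Rightarrow> nat \<Rightarrow> ('a \<Rightarrow> 'a) \<Rightarrow> ('a \<Rightarrow> int) \<Rightarrow> bool" where
  "normalizes \<Gamma> n \<rho> j \<longleftrightarrow> (\<forall>g\<in>\<Gamma> \<inter> B n. \<rho> g \<in> \<Gamma> \<inter> B n \<and> E (\<rho> g [^] k) = E (g [^] k) \<and>
     gconj g (\<rho> g \<otimes> zp (j g)) \<and>
     (\<forall>g'\<in>\<Gamma> \<inter> B n. D (tr g) = D (tr g') \<longrightarrow> E (g [^] k) = E (g' [^] k) \<longrightarrow> \<rho> g = \<rho> g'))"

lemma normalizesD: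
  assumes "normalizes \<Gamma> n \<rho> j" "g \<in> \<Gamma> \<inter> B n"
  shows "\<rho> g \<in> \<Gamma>" "\<rho> g \<in> B n" "E (\<rho> g [^] k) = E (g [^] k)" "gconj g (\<rho> g \<otimes> zp (j g))"
  using assms unfolding normalizes_def by blast+

lemma normalizes_eqI:
  assumes "normalizes \<Gamma> n \<rho> j" "g \<in> \<Gamma> \<inter> B n" "g' \<in> \<Gamma> \<inter> B n"
    and "D (tr g) = D (tr g')" "\<And>u. E (\<rho> g [^] k) u = E (\<rho> g' [^] k) u"
  shows "\<rho> g = \<rho> g'"
proof -
  have "E (\<rho> g [^] k) = E (\<rho> g' [^] k)" by (rule ext) (rule assms(5))
  then have "E (g [^] k) = E (g' [^] k)" using normalizesD(3)[OF assms(1)] assms(2,3) by simp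
  then show ?thesis using assms(1-4) unfolding normalizes_def by blast
qed

lemma reduction:
  assumes "\<Gamma> \<subseteq> cos t"
  shows "\<exists>C::nat. \<forall>n. \<exists>\<rho> j. normalizes \<Gamma> n \<rho> j \<and> (\<forall>g\<in>\<Gamma> \<inter> B n. \<bar>j g\<bar> \<le> int (C * (Suc n)\<^sup>2))"
    (is "\<exists>C. \<forall>n. ?P C n")
proof -
  obtain C :: nat where C: "\<And>n g g'. g \<in> cos t \<inter> B n \<Longrightarrow> g' \<in> cos t \<inter> B n \<Longrightarrow>
     D (tr g) = D (tr g') \<Longrightarrow> E (g [^] k) = E (g' [^] k) \<Longrightarrow>
     \<exists>j. \<bar>j\<bar> \<le> int (C * (Suc n)\<^sup>2) \<and> gconj g (g' \<otimes> zp j)" using conj_bound by metis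
  have "?P C n" for n
  proof -
    define r where "r d e = (SOME g. g \<in> \<Gamma> \<inter> B n \<and> D (tr g) = d \<and> E (g [^] k) = e)" for d e
    define \<rho> where "\<rho> g = r (D (tr g)) (E (g [^] k))" for g
    have \<rho>: "\<rho> g \<in> \<Gamma> \<inter> B n \<and> D (tr (\<rho> g)) = D (tr g) \<and> E (\<rho> g [^] k) = E (g [^] k)"
      if "g \<in> \<Gamma> \<inter> B n" for g
      unfolding \<rho>_def r_def by (rule someI[of _ g]) (use that in simp)
    have "\<exists>j. \<bar>j\<bar> \<le> int (C * (Suc n)\<^sup>2) \<and> gconj g (\<rho> g \<otimes> zp j)" if g: "g \<in> \<Gamma> \<inter> B n" for g
      using C[of g n "\<rho> g"] \<rho>[OF g] g assms by auto
    then obtain j where j: "\<And>g. g \<in> \<Gamma> \<inter> B n \<Longrightarrow> \<bar>j g\<bar> \<le> int (C * (Suc n)\<^sup>2) \<and> gconj g (\<rho> g \<otimes> zp (j g))"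
      by metis
    have key: "\<rho> g = \<rho> g'" if "D (tr g) = D (tr g')" "E (g [^] k) = E (g' [^] k)" for g g'
      unfolding \<rho>_def that by (rule refl)
    have "normalizes \<Gamma> n \<rho> j" unfolding normalizes_def using \<rho> j key by blast
    then show ?thesis using j by blast
  qed
  then show ?thesis by blast
qed

lemma tr_D_fin: "finite (D ` tr ` cos t)"
  by (rule finite_subset[OF _ D_fin]) (use tr_in in auto)

lemma gconj_join:
  assumes "g \<in> carrier G" "g' \<in> carrier G" "r \<in> carrier G" "gconj g r" "gconj g' r"
  shows "gconj g g'"
  using assms by (simp add: gconj_iff)

lemma normalizes_gconj:
  assumes \<rho>: "normalizes \<Gamma> n \<rho> j" and \<Gamma>: "\<Gamma> \<subseteq> cos t"
    and g: "g \<in> \<Gamma> \<inter> B n" "g' \<in> \<Gamma> \<inter> B n" and eq: "\<rho> g = \<rho> g'"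
    and shift: "gconj (\<rho> g \<otimes> zp (j g)) (\<rho> g \<otimes> zp (j g'))"
  shows "gconj g g'"
proof -
  have "\<rho> g \<in> carrier G" using normalizesD(1)[OF \<rho> g(1)] \<Gamma> cos_carrier by blast
  moreover have c: "g \<in> carrier G" "g' \<in> carrier G" using g \<Gamma> cos_carrier by blast+
  ultimately have "gconj g (\<rho> g \<otimes> zp (j g'))"
    using gconj_trans[OF c(1) _ _ normalizesD(4)[OF \<rho> g(1)] shift] by simp
  moreover have "gconj g' (\<rho> g \<otimes> zp (j g'))" using normalizesD(4)[OF \<rho> g(2)] eq by simp
  ultimately show ?thesis
    using gconj_join[OF c, of "\<rho> g \<otimes> zp (j g')"] \<open>\<rho> g \<in> carrier G\<close> by simp
qed

lemma gconj_refl: "g \<in> carrier G \<Longrightarrow> gconj g g"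
  by (simp add: gconj_iff)

text \<open>The offset \<open>j\<close> is quadratic in \<open>n\<close>; writing \<open>j = p (n + 1) + q\<close> makes both exponents linear, and
  \<open>p\<close> and \<open>q\<close> are read off from the product by pairing it with \<open>v\<close> and \<open>u\<close>.\<close>

lemma bdd_orthogonal:
  assumes \<Gamma>: "\<Gamma> \<subseteq> cos t" and u: "u \<in> N" and v: "v \<in> N" and uv: "om u v \<noteq> 0"
    and orth: "\<And>g g'. g \<in> \<Gamma> \<Longrightarrow> g' \<in> \<Gamma> \<Longrightarrow>
      om (g [^] k) u = om (g' [^] k) u \<and> om (g [^] k) v = om (g' [^] k) v"
  shows "bdd \<Gamma>"
proof -
  obtain C :: nat where C: "\<And>n. \<exists>\<rho> j. normalizes \<Gamma> n \<rho> j \<and> (\<forall>g\<in>\<Gamma> \<inter> B n. \<bar>j g\<bar> \<le> int (C * (Suc n)\<^sup>2))"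
    using reduction[OF \<Gamma>] by blast
  obtain mu where mu: "u \<in> B mu" using ex_ball u by blast
  obtain mv where mv: "v \<in> B mv" using ex_ball v by blast
  define A where "A = k + mu * C + mv"
  have "\<exists>x d. \<forall>g\<in>\<Gamma> \<inter> B n. x g \<in> N \<inter> B (A * Suc n) \<and> d g \<in> D ` tr ` cos t \<and>
      (\<forall>g'\<in>\<Gamma> \<inter> B n. d g = d g' \<longrightarrow> hconj (x g) (x g') \<longrightarrow> gconj g g')" for n
  proof -
    obtain \<rho> j where r: "normalizes \<Gamma> n \<rho> j" and jb: "\<And>g. g \<in> \<Gamma> \<inter> B n \<Longrightarrow> \<bar>j g\<bar> \<le> int (C * (Suc n)\<^sup>2)"
      using C[of n] by blast
    define p where "p g = j g div int (Suc n)" for g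
    define q where "q g = j g mod int (Suc n)" for g
    define x where "x g = \<rho> g [^] k \<otimes> u [^] p g \<otimes> v [^] q g" for g
    have pw: "\<rho> g [^] k \<in> N" if "g \<in> \<Gamma> \<inter> B n" for g using normalizesD(1)[OF r that] \<Gamma> cos_pow_in by blast
    have xN: "x g \<in> N" if "g \<in> \<Gamma> \<inter> B n" for g unfolding x_def using pw[OF that] u v by auto
    have xB: "x g \<in> B (A * Suc n)" if g: "g \<in> \<Gamma> \<inter> B n" for g
    proof -
      define a where "a = int (Suc n)"
      have a: "a > 0" by (simp add: a_def)
      have ja: "int (C * (Suc n)\<^sup>2) = int C * a * a" by (simp add: a_def power2_eq_square algebra_simps)
      have "\<bar>j g\<bar> \<le> int C * a * a" using jb[OF g] unfolding ja .
      then have "- (int C * a) * a \<le> j g" "j g \<le> int C * a * a" by auto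
      then have "(- (int C * a) * a) div a \<le> p g" "p g \<le> (int C * a * a) div a"
        unfolding p_def a_def[symmetric] using a by (metis zdiv_mono1)+
      moreover have "(- (int C * a) * a) div a = - (int C * a)" "(int C * a * a) div a = int C * a"
        using a by (intro nonzero_mult_div_cancel_right; simp)+
      ultimately have "\<bar>p g\<bar> \<le> int C * a" by linarith
      then have "\<bar>p g\<bar> \<le> int (C * Suc n)" by (simp only: a_def of_nat_mult)
      then have pb: "nat \<bar>p g\<bar> \<le> C * Suc n" by (simp only: nat_le_iff)
      have "0 \<le> q g" "q g < int (Suc n)" unfolding q_def by (auto intro!: pos_mod_bound)
      then have qb: "nat \<bar>q g\<bar> \<le> Suc n" by linarith
      have "x g \<in> B (n * k + mu * nat \<bar>p g\<bar> + mv * nat \<bar>q g\<bar>)"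
        unfolding x_def using B_mult[OF B_mult[OF word_ball_pow[OF S(2)] word_ball_int_pow[OF S(2) mu]]
          word_ball_int_pow[OF S(2) mv]] normalizesD(2)[OF r g] by blast
      moreover have "n * k + mu * nat \<bar>p g\<bar> + mv * nat \<bar>q g\<bar> \<le> Suc n * k + mu * (C * Suc n) + mv * Suc n"
        using pb qb by (intro add_mono mult_left_mono mult_right_mono) auto
      moreover have "Suc n * k + mu * (C * Suc n) + mv * Suc n = A * Suc n"
        unfolding A_def by (simp add: algebra_simps)
      ultimately show ?thesis using B_mono by metis
    qed
    have "gconj g g'" if g: "g \<in> \<Gamma> \<inter> B n" and g': "g' \<in> \<Gamma> \<inter> B n" and d: "D (tr g) = D (tr g')"
      and h: "hconj (x g) (x g')" for g g'
    proof -
      \<comment> \<open>From the \<open>H\<close>-class of the code only its image modulo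
        \<open><z>\<close> is used. The exponents have to be recovered first; only then does
        \<open>E\<close> of the power of \<open>\<rho> g\<close> become known.\<close>
      have e: "E (x g) = E (x g')" using hconj_E[OF h xN[OF g]] .
      note P = pw[OF g] pw[OF g']
      have omx: "om (x a) w = om (\<rho> a [^] k) w + p a * om u w + q a * om v w"
        if "w \<in> N" "a \<in> \<Gamma> \<inter> B n" for w a
        unfolding x_def using that pw[OF that(2)] u v by (simp add: om_mult_left om_int_pow_left)
      have omE: "om (x g) w = om (x g') w" if "w \<in> N" for w
        using om_E_left[OF xN[OF g] xN[OF g'] that e] .
      have rr: "\<rho> g \<in> \<Gamma>" "\<rho> g' \<in> \<Gamma>" by (rule normalizesD(1)[OF r g], rule normalizesD(1)[OF r g'])
      have "p g * om u v = p g' * om u v"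
        using omE[OF v] omx[OF v g] omx[OF v g'] orth[OF rr] om_self[OF v] by simp
      then have pe: "p g = p g'" using uv by simp
      have "q g * om v u = q g' * om v u"
        using omE[OF u] omx[OF u g] omx[OF u g'] orth[OF rr] om_self[OF u] by simp
      then have qe: "q g = q g'" using uv om_anti[OF u v] by simp
      have "E (\<rho> g [^] k) w = E (\<rho> g' [^] k) w" for w
        using fun_cong[OF e, of w] P u v pe qe by (simp add: x_def E_mult)
      then have re: "\<rho> g = \<rho> g'" by (rule normalizes_eqI[OF r g g' d])
      have "j g = j g'" using pe qe unfolding p_def q_def by (metis mult_div_mod_eq)
      then show ?thesis
        using normalizes_gconj[OF r \<Gamma> g g' re] gconj_refl[of "\<rho> g \<otimes> zp (j g)"] rr(1) \<Gamma> cos_carrier by auto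
    qed
    then have *: "\<forall>g\<in>\<Gamma> \<inter> B n. x g \<in> N \<inter> B (A * Suc n) \<and> D (tr g) \<in> D ` tr ` cos t \<and>
      (\<forall>g'\<in>\<Gamma> \<inter> B n. D (tr g) = D (tr g') \<longrightarrow> hconj (x g) (x g') \<longrightarrow> gconj g g')"
      using xN xB \<Gamma> by blast
    show ?thesis by (rule exI[of _ x], rule exI[of _ "\<lambda>g. D (tr g)"], rule *)
  qed
  then show ?thesis by (rule bddI[OF tr_D_fin])
qed

section \<open>Cosets that move \<open>N\<close> modulo its centre\<close>

lemma om_fixed_psi:
  assumes "f \<in> N" "E (psi f) = E f" "y \<in> N" shows "om f (psi y) = om f y"
proof -
  have "om f (psi y) = om (psi f) (psi y)" by (rule om_E_left) (use assms in auto)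
  then show ?thesis using om_psi assms by simp
qed

text \<open>\<open>u\<close> is \<open>psi y - y\<close> and \<open>v\<close> is \<open>k x\<close>
  minus the norm of \<open>x\<close>; both are orthogonal to everything fixed by \<open>psi\<close>
  modulo \<open><z>\<close>, in particular to every \<open>g^k\<close>. They are not orthogonal to
  each other: the norm of \<open>x\<close> is fixed and so drops out of \<open>om u v\<close>, which
  leaves \<open>k * om u x\<close>.\<close>

lemma bdd_cos_moving:
  assumes y: "y \<in> N" and x: "x \<in> N" and ne: "om (psi y) x \<noteq> om y x"
  shows "bdd (cos t)"
proof -
  define u where "u = psi y \<otimes> inv y"
  define v where "v = x [^] k \<otimes> inv (pp k x)"
  have uv: "u \<in> N" "v \<in> N" using x y by (auto simp: u_def v_def)
  have fu: "om f u = 0" if "f \<in> N" "E (psi f) = E f" for f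
    using that y om_fixed_psi[OF that y] by (simp add: u_def om_mult_right om_inv_right)
  have fv: "om f v = 0" if "f \<in> N" "E (psi f) = E f" for f
    using that x om_pp_fixed[OF that(1) x that(2), of k]
    by (simp add: v_def om_mult_right om_inv_right om_nat_pow_right)
  have "om (pp k x) u = 0" by (rule fu) (use x E_psi_pp_k in auto)
  then have "om u (pp k x) = 0" using om_anti[of "pp k x" u] x uv(1) by simp
  then have "om u v = int k * om u x"
    using x uv(1) by (simp add: v_def om_mult_right om_inv_right om_nat_pow_right)
  moreover have "om u x \<noteq> 0" using ne x y by (simp add: u_def om_mult_left om_inv_left)
  ultimately have "om u v \<noteq> 0" using k(1) by simp
  moreover have "om (g [^] k) u = 0 \<and> om (g [^] k) v = 0" if "g \<in> cos t" for g
    using fu[OF cos_pow_in[OF that] E_psi_cos_pow[OF that]] fv[OF cos_pow_in[OF that] E_psi_cos_pow[OF that]] by simp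
  ultimately show ?thesis by (intro bdd_orthogonal[OF subset_refl uv]) auto
qed

text \<open>An element fixed modulo \<open><z>\<close> commutes with \<open>t\<close> up to
  \<open>z^a\<close> and with \<open>tr g\<close> up to \<open>om y (tr g)\<close>. So its
  commutator with \<open>g\<close> is a power of \<open>z\<close> whose exponent is affine in
  \<open>tr g\<close>, with a constant \<open>a\<close> common to the whole coset.\<close>

lemma ex_lam:
  assumes y: "y \<in> N" "E (psi y) = E y"
  shows "\<exists>a. \<forall>g\<in>cos t. y \<otimes> g = g \<otimes> y \<otimes> zp (a + om y (tr g))"
proof -
  obtain a where a: "psi y = y \<otimes> zp a" using E_eq_iff[of "psi y" y] y by auto
  have "y \<otimes> g = g \<otimes> y \<otimes> zp (a + om y (tr g))" if g: "g \<in> cos t" for g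
  proof -
    define h where "h = tr g"
    have h: "h \<in> N" "g = t \<otimes> h" using tr_in[OF g] tr_eq[OF g] by (auto simp: h_def)
    have "y \<otimes> g = t \<otimes> (psi y \<otimes> h)" unfolding h(2) psi_def using t h(1) y by (simp add: word_simps)
    also have "psi y \<otimes> h = (y \<otimes> zp a) \<otimes> (h \<otimes> zp 0)" unfolding a using h(1) y by simp
    also have "\<dots> = (y \<otimes> h) \<otimes> zp a" using mult_zp[OF y(1) h(1), of a 0] by simp
    also have "y \<otimes> h = h \<otimes> y \<otimes> zp (om y h)" by (rule om[OF y(1) h(1)])
    also have "t \<otimes> (h \<otimes> y \<otimes> zp (om y h) \<otimes> zp a) = g \<otimes> y \<otimes> (zp (om y h) \<otimes> zp a)"
      unfolding h(2) using t h(1) y by (simp add: m_assoc)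
    finally show ?thesis by (simp add: zp_add h_def add.commute)
  qed
  then show ?thesis by blast
qed

lemma int_pow_mult_zp:
  assumes "a \<in> carrier G" "zp l \<otimes> a = a \<otimes> zp l"
  shows "(a \<otimes> zp l) [^] (m::int) = a [^] m \<otimes> zp (l * m)"
  using int_pow_mult_distrib[of a "zp l" m] assms by (simp add: int_pow_pow)

text \<open>Moving \<open>y^m\<close> past \<open>r\<close> collects \<open>z^l\<close> once for
  each factor. Hence the class of \<open>r z^j\<close> depends on \<open>j\<close> modulo
  \<open>l\<close> only.\<close>

lemma gconj_shift:
  assumes y: "y \<in> N" and r: "r \<in> cos t" and l: "y \<otimes> r = r \<otimes> y \<otimes> zp l"
  shows "gconj (r \<otimes> zp j) (r \<otimes> zp (j + m * l))"
proof -
  have rc: "r \<in> carrier G" using cos_carrier[OF r] .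
  have "inv r \<otimes> y \<otimes> r = inv r \<otimes> (y \<otimes> r)" using rc y by (simp add: m_assoc)
  also have "\<dots> = y \<otimes> zp l" unfolding l using rc y by (simp add: word_simps)
  finally have "inv r \<otimes> y [^] m \<otimes> r = (y \<otimes> zp l) [^] m" using conj_int_pow[OF rc, of y m] y by simp
  also have "\<dots> = y [^] m \<otimes> zp (l * m)" using y zp_commute[OF y] by (intro int_pow_mult_zp) auto
  finally have c: "inv r \<otimes> y [^] m \<otimes> r = y [^] m \<otimes> zp (l * m)" .
  have "y [^] m \<otimes> (r \<otimes> zp j) \<otimes> inv (y [^] m) = r \<otimes> (inv r \<otimes> y [^] m \<otimes> r) \<otimes> zp j \<otimes> inv (y [^] m)"
    using rc y by (simp add: word_simps)
  also have "\<dots> = r \<otimes> (y [^] m \<otimes> (zp (l * m) \<otimes> zp j \<otimes> inv (y [^] m)))"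
    unfolding c using rc y by (simp add: m_assoc)
  also have "\<dots> = r \<otimes> (y [^] m \<otimes> (inv (y [^] m) \<otimes> zp (l * m + j)))"
    unfolding zp_add using zp_commute[of "inv (y [^] m)" "l * m + j"] y by simp
  also have "\<dots> = r \<otimes> zp (j + m * l)" using y rc by (simp add: word_simps algebra_simps)
  finally show ?thesis unfolding gconj_def using y by (intro bexI[of _ "y [^] m"]) auto
qed

lemma lam_bound:
  assumes y: "y \<in> N" "E (psi y) = E y"
  shows "\<exists>C::nat. \<forall>n. \<forall>g\<in>cos t \<inter> B n. \<exists>l. \<bar>l\<bar> \<le> int (C * Suc n) \<and> y \<otimes> g = g \<otimes> y \<otimes> zp l"
proof -
  obtain m where m: "t \<in> B m" using ex_ball[OF t] by blast
  obtain a where a: "\<And>g. g \<in> cos t \<Longrightarrow> y \<otimes> g = g \<otimes> y \<otimes> zp (a + om y (tr g))" using ex_lam[OF y] by blast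
  obtain C :: nat where C: "\<And>n x. x \<in> N \<inter> B n \<Longrightarrow> \<bar>om y x\<bar> \<le> int (C * Suc n)"
    using Lip[of "om y"] om_mult_right[OF _ _ y(1)] by blast
  have "\<bar>a + om y (tr g)\<bar> \<le> int ((nat \<bar>a\<bar> + C * Suc m) * Suc n)" if g: "g \<in> cos t" "g \<in> B n" for g n
  proof -
    have "tr g \<in> N \<inter> B (m + n)"
      using tr_in[OF g(1)] B_mult[OF word_ball_inv[OF S(2) m] g(2)] by (simp add: tr_def)
    then have "\<bar>om y (tr g)\<bar> \<le> int (C * Suc (m + n))" by (rule C)
    moreover have "C * Suc (m + n) \<le> C * (Suc m * Suc n)" by (intro mult_left_mono) auto
    moreover have "int (nat \<bar>a\<bar>) \<le> int (nat \<bar>a\<bar> * Suc n)" by simp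
    moreover have "int ((nat \<bar>a\<bar> + C * Suc m) * Suc n) = int (nat \<bar>a\<bar> * Suc n) + int (C * (Suc m * Suc n))"
      by (simp only: distrib_right of_nat_add mult.assoc)
    ultimately show ?thesis by linarith
  qed
  then show ?thesis using a by blast
qed

end

section \<open>Cosets that act trivially on \<open>N\<close> modulo its centre\<close>

locale coset_central = coset_setup +
  fixes Y :: "'a set"
  assumes triv: "x \<in> N \<Longrightarrow> y \<in> N \<Longrightarrow> om (psi x) y = om x y"
    and Y: "finite Y" "Y \<subseteq> N" "N \<inter> B n \<subseteq> prods G Y (Suc n)"
begin

lemma om_pp_triv: assumes "x \<in> N" "y \<in> N" shows "om (pp i x) y = int i * om x y"
  by (induction i) (use assms triv in \<open>simp_all add: om_mult_left algebra_simps\<close>)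

text \<open>Since \<open>psi\<close> is trivial modulo the centre, \<open>pp k y\<close> is \<open>y [^] k\<close> up to a central factor,
  so any two degenerate elements of \<open>cos t\<close> differ by a central element of \<open>N\<close>.\<close>

definition deg :: "'a \<Rightarrow> bool" where
  "deg g \<longleftrightarrow> (\<forall>y\<in>Y. pp k y \<otimes> g = g \<otimes> pp k y)"

text \<open>For a degenerate \<open>g\<close> the exponent \<open>a + om (pp k y) (tr g)\<close>
  vanishes, and \<open>a\<close> is the same for the whole coset. So \<open>k * om y (tr g)\<close>
  does not depend on \<open>g\<close> for \<open>y\<close> in \<open>Y\<close>, and additivity
  carries this over to all products of elements of \<open>Y\<close>, that is to
  \<open>N\<close>.\<close>

lemma deg_om:
  assumes g: "g \<in> cos t" "deg g" and g': "g' \<in> cos t" "deg g'" and x: "x \<in> N"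
  shows "om x (tr g) = om x (tr g')"
proof -
  have T: "tr g \<in> N" "tr g' \<in> N" using tr_in g g' by auto
  have yy: "om y (tr g) = om y (tr g')" if y: "y \<in> Y" for y
  proof -
    have yN: "y \<in> N" using y Y(2) by blast
    have pN: "pp k y \<in> N" using yN by simp
    obtain a where a: "\<And>g. g \<in> cos t \<Longrightarrow> pp k y \<otimes> g = g \<otimes> pp k y \<otimes> zp (a + om (pp k y) (tr g))"
      using ex_lam[OF pN E_psi_pp_k[OF yN]] by blast
    have zero: "a + om (pp k y) (tr f) = 0" if f: "f \<in> cos t" "deg f" for f
    proof -
      have fc: "f \<otimes> pp k y \<in> carrier G" using cos_carrier[OF f(1)] pN by simp
      have "f \<otimes> pp k y \<otimes> zp (a + om (pp k y) (tr f)) = f \<otimes> pp k y"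
        using a[OF f(1)] f(2) y unfolding deg_def by simp
      then have "zp (a + om (pp k y) (tr f)) = \<one>"
        using fc by (metis l_cancel_one int_pow_closed z_carrier)
      then show ?thesis by (rule z_inf)
    qed
    then have "om (pp k y) (tr g) = om (pp k y) (tr g')" using zero[OF g] zero[OF g'] by linarith
    then show ?thesis using om_pp_triv[OF yN] T k(1) by simp
  qed
  obtain n where "x \<in> B n" using ex_ball x by blast
  then have xY: "x \<in> prods G Y (Suc n)" using Y(3) x by blast
  have "Y \<subseteq> carrier G" using Y(2) by auto
  from this xY have "x \<in> N \<and> om x (tr g) = om x (tr g')"
  proof (induction rule: prods_induct)
    case (step n x y)
    then show ?case using yy T Y(2) om_mult_left[of x y] by auto
  qed (use T in auto)
  then show ?thesis by blast
qed

text \<open>Since \<open>g^k\<close> pairs like \<open>t^k\<close> plus \<open>k\<close> times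
  \<open>tr g\<close>, all degenerate \<open>g\<close> have the same pairing with every element of
  \<open>N\<close>, so any noncommuting pair in \<open>N\<close> can absorb the offset.\<close>

lemma bdd_deg: "bdd {g \<in> cos t. deg g}"
proof -
  obtain u v where uv: "u \<in> N" "v \<in> N" "om u v \<noteq> 0" using nonabelian by blast
  have "om (g [^] k) x = om (g' [^] k) x"
    if g: "g \<in> cos t" "deg g" and g': "g' \<in> cos t" "deg g'" and x: "x \<in> N" for g g' x
  proof -
    have T: "tr g \<in> N" "tr g' \<in> N" using tr_in g g' by auto
    have "om (tr g) x = om (tr g') x" using deg_om[OF g g' x] om_anti T x by metis
    then show ?thesis using om_cos_pow[OF g(1) x] om_cos_pow[OF g'(1) x] om_pp_triv[OF T(1) x, of k]
        om_pp_triv[OF T(2) x, of k] by simp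
  qed
  then show ?thesis by (intro bdd_orthogonal[OF _ uv]) (use uv in auto)
qed

text \<open>One constant for all norms in question; this is what the finiteness of \<open>Y\<close>
  is for, and why degeneracy is tested on \<open>Y\<close> instead of on \<open>N\<close>.\<close>

lemma lam_bound_uniform:
  "\<exists>C::nat. \<forall>n. \<forall>g\<in>cos t \<inter> B n. \<forall>y\<in>Y. \<exists>l. \<bar>l\<bar> \<le> int (C * Suc n) \<and> pp k y \<otimes> g = g \<otimes> pp k y \<otimes> zp l"
proof -
  have "\<forall>y\<in>Y. \<exists>C::nat. \<forall>n. \<forall>g\<in>cos t \<inter> B n. \<exists>l. \<bar>l\<bar> \<le> int (C * Suc n) \<and> pp k y \<otimes> g = g \<otimes> pp k y \<otimes> zp l"
  proof
    fix y assume "y \<in> Y"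
    then have "y \<in> N" using Y(2) by blast
    then show "\<exists>C::nat. \<forall>n. \<forall>g\<in>cos t \<inter> B n. \<exists>l. \<bar>l\<bar> \<le> int (C * Suc n) \<and> pp k y \<otimes> g = g \<otimes> pp k y \<otimes> zp l"
      by (intro lam_bound E_psi_pp_k) auto
  qed
  then obtain C :: "'a \<Rightarrow> nat" where C: "\<forall>y\<in>Y. \<forall>n. \<forall>g\<in>cos t \<inter> B n.
      \<exists>l. \<bar>l\<bar> \<le> int (C y * Suc n) \<and> pp k y \<otimes> g = g \<otimes> pp k y \<otimes> zp l" using bchoice by metis
  have "\<exists>l. \<bar>l\<bar> \<le> int (sum C Y * Suc n) \<and> pp k y \<otimes> g = g \<otimes> pp k y \<otimes> zp l"
    if g: "g \<in> cos t \<inter> B n" and y: "y \<in> Y" for g n y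
  proof -
    obtain l where l: "\<bar>l\<bar> \<le> int (C y * Suc n)" "pp k y \<otimes> g = g \<otimes> pp k y \<otimes> zp l" using C g y by blast
    have "C y \<le> sum C Y" by (rule member_le_sum[OF y _ Y(1)]) simp
    then have "C y * Suc n \<le> sum C Y * Suc n" by (rule mult_right_mono) simp
    then have "int (C y * Suc n) \<le> int (sum C Y * Suc n)" by (simp only: of_nat_le_iff)
    then show ?thesis using l order_trans by blast
  qed
  then show ?thesis by blast
qed

text \<open>Some norm \<open>pp k y\<close> has with \<open>\<rho> g\<close> a commutator
  \<open>z^l\<close> where \<open>l\<close> is nonzero and of size O(n). Conjugating by its powers
  replaces the quadratic offset by its remainder modulo \<open>|l|\<close>.\<close>

lemma reduction_nondeg:
  defines "\<Gamma> \<equiv> {g \<in> cos t. \<not> deg g}"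
  shows "\<exists>C. \<forall>n. \<exists>\<rho> j. normalizes \<Gamma> n \<rho> (\<lambda>g. int (j g)) \<and> (\<forall>g\<in>\<Gamma> \<inter> B n. j g \<le> C * Suc n)"
    (is "\<exists>C. \<forall>n. ?P C n")
proof -
  have \<Gamma>: "\<Gamma> \<subseteq> cos t" by (auto simp: \<Gamma>_def)
  obtain C :: nat where C: "\<And>n g y. g \<in> cos t \<inter> B n \<Longrightarrow> y \<in> Y \<Longrightarrow>
      \<exists>l. \<bar>l\<bar> \<le> int (C * Suc n) \<and> pp k y \<otimes> g = g \<otimes> pp k y \<otimes> zp l" using lam_bound_uniform by blast
  have "?P C n" for n
  proof -
    obtain \<rho> j where r: "normalizes \<Gamma> n \<rho> j" using reduction[OF \<Gamma>] by blast
    have "\<exists>i. i \<le> C * Suc n \<and> gconj g (\<rho> g \<otimes> zp (int i))" if g: "g \<in> \<Gamma> \<inter> B n" for g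
    proof -
      \<comment> \<open>The commutator is taken with \<open>\<rho> g\<close> and not with
        \<open>g\<close>, so it matters that the representative is itself nondegenerate.\<close>
      have R: "\<rho> g \<in> \<Gamma> \<inter> B n" "gconj g (\<rho> g \<otimes> zp (j g))" using normalizesD[OF r g] by auto
      then have Rc: "\<rho> g \<in> cos t" "\<not> deg (\<rho> g)" by (auto simp: \<Gamma>_def)
      then obtain y where y: "y \<in> Y" "pp k y \<otimes> \<rho> g \<noteq> \<rho> g \<otimes> pp k y" unfolding deg_def by blast
      obtain l where l: "\<bar>l\<bar> \<le> int (C * Suc n)" "pp k y \<otimes> \<rho> g = \<rho> g \<otimes> pp k y \<otimes> zp l"
        using C[of "\<rho> g" n y] Rc R y(1) by blast
      have yN: "pp k y \<in> N" using y Y(2) by auto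
      have l0: "l \<noteq> 0"
      proof
        assume "l = 0"
        then show False using l(2) y(2) yN cos_carrier[OF Rc(1)] by simp
      qed
      define i where "i = j g mod \<bar>l\<bar>"
      have i: "0 \<le> i" "i < \<bar>l\<bar>" using l0 by (auto simp: i_def)
      \<comment> \<open>\<open>l\<close> may be negative; the factor \<open>sgn l\<close> turns a
        multiple of \<open>|l|\<close> into a multiple of \<open>l\<close>.\<close>
      have "j g + (- (j g div \<bar>l\<bar>) * sgn l) * l = j g - (j g div \<bar>l\<bar>) * \<bar>l\<bar>"
        by (simp add: abs_sgn mult.assoc)
      also have "\<dots> = i" unfolding i_def by (simp add: minus_div_mult_eq_mod)
      finally have "gconj (\<rho> g \<otimes> zp (j g)) (\<rho> g \<otimes> zp i)"
        using gconj_shift[OF yN Rc(1) l(2), of "j g" "- (j g div \<bar>l\<bar>) * sgn l"] by simp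
      moreover have "g \<in> carrier G" "\<rho> g \<in> carrier G" using g \<Gamma> Rc cos_carrier by auto
      ultimately have "gconj g (\<rho> g \<otimes> zp i)"
        using gconj_trans[of g "\<rho> g \<otimes> zp (j g)" "\<rho> g \<otimes> zp i"] R(2) by simp
      moreover have "int (nat i) = i" "nat i \<le> C * Suc n" using i l(1) by linarith+
      ultimately show ?thesis by (intro exI[of _ "nat i"]) simp
    qed
    then obtain i where "\<forall>g\<in>\<Gamma> \<inter> B n. i g \<le> C * Suc n \<and> gconj g (\<rho> g \<otimes> zp (int (i g)))" by metis
    then show ?thesis using r unfolding normalizes_def by (intro exI[of _ \<rho>] exI[of _ i]) blast
  qed
  then show ?thesis by blast
qed

text \<open>\<open>u = psi y - y\<close> has norm zero and \<open>g^k\<close> is fixed, so the norm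
  of the code \<open>g^k u^j\<close> is \<open>k\<close> times \<open>g^k\<close> modulo
  \<open><z>\<close>. This gives \<open>\<rho> g\<close> without knowledge of \<open>j\<close>;
  afterwards \<open>j\<close> is read off at a coordinate \<open>w\<close> where \<open>u\<close>
  does not vanish. The code is short enough because \<open>j\<close> is already linear in
  \<open>n\<close>.\<close>

lemma bdd_nondeg_moving:
  assumes y: "y \<in> N" and ne: "E (psi y) \<noteq> E y"
  shows "bdd {g \<in> cos t. \<not> deg g}"
proof -
  define \<Gamma> where "\<Gamma> = {g \<in> cos t. \<not> deg g}"
  have \<Gamma>: "\<Gamma> \<subseteq> cos t" by (auto simp: \<Gamma>_def)
  define u where "u = psi y \<otimes> inv y"
  have u: "u \<in> N" using y by (simp add: u_def)
  obtain w where w: "E u w \<noteq> 0" using ne y by (auto simp: fun_eq_iff u_def E_mult)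
  have inv0: "E (pp k y) v + E (pp k (inv y)) v = 0" for v
    using E_pp_mult[of y "inv y" k v] E_pp_pow[of \<one> k 0 v] y by simp
  have pu: "E (pp k u) v = 0" for v
    using E_pp_psi[OF y, of k] E_psi_pp_k[OF y] inv0[of v] y by (simp add: u_def E_pp_mult)
  obtain C where C: "\<And>n. \<exists>\<rho> j. normalizes \<Gamma> n \<rho> (\<lambda>g. int (j g)) \<and> (\<forall>g\<in>\<Gamma> \<inter> B n. j g \<le> C * Suc n)"
    using reduction_nondeg unfolding \<Gamma>_def by blast
  obtain mu where mu: "u \<in> B mu" using ex_ball u by blast
  define A where "A = k + mu * C"
  have "\<exists>x d. \<forall>g\<in>\<Gamma> \<inter> B n. x g \<in> N \<inter> B (A * Suc n) \<and> d g \<in> D ` tr ` cos t \<and>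
      (\<forall>g'\<in>\<Gamma> \<inter> B n. d g = d g' \<longrightarrow> hconj (x g) (x g') \<longrightarrow> gconj g g')" for n
  proof -
    obtain \<rho> j where r: "normalizes \<Gamma> n \<rho> (\<lambda>g. int (j g))" and jb: "\<And>g. g \<in> \<Gamma> \<inter> B n \<Longrightarrow> j g \<le> C * Suc n"
      using C[of n] by blast
    define x where "x g = \<rho> g [^] k \<otimes> u [^] j g" for g
    have rc: "\<rho> g \<in> cos t" if "g \<in> \<Gamma> \<inter> B n" for g using normalizesD(1)[OF r that] \<Gamma> by blast
    have pw: "\<rho> g [^] k \<in> N" if "g \<in> \<Gamma> \<inter> B n" for g using cos_pow_in[OF rc[OF that]] .
    have xN: "x g \<in> N" if "g \<in> \<Gamma> \<inter> B n" for g unfolding x_def using pw[OF that] u by auto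
    have xB: "x g \<in> B (A * Suc n)" if g: "g \<in> \<Gamma> \<inter> B n" for g
    proof -
      have "\<rho> g \<in> B n" by (rule normalizesD(2)[OF r g])
      then have "x g \<in> B (n * k + mu * j g)"
        unfolding x_def using B_mult[OF word_ball_pow[OF S(2)] word_ball_pow[OF S(2) mu]] by blast
      moreover have "n * k + mu * j g \<le> Suc n * k + mu * (C * Suc n)"
        using jb[OF g] by (intro add_mono mult_left_mono mult_right_mono) auto
      moreover have "Suc n * k + mu * (C * Suc n) = A * Suc n"
        unfolding A_def by (simp add: algebra_simps)
      ultimately show ?thesis using B_mono by metis
    qed
    have "gconj g g'" if g: "g \<in> \<Gamma> \<inter> B n" and g': "g' \<in> \<Gamma> \<inter> B n" and d: "D (tr g) = D (tr g')"
      and h: "hconj (x g) (x g')" for g g'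
    proof -
      have e: "E (x g) = E (x g')" using hconj_E[OF h xN[OF g]] .
      have px: "E (pp k (x a)) v = int k * E (\<rho> a [^] k) v" if "a \<in> \<Gamma> \<inter> B n" for a v
        using pw[OF that] u pu E_pp_fixed[OF pw[OF that] E_psi_cos_pow[OF rc[OF that]], of k v]
        by (simp add: x_def E_pp_mult E_pp_pow)
      have "E (pp k (x g)) = E (pp k (x g'))" using E_pp_cong[OF xN[OF g] xN[OF g'] e] .
      then have pe: "E (\<rho> g [^] k) v = E (\<rho> g' [^] k) v" for v
        using px[OF g, of v] px[OF g', of v] k(1) by simp
      then have re: "\<rho> g = \<rho> g'" by (rule normalizes_eqI[OF r g g' d])
      have "int (j g) * E u w = int (j g') * E u w"
        using fun_cong[OF e, of w] pw[OF g] pw[OF g'] u pe[of w] by (simp add: x_def E_mult)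
      then have "j g = j g'" using w by simp
      then show ?thesis
        using normalizes_gconj[OF r \<Gamma> g g' re] gconj_refl[of "\<rho> g \<otimes> zp (int (j g))"] rc[OF g] cos_carrier by auto
    qed
    then have *: "\<forall>g\<in>\<Gamma> \<inter> B n. x g \<in> N \<inter> B (A * Suc n) \<and> D (tr g) \<in> D ` tr ` cos t \<and>
      (\<forall>g'\<in>\<Gamma> \<inter> B n. D (tr g) = D (tr g') \<longrightarrow> hconj (x g) (x g') \<longrightarrow> gconj g g')"
      using xN xB \<Gamma> by blast
    show ?thesis by (rule exI[of _ x], rule exI[of _ "\<lambda>g. D (tr g)"], rule *)
  qed
  then have "bdd \<Gamma>" by (rule bddI[OF tr_D_fin])
  then show ?thesis by (simp add: \<Gamma>_def)
qed

text \<open>The conjugator \<open>a\<close> lies only in \<open>H\<close>, but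
  \<open>y = a^k\<close> lies in \<open>N\<close>. If \<open>a\<close> shifts
  \<open>R = r^(k k)\<close> by \<open>z^i\<close>, with \<open>i = j' - j\<close>, then
  \<open>om y R = i k\<close>. If \<open>l\<close> is the commutator exponent of \<open>y\<close>
  with \<open>r\<close>, then also \<open>om y R = k (l k)\<close>. So \<open>i = k l\<close>, which
  is the shift of \<open>r\<close> produced by conjugating with \<open>y^k\<close>.\<close>

lemma hconj_power_shift:
  assumes fixed: "\<And>y. y \<in> N \<Longrightarrow> E (psi y) = E y"
    and r: "r \<in> cos t" and h: "hconj ((r [^] k) [^] k \<otimes> zp j) ((r [^] k) [^] k \<otimes> zp j')"
  shows "gconj (r \<otimes> zp j) (r \<otimes> zp j')"
proof -
  define R where "R = (r [^] k) [^] k"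
  have rc: "r \<in> carrier G" using cos_carrier[OF r] .
  have rk: "r [^] k \<in> N" using cos_pow_in[OF r] .
  have R: "R \<in> N" using rk by (simp add: R_def)
  obtain a where a: "a \<in> H" "R \<otimes> zp j' = a \<otimes> (R \<otimes> zp j) \<otimes> inv a" using h by (auto simp: hconj_def R_def)
  have ac: "a \<in> carrier G" using H_carrier[OF a(1)] .
  have az: "zp i \<otimes> a = a \<otimes> zp i" for i
  proof -
    have "inv a \<otimes> z \<otimes> a = inv a \<otimes> (z \<otimes> a)" using ac by (simp add: m_assoc)
    also have "\<dots> = zp 1" unfolding z_H[OF a(1), symmetric] using ac by (simp add: word_simps)
    finally show ?thesis using zp_conj_commute[OF ac, of 1 i] by simp
  qed
  define i where "i = j' - j"
  have "R \<otimes> zp j' \<otimes> a = a \<otimes> (R \<otimes> zp j)" unfolding a(2) using ac R by (simp add: word_simps)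
  then have "a \<otimes> R \<otimes> zp j \<otimes> zp (-j) = R \<otimes> zp j' \<otimes> a \<otimes> zp (-j)" using ac R by (simp add: m_assoc)
  also have "R \<otimes> zp j' \<otimes> a = R \<otimes> a \<otimes> zp j'" using az[of j'] ac R by (simp add: m_assoc)
  finally have "a \<otimes> R \<otimes> (zp j \<otimes> zp (-j)) = R \<otimes> a \<otimes> (zp j' \<otimes> zp (-j))"
    using ac R by (simp add: m_assoc)
  then have "a \<otimes> R = R \<otimes> a \<otimes> zp i" unfolding zp_add using ac R by (simp add: i_def)
  then have "inv R \<otimes> a \<otimes> R = inv R \<otimes> (R \<otimes> (a \<otimes> zp i))" using ac R by (simp add: m_assoc)
  then have aR: "inv R \<otimes> a \<otimes> R = a \<otimes> zp i" using ac R by (simp add: word_simps)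
  define y where "y = a [^] k"
  have y: "y \<in> N" using k(2)[OF ac] by (simp add: y_def)
  have yk: "y = a [^] int k" by (simp add: y_def int_pow_int)
  have "inv R \<otimes> y \<otimes> R = (a \<otimes> zp i) [^] int k"
    unfolding yk using conj_int_pow[of R a "int k"] ac R aR by simp
  also have "\<dots> = y \<otimes> zp (i * int k)" unfolding yk by (rule int_pow_mult_zp[OF ac az])
  finally have "R \<otimes> (inv R \<otimes> y \<otimes> R) = R \<otimes> (y \<otimes> zp (i * int k))" by simp
  then have "y \<otimes> R = R \<otimes> y \<otimes> zp (i * int k)" using y R by (simp add: word_simps)
  then have o1: "om y R = i * int k" using om_eqI[OF y R] by blast
  obtain b where b: "\<And>g. g \<in> cos t \<Longrightarrow> y \<otimes> g = g \<otimes> y \<otimes> zp (b + om y (tr g))"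
    using ex_lam[OF y fixed[OF y]] by blast
  define l where "l = b + om y (tr r)"
  have l: "y \<otimes> r = r \<otimes> y \<otimes> zp l" using b[OF r] by (simp add: l_def)
  have "y \<otimes> r \<otimes> inv y = r \<otimes> (y \<otimes> (zp l \<otimes> inv y))" unfolding l using rc y by (simp add: m_assoc)
  also have "\<dots> = r \<otimes> zp l" using zp_commute[of "inv y" l] y rc by (simp add: word_simps)
  finally have yr: "inv (inv y) \<otimes> r \<otimes> inv y = r \<otimes> zp l" using y by simp
  have "inv (inv y) \<otimes> r [^] int k \<otimes> inv y = (r \<otimes> zp l) [^] int k"
    using conj_int_pow[of "inv y" r "int k"] y rc yr by simp
  also have "\<dots> = r [^] int k \<otimes> zp (l * int k)" by (rule int_pow_mult_zp[OF rc zp_cos[OF r]])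
  finally have "y \<otimes> r [^] k \<otimes> inv y \<otimes> y = r [^] k \<otimes> zp (l * int k) \<otimes> y" using y by (simp add: int_pow_int)
  then have "y \<otimes> r [^] k = r [^] k \<otimes> y \<otimes> zp (l * int k)"
    using y rk zp_commute[OF y, of "l * int k"] by (simp add: m_assoc)
  then have "om y (r [^] k) = l * int k" using om_eqI[OF y rk] by blast
  then have "om y R = int k * (l * int k)" unfolding R_def using om_nat_pow_right[OF rk y, of k] by simp
  then have "i = int k * l" using o1 k(1) by simp
  then have "j' = j + int k * l" by (simp add: i_def)
  then show ?thesis using gconj_shift[OF y r l, of j "int k"] by simp
qed

text \<open>Here \<open>psi y - y\<close> is always zero modulo \<open><z>\<close>, so no
  \<open>u\<close> as in the moving case exists and \<open>j\<close> stays in the exponent of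
  \<open>z\<close>. The image of the code gives \<open>\<rho> g\<close>, and the remaining ambiguity
  of \<open>j\<close> within an \<open>H\<close>-class does not change the \<open>G\<close>-class.
  The factor \<open>z^j\<close> costs linear length because \<open>j\<close> is linear.\<close>

lemma bdd_nondeg_fixed:
  assumes fixed: "\<And>y. y \<in> N \<Longrightarrow> E (psi y) = E y"
  shows "bdd {g \<in> cos t. \<not> deg g}"
proof -
  define \<Gamma> where "\<Gamma> = {g \<in> cos t. \<not> deg g}"
  have \<Gamma>: "\<Gamma> \<subseteq> cos t" by (auto simp: \<Gamma>_def)
  obtain C where C: "\<And>n. \<exists>\<rho> j. normalizes \<Gamma> n \<rho> (\<lambda>g. int (j g)) \<and> (\<forall>g\<in>\<Gamma> \<inter> B n. j g \<le> C * Suc n)"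
    using reduction_nondeg unfolding \<Gamma>_def by blast
  obtain mz where mz: "z \<in> B mz" using ex_ball z_carrier by blast
  define A where "A = k * k + mz * C"
  have "\<exists>x d. \<forall>g\<in>\<Gamma> \<inter> B n. x g \<in> N \<inter> B (A * Suc n) \<and> d g \<in> D ` tr ` cos t \<and>
      (\<forall>g'\<in>\<Gamma> \<inter> B n. d g = d g' \<longrightarrow> hconj (x g) (x g') \<longrightarrow> gconj g g')" for n
  proof -
    obtain \<rho> j where r: "normalizes \<Gamma> n \<rho> (\<lambda>g. int (j g))" and jb: "\<And>g. g \<in> \<Gamma> \<inter> B n \<Longrightarrow> j g \<le> C * Suc n"
      using C[of n] by blast
    define x where "x g = (\<rho> g [^] k) [^] k \<otimes> zp (int (j g))" for g
    have rc: "\<rho> g \<in> cos t" if "g \<in> \<Gamma> \<inter> B n" for g using normalizesD(1)[OF r that] \<Gamma> by blast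
    have pw: "\<rho> g [^] k \<in> N" if "g \<in> \<Gamma> \<inter> B n" for g using cos_pow_in[OF rc[OF that]] .
    have xN: "x g \<in> N" if "g \<in> \<Gamma> \<inter> B n" for g unfolding x_def using pw[OF that] by auto
    have xB: "x g \<in> B (A * Suc n)" if g: "g \<in> \<Gamma> \<inter> B n" for g
    proof -
      have "\<rho> g \<in> B n" by (rule normalizesD(2)[OF r g])
      then have "x g \<in> B (n * k * k + mz * nat \<bar>int (j g)\<bar>)"
        unfolding x_def using B_mult[OF word_ball_pow[OF S(2) word_ball_pow[OF S(2)]] word_ball_int_pow[OF S(2) mz]]
        by blast
      moreover have "n * k * k + mz * nat \<bar>int (j g)\<bar> \<le> Suc n * k * k + mz * (C * Suc n)"
        using jb[OF g] by (intro add_mono mult_left_mono mult_right_mono) auto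
      moreover have "Suc n * k * k + mz * (C * Suc n) = A * Suc n"
        unfolding A_def by (simp add: algebra_simps)
      ultimately show ?thesis using B_mono by metis
    qed
    have "gconj g g'" if g: "g \<in> \<Gamma> \<inter> B n" and g': "g' \<in> \<Gamma> \<inter> B n" and d: "D (tr g) = D (tr g')"
      and h: "hconj (x g) (x g')" for g g'
    proof -
      have e: "E (x g) = E (x g')" using hconj_E[OF h xN[OF g]] .
      have "E (\<rho> g [^] k) v = E (\<rho> g' [^] k) v" for v
        using fun_cong[OF e, of v] pw[OF g] pw[OF g'] k(1) by (simp add: x_def E_mult)
      then have re: "\<rho> g = \<rho> g'" by (rule normalizes_eqI[OF r g g' d])
      have "gconj (\<rho> g \<otimes> zp (int (j g))) (\<rho> g \<otimes> zp (int (j g')))"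
        by (rule hconj_power_shift[OF fixed rc[OF g]]) (use h re in \<open>simp_all add: x_def\<close>)
      then show ?thesis by (rule normalizes_gconj[OF r \<Gamma> g g' re])
    qed
    then have *: "\<forall>g\<in>\<Gamma> \<inter> B n. x g \<in> N \<inter> B (A * Suc n) \<and> D (tr g) \<in> D ` tr ` cos t \<and>
      (\<forall>g'\<in>\<Gamma> \<inter> B n. D (tr g) = D (tr g') \<longrightarrow> hconj (x g) (x g') \<longrightarrow> gconj g g')"
      using xN xB \<Gamma> by blast
    show ?thesis by (rule exI[of _ x], rule exI[of _ "\<lambda>g. D (tr g)"], rule *)
  qed
  then have "bdd \<Gamma>" by (rule bddI[OF tr_D_fin])
  then show ?thesis by (simp add: \<Gamma>_def)
qed

lemma bdd_cos_central: "bdd (cos t)"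
proof -
  have "bdd {g \<in> cos t. \<not> deg g}"
    using bdd_nondeg_moving bdd_nondeg_fixed by blast
  from bdd_Un[OF bdd_deg this] show ?thesis by (rule bdd_subset) auto
qed

end

section \<open>All cosets together\<close>

context conj_setup
begin

lemma bdd_cos: assumes t: "t \<in> carrier G" shows "bdd (cos t)"
  using z_conj[OF t]
proof
  assume "inv t \<otimes> z \<otimes> t = inv z"
  then show ?thesis by (rule bdd_cos_inverting[OF t])
next
  assume tz: "inv t \<otimes> z \<otimes> t = z"
  interpret coset_setup G N z H S E k D t
    by (intro coset_setup.intro conj_setup_axioms coset_setup_axioms.intro t tz)
  show ?thesis
  proof (cases "\<forall>x\<in>N. \<forall>y\<in>N. om (psi x) y = om x y")
    case True
    obtain Y where Y: "finite Y" "Y \<subseteq> N" "\<And>n. N \<inter> B n \<subseteq> prods G Y (Suc n)"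
      using schreier[OF N fin_N S] by blast
    interpret coset_central G N z H S E k D t Y
      by unfold_locales (use True Y in blast)+
    show ?thesis by (rule bdd_cos_central)
  next
    case False
    then show ?thesis using bdd_cos_moving by blast
  qed
qed

lemma bdd_carrier: "bdd (carrier G)"
proof -
  obtain R where R: "finite R" "R \<subseteq> carrier G" "\<And>g. g \<in> carrier G \<Longrightarrow> \<exists>r\<in>R. \<exists>x\<in>N. g = x \<otimes> r"
    using fin_N by (auto simp: fin_idx_def)
  have "bdd (\<Union>r\<in>R'. cos r)" if "R' \<subseteq> R" for R'
  proof -
    have "finite R'" using that R(1) by (rule finite_subset)
    then show ?thesis using that
    proof (induction rule: finite_induct)
      case empty
      then show ?case by (simp add: bdd_empty)
    next
      case (insert r R')
      then have "r \<in> carrier G" using R(2) by blast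
      then show ?case using bdd_Un[OF bdd_cos] insert by simp
    qed
  qed
  then have "bdd (\<Union>r\<in>R. cos r)" by blast
  moreover have "carrier G \<subseteq> (\<Union>r\<in>R. cos r)"
  proof
    fix g assume g: "g \<in> carrier G"
    obtain r x where rx: "r \<in> R" "x \<in> N" "g = x \<otimes> r" using R(3)[OF g] by blast
    have rc: "r \<in> carrier G" using rx(1) R(2) by blast
    \<comment> \<open>\<open>fin_idx\<close> provides right cosets and \<open>cos\<close> is a left
      coset; they agree because \<open>N\<close> is normal.\<close>
    have "inv r \<otimes> g = inv r \<otimes> x \<otimes> r" unfolding rx(3) using rc rx(2) by (simp add: m_assoc)
    then have "g \<in> cos r" using normal'[OF rc rx(2)] g by (simp add: cos_def)
    then show "g \<in> (\<Union>r\<in>R. cos r)" using rx(1) by blast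
  qed
  ultimately show ?thesis by (rule bdd_subset)
qed

end

section \<open>Comparison of the growth functions\<close>

context class2
begin

text \<open>Of the modulus \<open>k * k\<close> one factor is the \<open>k\<close> of the
  conclusion. The other makes all exponents of \<open>c\<close> divisible by \<open>k\<close>, so
  that \<open>c\<close> is a product of powers of \<open>k\<close>-th powers and lands in
  \<open>M\<close>, which may be smaller than the lattice. Its length is controlled by the linear
  bound on coordinates.\<close>

lemma coord_root:
  assumes us: "indep us" "fin_idx G (zlat us)" and S: "finite S" "S \<subseteq> carrier G" "generate G S = carrier G"
    and M: "subgroup M G" "M \<subseteq> zlat us" and k: "0 < (k::nat)" "\<And>g. g \<in> carrier G \<Longrightarrow> g [^] k \<in> M"
  shows "\<exists>C. \<forall>n. \<forall>x\<in>M \<inter> word_ball G S n. \<forall>y\<in>M \<inter> word_ball G S n.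
      (\<lambda>u. coord us x u mod (int k * int k)) = (\<lambda>u. coord us y u mod (int k * int k)) \<longrightarrow>
      (\<exists>c\<in>M \<inter> word_ball G S (C * Suc n). \<forall>u. coord us x u = coord us y u + int k * coord us c u)"
proof -
  have usN: "set us \<subseteq> N" using us(1) by (simp add: indep_def)
  have usG: "set us \<subseteq> carrier G" using usN by auto
  obtain A where A: "set us \<subseteq> word_ball G S A"
    using ex_word_ball_finite[OF S(2,3) _ usG] by auto
  obtain C where C: "\<And>n x. x \<in> zlat us \<inter> word_ball G S n \<Longrightarrow> (\<Sum>u\<leftarrow>us. \<bar>coord us x u\<bar>) \<le> int (C * Suc n)"
    using coord_bound[OF us S(1,2)] by blast
  have "\<exists>c\<in>M \<inter> word_ball G S (A * (k * (2 * C)) * Suc n). \<forall>u. coord us x u = coord us y u + int k * coord us c u"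
    if x: "x \<in> M \<inter> word_ball G S n" and y: "y \<in> M \<inter> word_ball G S n"
      and eq: "(\<lambda>u. coord us x u mod (int k * int k)) = (\<lambda>u. coord us y u mod (int k * int k))" for n x y
  proof -
    define f where "f u = (coord us x u - coord us y u) div (int k * int k)" for u
    have f: "coord us x u - coord us y u = int k * int k * f u" for u
    proof -
      have "int k * int k dvd coord us x u - coord us y u"
        using fun_cong[OF eq, of u] by (simp add: mod_eq_dvd_iff)
      then show ?thesis unfolding f_def by simp
    qed
    define c where "c = prodpow G us (\<lambda>u. int k * f u)"
    have cM: "c \<in> M" unfolding c_def
    proof (rule prodpow_in_subgroup[OF M(1)])
      fix u assume "u \<in> set us"
      then have uc: "u \<in> carrier G" using usG by blast
      have "u [^] (int k * f u) = (u [^] k) [^] f u" using uc by (metis int_pow_int int_pow_pow)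
      then show "u [^] (int k * f u) \<in> M" using subgroup_int_pow[OF M(1) k(2)[OF uc]] by simp
    qed
    have xl: "x \<in> zlat us" "y \<in> zlat us" "c \<in> zlat us" using x y cM M(2) by auto
    have "c = prodpow G us (\<lambda>u. int k * f u) \<otimes> zp 0" using prodpow_in[OF usN] by (simp add: c_def)
    note cc = coord_eqI(1)[OF us(1) this]
    have "coord us x u = coord us y u + int k * coord us c u" for u
    proof (cases "u \<in> set us")
      case True
      then show ?thesis using cc f[of u] by simp
    next
      case False
      then show ?thesis using coord_support(1)[OF xl(1)] coord_support(1)[OF xl(2)] coord_support(1)[OF xl(3)] by simp
    qed
    moreover have "c \<in> word_ball G S (A * (k * (2 * C)) * Suc n)"
    proof -
      have kk: "\<bar>int k * f u\<bar> \<le> int k * \<bar>coord us x u\<bar> + int k * \<bar>coord us y u\<bar>" for u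
      proof -
        have "int k * int k \<ge> 1" using k(1) by (simp add: zmult_eq_1_iff flip: of_nat_mult)
        then have "1 * \<bar>f u\<bar> \<le> (int k * int k) * \<bar>f u\<bar>" by (rule mult_right_mono) simp
        then have "\<bar>f u\<bar> \<le> \<bar>coord us x u - coord us y u\<bar>" unfolding f by (simp add: abs_mult)
        then have "\<bar>f u\<bar> \<le> \<bar>coord us x u\<bar> + \<bar>coord us y u\<bar>" by linarith
        then have "int k * \<bar>f u\<bar> \<le> int k * (\<bar>coord us x u\<bar> + \<bar>coord us y u\<bar>)" by (rule mult_left_mono) simp
        then show ?thesis by (simp add: abs_mult distrib_left)
      qed
      have "(\<Sum>u\<leftarrow>us. \<bar>int k * f u\<bar>) \<le> (\<Sum>u\<leftarrow>us. int k * \<bar>coord us x u\<bar> + int k * \<bar>coord us y u\<bar>)"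
        using kk by (intro sum_list_mono) auto
      also have "\<dots> = int k * (\<Sum>u\<leftarrow>us. \<bar>coord us x u\<bar>) + int k * (\<Sum>u\<leftarrow>us. \<bar>coord us y u\<bar>)"
        by (simp add: sum_list_addf sum_list_const_mult)
      also have "\<dots> \<le> int k * int (C * Suc n) + int k * int (C * Suc n)"
        using C[of x n] C[of y n] x y xl by (intro add_mono mult_left_mono) auto
      also have "\<dots> = int (k * (2 * C) * Suc n)" by (simp add: algebra_simps)
      finally have "(\<Sum>u\<leftarrow>us. \<bar>int k * f u\<bar>) \<le> int (k * (2 * C) * Suc n)" by simp
      then have "nat (\<Sum>u\<leftarrow>us. \<bar>int k * f u\<bar>) \<le> k * (2 * C) * Suc n" by (simp only: nat_le_iff)
      then have "A * nat (\<Sum>u\<leftarrow>us. \<bar>int k * f u\<bar>) \<le> A * (k * (2 * C) * Suc n)" by (rule mult_left_mono) simp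
      also have "\<dots> = A * (k * (2 * C)) * Suc n" by (simp only: mult.assoc)
      finally have le: "A * nat (\<Sum>u\<leftarrow>us. \<bar>int k * f u\<bar>) \<le> A * (k * (2 * C)) * Suc n" .
      have "c \<in> word_ball G S (A * nat (\<Sum>u\<leftarrow>us. \<bar>int k * f u\<bar>))"
        unfolding c_def by (rule prodpow_word_ball[OF S(2)]) (use A in auto)
      then show ?thesis by (rule subsetD[OF word_ball_mono[OF le]])
    qed
    ultimately show ?thesis using cM by blast
  qed
  then show ?thesis by blast
qed

lemma zp_subgroup_generator:
  assumes M: "subgroup M G" and k: "0 < (k::nat)" "z [^] k \<in> M"
  shows "\<exists>c>0. zp c \<in> M \<and> (\<forall>i. zp i \<in> M \<longrightarrow> c dvd i)"
proof -
  let ?P = "\<lambda>m::nat. 0 < m \<and> z [^] m \<in> M"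
  define m where "m = (LEAST m. ?P m)"
  have "?P k" using k by simp
  then have m: "?P m" unfolding m_def by (rule LeastI)
  have least: "m \<le> n" if "?P n" for n unfolding m_def by (rule Least_le) (rule that)
  have zm: "zp (int m) \<in> M" using m by (simp add: int_pow_int)
  have "int m dvd i" if i: "zp i \<in> M" for i
  proof (rule ccontr)
    assume "\<not> int m dvd i"
    then have "i mod int m \<noteq> 0" by (simp only: dvd_eq_mod_eq_0 not_False_eq_True)
    moreover have m0: "0 < int m" using m by simp
    moreover note pos_mod_sign[OF m0, of i] pos_mod_bound[OF m0, of i]
    ultimately have r: "0 < i mod int m" "i mod int m < int m" by linarith+
    have "zp (i mod int m) = zp i \<otimes> zp (int m) [^] (- (i div int m))"
      by (simp only: int_pow_pow[OF z_carrier] zp_add) (simp add: minus_mult_div_eq_mod)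
    then have "zp (i mod int m) \<in> M"
      using i subgroup_int_pow[OF M zm] subgroup.m_closed[OF M] by simp
    moreover have "i mod int m = int (nat (i mod int m))" using r(1) by simp
    ultimately have "z [^] nat (i mod int m) \<in> M" by (metis int_pow_int)
    then have "m \<le> nat (i mod int m)" using least r by simp
    then show False using r by linarith
  qed
  then show ?thesis using m zm by (intro exI[of _ "int m"]) auto
qed

end

context group
begin

text \<open>A commutator of elements of \<open>M\<close> is a power of \<open>w\<close> and lies in
  \<open>M\<close>; the hypotheses on \<open>c\<close> say that \<open>w^c\<close> generates all
  such powers.\<close>

lemma class2_sub:
  assumes H: "class2 G H w" and M: "subgroup M G" "M \<subseteq> H"
    and c: "c > 0" "w [^] (c::int) \<in> M" "\<And>i::int. w [^] i \<in> M \<Longrightarrow> c dvd i"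
  shows "class2 G M (w [^] c)"
proof -
  interpret H: class2 G H w by (rule H)
  show ?thesis
  proof (intro class2.intro class2_axioms.intro)
    show "group G" by (rule is_group)
    show "subgroup M G" by (rule M(1))
    show "w [^] c \<in> M" by (rule c(2))
    show "x \<otimes> w [^] c = w [^] c \<otimes> x" if "x \<in> M" for x
      using H.zp_commute[of x c] that M(2) by auto
    show "i = 0" if "(w [^] c) [^] (i::int) = \<one>" for i
      using that H.z_inf[of "c * i"] c(1) by (simp add: int_pow_pow)
    show "\<exists>i::int. x \<otimes> y = y \<otimes> x \<otimes> (w [^] c) [^] i" if xy: "x \<in> M" "y \<in> M" for x y
    proof -
      have h: "x \<in> H" "y \<in> H" using xy M(2) by auto
      have "H.zp (H.om x y) = inv (y \<otimes> x) \<otimes> (x \<otimes> y)"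
        unfolding H.om[OF h] using h by (simp add: word_simps)
      also have "\<dots> \<in> M" using xy subgroup.m_closed[OF M(1)] subgroup.m_inv_closed[OF M(1)] by simp
      finally have "c dvd H.om x y" by (rule c(3))
      then obtain i where "H.om x y = c * i" by (rule dvdE)
      then have "x \<otimes> y = y \<otimes> x \<otimes> (w [^] c) [^] i" using H.om[OF h] by (simp add: int_pow_pow)
      then show ?thesis by blast
    qed
  qed
qed

text \<open>The lattice \<open>K\<close> over a maximal independent list has finite index and is
  torsion-free modulo \<open><w>\<close>, but need not be normal in \<open>G\<close>. Its core
  \<open>M\<close> is normal, still of finite index, and inherits the coordinates of
  \<open>K\<close>. The element \<open>z\<close> becomes the generator \<open>w^c\<close> of the
  intersection of \<open><w>\<close> with \<open>M\<close>.\<close>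

lemma ex_conj_setup:
  assumes H: "class2 G H w" and nonab: "x \<in> H" "y \<in> H" "x \<otimes> y \<noteq> y \<otimes> x"
    and fin: "fin_idx G H" and T: "finite T" "T \<subseteq> H" "generate G T = H"
    and S: "finite S" "S \<subseteq> carrier G" "generate G S = carrier G"
  shows "\<exists>N z E k (D :: 'a \<Rightarrow> 'a \<Rightarrow> int). conj_setup G N z H S E k D"
proof -
  interpret H: class2 G H w by (rule H)
  have HG: "subgroup H G" by (rule H.N)
  obtain us m where us: "H.indep us" "m > 0" "\<And>t. t \<in> T \<Longrightarrow> t [^] (m::int) \<in> H.zlat us"
    using H.ex_maximal_indep[OF T(1,2)] by blast
  have usH: "set us \<subseteq> H" using us(1) by (simp add: H.indep_def)
  define K where "K = H.zlat us"
  have K: "subgroup K G" "K \<subseteq> H" unfolding K_def by (rule H.subgroup_zlat[OF usH], rule H.zlat_subset[OF usH])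
  have finK: "fin_idx G K" unfolding K_def by (rule H.fin_idx_zlat[OF T fin usH us(2,3)])
  define M where "M = core K"
  have M: "subgroup M G" "M \<subseteq> K" "fin_idx G M"
    unfolding M_def by (rule subgroup_core[OF K(1)], rule core_subset[OF K(1)], rule fin_idx_core[OF K(1) finK])
  have MH: "M \<subseteq> H" using M(2) K(2) by blast
  obtain k :: nat where k: "k > 0" "\<And>g. g \<in> carrier G \<Longrightarrow> g [^] k \<in> M"
    using fin_idx_power[OF M(1,3)] by blast
  obtain c where c: "c > 0" "w [^] (c::int) \<in> M" "\<And>i::int. w [^] i \<in> M \<Longrightarrow> c dvd i"
    using H.zp_subgroup_generator[OF M(1) k(1) k(2)[OF H.z_carrier]] by blast
  interpret M: class2 G M "w [^] c" by (rule class2_sub[OF H M(1) MH c])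
  define E where "E = H.coord us"
  define D where "D x = (\<lambda>u. E x u mod (int k * int k))" for x
  obtain C0 where C0: "\<And>u v. u \<in> set us \<Longrightarrow> v \<in> set us \<Longrightarrow> \<bar>H.om u v\<bar> \<le> C0"
    using H.ex_om_bound[of "set us"] by blast
  have E_mult: "E (x \<otimes> y) u = E x u + E y u" if "x \<in> K" "y \<in> K" for x y u
    unfolding E_def by (rule H.coord_mult(1)[OF us(1) C0 that[unfolded K_def]])
  have E_w: "E (w [^] i) u = 0" for i :: int and u
  proof -
    have "w [^] i \<in> H.zlat us" by (rule H.zp_zlat)
    then show ?thesis using H.coord_zero_iff[OF us(1)] unfolding E_def by blast
  qed
  have wK: "w [^] (i::int) \<in> K" for i unfolding K_def by (rule H.zp_zlat)
  have D_fin: "finite (D ` M)"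
  proof (rule finite_subset)
    show "D ` M \<subseteq> {f. \<forall>u. (u \<in> set us \<longrightarrow> f u \<in> {0..<int k * int k}) \<and> (u \<notin> set us \<longrightarrow> f u = 0)}"
    proof
      fix f assume "f \<in> D ` M"
      then obtain x where x: "x \<in> M" "f = D x" by blast
      then have "\<forall>u. u \<notin> set us \<longrightarrow> E x u = 0"
        unfolding E_def using H.coord_support(1)[of x us] M(2) by (auto simp: K_def)
      then show "f \<in> {f. \<forall>u. (u \<in> set us \<longrightarrow> f u \<in> {0..<int k * int k}) \<and> (u \<notin> set us \<longrightarrow> f u = 0)}"
        using x(2) k(1) by (simp add: D_def)
    qed
    show "finite {f. \<forall>u. (u \<in> set us \<longrightarrow> f u \<in> {0..<int k * int k}) \<and> (u \<notin> set us \<longrightarrow> f u = (0::int))}"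
      by (rule finite_set_of_finite_funs) auto
  qed
  have root: "\<exists>C. \<forall>n. \<forall>x\<in>M \<inter> word_ball G S n. \<forall>y\<in>M \<inter> word_ball G S n. D x = D y \<longrightarrow>
      (\<exists>c\<in>M \<inter> word_ball G S (C * Suc n). \<forall>u. E x u = E y u + int k * E c u)"
    unfolding D_def E_def
    by (rule H.coord_root[OF us(1) finK[unfolded K_def] S M(1) M(2)[unfolded K_def] k])
  obtain C :: nat where C: "\<And>n i. w [^] (i::int) \<in> word_ball G S n \<Longrightarrow> \<bar>i\<bar> \<le> int (C * (Suc n)\<^sup>2)"
    using H.zp_word_bound[OF us(1) finK[unfolded K_def] S(1,2)] by blast
  have zb: "\<exists>C::nat. \<forall>n (i::int). (w [^] c) [^] i \<in> word_ball G S n \<longrightarrow> \<bar>i\<bar> \<le> int (C * (Suc n)\<^sup>2)"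
  proof (intro exI allI impI)
    fix n and i :: int assume "(w [^] c) [^] i \<in> word_ball G S n"
    then have "\<bar>c * i\<bar> \<le> int (C * (Suc n)\<^sup>2)" using C by (simp only: int_pow_pow[OF H.z_carrier])
    moreover have "1 * \<bar>i\<bar> \<le> \<bar>c\<bar> * \<bar>i\<bar>" using c(1) by (intro mult_right_mono) auto
    ultimately show "\<bar>i\<bar> \<le> int (C * (Suc n)\<^sup>2)" unfolding abs_mult by linarith
  qed
  \<comment> \<open>The given noncommuting pair may lie outside \<open>M\<close>. Its
    \<open>k\<close>-th powers lie in \<open>M\<close>, and their pairing is \<open>k * k\<close>
    times the original one, hence nonzero.\<close>
  have pows: "x [^] k \<in> M" "y [^] k \<in> M" using k(2) nonab H.N_carrier by blast+
  have "H.om x y \<noteq> 0" using H.om[OF nonab(1,2)] nonab by auto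
  then have "H.om (x [^] k) (y [^] k) \<noteq> 0"
    using nonab k(1) by (simp add: H.om_nat_pow_left H.om_nat_pow_right)
  then have nc: "x [^] k \<otimes> y [^] k \<noteq> y [^] k \<otimes> x [^] k"
    using H.om_eqI[of "x [^] k" "y [^] k" 0] nonab by auto
  have "M.om (x [^] k) (y [^] k) \<noteq> 0"
  proof
    assume "M.om (x [^] k) (y [^] k) = 0"
    then show False using M.om[OF pows] nc nonab H.N_carrier by simp
  qed
  then have nonabM: "\<exists>x\<in>M. \<exists>y\<in>M. M.om x y \<noteq> 0" using pows by blast
  have ezero: "(\<forall>u. E x u = 0) \<longleftrightarrow> (\<exists>i. x = (w [^] c) [^] (i::int))" if x: "x \<in> M" for x
  proof
    assume "\<forall>u. E x u = 0"
    then obtain i where i: "x = w [^] (i::int)"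
      using H.coord_zero_iff[OF us(1), of x] x M(2) unfolding E_def K_def by blast
    then obtain i' where "i = c * i'" using c(3)[of i] x by (metis dvdE)
    then show "\<exists>i. x = (w [^] c) [^] (i::int)" using i by (metis int_pow_pow H.z_carrier)
  next
    assume "\<exists>i. x = (w [^] c) [^] (i::int)"
    then show "\<forall>u. E x u = 0" using E_w by (auto simp: int_pow_pow)
  qed
  have econj: "E (h \<otimes> x \<otimes> inv h) u = E x u" if h: "h \<in> H" and x: "x \<in> M" for h x u
  proof -
    have xH: "x \<in> H" using x MH by blast
    \<comment> \<open>Conjugation by \<open>h\<close> multiplies \<open>x\<close> by a power of
      \<open>w\<close>, on which the coordinates vanish.\<close>
    have "h \<otimes> x \<otimes> inv h = x \<otimes> (h \<otimes> (w [^] (H.om h x) \<otimes> inv h))"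
      unfolding H.om[OF h xH] using h xH by (simp add: word_simps)
    also have "\<dots> = x \<otimes> w [^] (H.om h x)"
      using H.zp_commute[of "inv h" "H.om h x"] h by (simp add: word_simps)
    finally show ?thesis using E_mult[of x "w [^] (H.om h x)"] x M(2) wK E_w by auto
  qed
  have "conj_setup G M (w [^] c) H S E k D"
  proof (intro conj_setup.intro conj_setup_axioms.intro)
    show "class2 G M (w [^] c)" by (rule M.class2_axioms)
    show "\<exists>n. g \<in> word_ball G S n" if "g \<in> carrier G" for g
      using ex_word_ball[OF S(2), of g] that S(3) by simp
    show "g \<otimes> x \<otimes> inv g \<in> M" if "g \<in> carrier G" "x \<in> M" for g x
      using core_conj that unfolding M_def by blast
    show "E (x \<otimes> y) u = E x u + E y u" if "x \<in> M" "y \<in> M" for x y u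
      using E_mult that M(2) by blast
    show "h \<otimes> w [^] c = w [^] c \<otimes> h" if "h \<in> H" for h using H.zp_commute[OF that, of c] by simp
    show "finite S" "S \<subseteq> carrier G" by (fact S)+
    show "subgroup H G" by (rule HG)
    show "M \<subseteq> H" by (rule MH)
    show "(\<forall>u. E x u = 0) \<longleftrightarrow> (\<exists>i. x = (w [^] c) [^] (i::int))" if "x \<in> M" for x by (rule ezero[OF that])
    show "E (h \<otimes> x \<otimes> inv h) u = E x u" if "h \<in> H" "x \<in> M" for h x u by (rule econj[OF that])
    show "0 < k" by (rule k(1))
    show "g [^] k \<in> M" if "g \<in> carrier G" for g by (rule k(2)[OF that])
    show "fin_idx G M" by (rule M(3))
    show "\<exists>C::nat. \<forall>n (i::int). (w [^] c) [^] i \<in> word_ball G S n \<longrightarrow> \<bar>i\<bar> \<le> int (C * (Suc n)\<^sup>2)" by (rule zb)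
    show "finite (D ` M)" by (rule D_fin)
    show "\<exists>C. \<forall>n. \<forall>x\<in>M \<inter> word_ball G S n. \<forall>y\<in>M \<inter> word_ball G S n. D x = D y \<longrightarrow>
      (\<exists>c\<in>M \<inter> word_ball G S (C * Suc n). \<forall>u. E x u = E y u + int k * E c u)" by (rule root)
    show "\<exists>x\<in>M. \<exists>y\<in>M. M.om x y \<noteq> 0" by (rule nonabM)
  qed
  then show ?thesis by blast
qed

end

lemma growth_leI:
  fixes f g :: "nat \<Rightarrow> nat"
  assumes mono: "\<And>m n. m \<le> n \<Longrightarrow> g m \<le> g n" and le: "\<And>n. f n \<le> C * g (C * Suc n)"
  shows "growth_le f g"
proof -
  \<comment> \<open>For positive \<open>n\<close> one has \<open>Suc n \<le> 2 * n\<close>, which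
    explains \<open>2 * C\<close>. For \<open>n = 0\<close> no multiple of \<open>n\<close> helps,
    so the value \<open>C * g C\<close> goes into the additive constant, and the 2 ensures
    \<open>l > 1\<close>.\<close>
  define l where "l = 2 + 2 * C + C * g C"
  have "f n \<le> l * g (l * n) + l" for n
  proof (cases n)
    case 0
    have "f 0 \<le> C * g C" using le[of 0] by simp
    then show ?thesis using 0 by (simp add: l_def)
  next
    case (Suc m)
    have "C * Suc n \<le> 2 * C * n" using Suc by (simp add: algebra_simps)
    also have "\<dots> \<le> l * n" by (intro mult_right_mono) (auto simp: l_def)
    finally have "g (C * Suc n) \<le> g (l * n)" by (rule mono)
    then have "C * g (C * Suc n) \<le> l * g (l * n)" by (intro mult_mono) (auto simp: l_def)
    then show ?thesis using le[of n] by linarith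
  qed
  moreover have "l > 1" by (simp add: l_def)
  ultimately show ?thesis unfolding growth_le_def by blast
qed

section \<open>Comparing \<open>G\<close> and \<open>H\<close> in both directions\<close>

context group
begin

lemma conj_growth_mono:
  assumes "fin_gen_set G S" "m \<le> n" shows "conj_growth G S m \<le> conj_growth G S n"
proof -
  have "finite (conj_class G ` word_ball G S n)"
    using assms(1) finite_word_ball by (auto simp: fin_gen_set_def)
  then show ?thesis unfolding conj_growth_eq[OF assms(1)]
    by (rule card_mono) (rule image_mono[OF word_ball_mono[OF assms(2)]])
qed

text \<open>Choose one \<open>g\<close> in \<open>A\<close> for each \<open>G\<close>-class. If
  \<open>h = x g x^-1\<close> and \<open>x = y r\<close> with \<open>y\<close> in \<open>H\<close>,
  then \<open>h\<close> is conjugate in \<open>H\<close> to \<open>r g r^-1\<close>, so the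
  \<open>H\<close>-class of \<open>h\<close> is determined by its \<open>G\<close>-class and
  \<open>r\<close>.\<close>

lemma card_conj_subgroup:
  assumes H: "subgroup H G" and R: "finite R" "R \<subseteq> carrier G"
    "\<And>g. g \<in> carrier G \<Longrightarrow> \<exists>r\<in>R. \<exists>x\<in>H. g = x \<otimes> r" and A: "finite A" "A \<subseteq> H"
  shows "card (conj_class (G\<lparr>carrier := H\<rparr>) ` A) \<le> card (conj_class G ` A) * card R"
proof -
  let ?cH = "conj_class (G\<lparr>carrier := H\<rparr>)"
  have HG: "H \<subseteq> carrier G" by (rule subgroup.subset[OF H])
  define rep where "rep \<kappa> = (SOME g. g \<in> A \<and> conj_class G g = \<kappa>)" for \<kappa>
  have rep: "rep (conj_class G h) \<in> A \<and> conj_class G (rep (conj_class G h)) = conj_class G h" if "h \<in> A" for h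
    unfolding rep_def by (rule someI[of _ h]) (use that in simp)
  have "\<exists>r\<in>R. ?cH h = ?cH (r \<otimes> rep (conj_class G h) \<otimes> inv r) \<and> r \<otimes> rep (conj_class G h) \<otimes> inv r \<in> H"
    if h: "h \<in> A" for h
  proof -
    define g where "g = rep (conj_class G h)"
    have g: "g \<in> A" "conj_class G g = conj_class G h" using rep[OF h] by (auto simp: g_def)
    have c: "g \<in> carrier G" "h \<in> carrier G" using g h A HG by auto
    obtain x where x: "x \<in> carrier G" "h = x \<otimes> g \<otimes> inv x" using g(2) conj_class_eq_iff[OF c] by blast
    obtain r y where r: "r \<in> R" "y \<in> H" "x = y \<otimes> r" using R(3)[OF x(1)] by blast
    have c': "r \<in> carrier G" "y \<in> carrier G" using r R HG by auto
    define f where "f = r \<otimes> g \<otimes> inv r"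
    have hf: "h = y \<otimes> f \<otimes> inv y" unfolding x(2) r(3) f_def using c c' by (simp add: word_simps)
    have fc: "f \<in> carrier G" using c c' by (simp add: f_def)
    have "f = inv y \<otimes> h \<otimes> y" unfolding hf using c' fc by (simp add: word_simps)
    then have fH: "f \<in> H" using r(2) h A subgroup.m_closed[OF H] subgroup.m_inv_closed[OF H] by auto
    have hH: "h \<in> H" using h A by blast
    have "?cH f = ?cH h" using conj_class_subgroup_eq_iff[OF H fH hH] hf r(2) by blast
    then show ?thesis using r(1) fH by (auto simp: f_def g_def)
  qed
  then obtain r where r: "\<And>h. h \<in> A \<Longrightarrow> r h \<in> R \<and> ?cH h = ?cH (r h \<otimes> rep (conj_class G h) \<otimes> inv (r h))"
    by metis
  have "?cH ` A \<subseteq> (\<lambda>(\<kappa>, r). ?cH (r \<otimes> rep \<kappa> \<otimes> inv r)) ` (conj_class G ` A \<times> R)"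
  proof
    fix \<kappa> assume "\<kappa> \<in> ?cH ` A"
    then obtain h where h: "h \<in> A" "\<kappa> = ?cH h" by blast
    have "\<kappa> = (\<lambda>(\<kappa>, r). ?cH (r \<otimes> rep \<kappa> \<otimes> inv r)) (conj_class G h, r h)" using r[OF h(1)] h(2) by simp
    moreover have "(conj_class G h, r h) \<in> conj_class G ` A \<times> R" using r[OF h(1)] h(1) by blast
    ultimately show "\<kappa> \<in> (\<lambda>(\<kappa>, r). ?cH (r \<otimes> rep \<kappa> \<otimes> inv r)) ` (conj_class G ` A \<times> R)" by (rule image_eqI)
  qed
  moreover have fin: "finite (conj_class G ` A \<times> R)" using A R by simp
  ultimately have "card (?cH ` A) \<le> card (conj_class G ` A \<times> R)" by (rule surj_card_le[rotated])
  then show ?thesis by (simp add: card_cartesian_product)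
qed

lemma growth_le_subgroup:
  assumes H: "subgroup H G" "fin_idx G H" and T: "fin_gen_set (G\<lparr>carrier := H\<rparr>) T" and S: "fin_gen_set G S"
  shows "growth_le (conj_growth (G\<lparr>carrier := H\<rparr>) T) (conj_growth G S)"
proof -
  let ?K = "G\<lparr>carrier := H\<rparr>"
  have Tp: "finite T" "T \<subseteq> H" using T by (auto simp: fin_gen_set_def)
  have Sp: "S \<subseteq> carrier G" "generate G S = carrier G" "finite S" using S by (auto simp: fin_gen_set_def)
  have TG: "T \<subseteq> carrier G" using Tp subgroup.subset[OF H(1)] by blast
  obtain R where R: "finite R" "R \<subseteq> carrier G" "\<And>g. g \<in> carrier G \<Longrightarrow> \<exists>r\<in>R. \<exists>x\<in>H. g = x \<otimes> r"
    using H(2) by (auto simp: fin_idx_def)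
  obtain C where C: "T \<subseteq> word_ball G S C" using ex_word_ball_finite[OF Sp(1,2) Tp(1) TG] by blast
  interpret GH: group ?K by (rule subgroup_imp_group[OF H(1)])
  have ball: "x \<in> H \<and> x \<in> word_ball G S (C * n)" if "x \<in> word_ball G T n" for x n
    using word_ball_gens[OF TG] that[unfolded word_ball_def]
  proof (induction rule: prods_induct)
    case (one n)
    then show ?case using subgroup.one_closed[OF H(1)] one_in_word_ball by blast
  next
    case (step n x y)
    have T1: "s \<in> H \<and> s \<in> word_ball G S C" if "s \<in> T" for s using that C Tp(2) by blast
    have T2: "inv s \<in> H \<and> inv s \<in> word_ball G S C" if "s \<in> T" for s
      using T1[OF that] subgroup.m_inv_closed[OF H(1)] word_ball_inv[OF Sp(1)] by simp
    have "y \<in> T \<union> m_inv G ` T" by (rule step)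
    then have y: "y \<in> H" "y \<in> word_ball G S C" using T1 T2 by blast+
    have x: "x \<in> H" "x \<in> word_ball G S (C * n)" using step.IH by auto
    have "x \<otimes> y \<in> word_ball G S (C * n + C)" by (rule word_ball_mult[OF Sp(1) x(2) y(2)])
    then show ?case using subgroup.m_closed[OF H(1) x(1) y(1)] by (simp add: add.commute)
  next
    case (mono n x)
    then show ?case using word_ball_mono[of "C * n" "C * Suc n" G S] by auto
  qed
  define C' where "C' = C + card R"
  have "conj_growth ?K T n \<le> C' * conj_growth G S (C' * Suc n)" for n
  proof -
    have "conj_growth ?K T n = card (conj_class ?K ` word_ball G T n)"
      unfolding GH.conj_growth_eq[OF T] word_ball_subgroup[OF H(1) Tp(2)] by (rule refl)
    also have "\<dots> \<le> card (conj_class G ` word_ball G T n) * card R"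
      by (rule card_conj_subgroup[OF H(1) R]) (use finite_word_ball[OF Tp(1)] ball in blast)+
    also have "\<dots> \<le> conj_growth G S (C' * Suc n) * card R"
    proof (rule mult_right_mono)
      have "word_ball G T n \<subseteq> word_ball G S (C * n)" using ball by blast
      then have "card (conj_class G ` word_ball G T n) \<le> card (conj_class G ` word_ball G S (C * n))"
        by (intro card_mono finite_imageI image_mono finite_word_ball[OF Sp(3)])
      also have "\<dots> = conj_growth G S (C * n)" by (simp only: conj_growth_eq[OF S])
      also have "\<dots> \<le> conj_growth G S (C' * Suc n)"
        by (rule conj_growth_mono[OF S]) (unfold C'_def, intro mult_mono, auto)
      finally show "card (conj_class G ` word_ball G T n) \<le> conj_growth G S (C' * Suc n)" .
    qed simp
    also have "\<dots> \<le> C' * conj_growth G S (C' * Suc n)" by (simp add: C'_def)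
    finally show ?thesis .
  qed
  note le = this
  show ?thesis by (rule growth_leI[where C = C']) (erule conj_growth_mono[OF S], rule le)
qed

text \<open>The coset count bounds the classes of \<open>G\<close> by classes of \<open>H\<close>
  that meet a ball for \<open>S\<close>. As \<open>H\<close> is undistorted, this ball meets
  \<open>H\<close> inside a ball for \<open>T\<close> of comparable radius.\<close>

lemma growth_le_class2:
  assumes H: "class2 G H w" "fin_idx G H" and nonab: "x \<in> H" "y \<in> H" "x \<otimes> y \<noteq> y \<otimes> x"
    and T: "fin_gen_set (G\<lparr>carrier := H\<rparr>) T" and S: "fin_gen_set G S"
  shows "growth_le (conj_growth G S) (conj_growth (G\<lparr>carrier := H\<rparr>) T)"
proof -
  let ?K = "G\<lparr>carrier := H\<rparr>"
  have HG: "subgroup H G" by (rule class2.N[OF H(1)])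
  have Tp: "finite T" "T \<subseteq> H" using T by (auto simp: fin_gen_set_def)
  have Tg: "generate G T = H" using T generate_consistent[OF Tp(2) HG] by (simp add: fin_gen_set_def)
  have Sp: "finite S" "S \<subseteq> carrier G" "generate G S = carrier G" using S by (auto simp: fin_gen_set_def)
  obtain N z E k and D :: "'a \<Rightarrow> 'a \<Rightarrow> int" where "conj_setup G N z H S E k D"
    using ex_conj_setup[OF H(1) nonab H(2) Tp Tg Sp] by blast
  then interpret A: conj_setup G N z H S E k D .
  interpret GH: group ?K by (rule subgroup_imp_group[OF HG])
  obtain C where C: "\<And>n. card (conj_class G ` (carrier G \<inter> word_ball G S n)) \<le> C * A.H_count (C * Suc n)"
    using A.bdd_carrier unfolding A.bdd_def by blast
  obtain C' where C': "\<And>n. H \<inter> word_ball G S n \<subseteq> word_ball G T (C' * Suc n)"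
    using word_ball_fin_idx_compare[OF HG H(2) Sp(1,2) Tp(2) Tg] by blast
  \<comment> \<open>Two linear changes of radius are composed:
    \<open>C' * Suc (C * Suc n) \<le> C' * Suc C * Suc n\<close>. The summand \<open>C\<close>
    covers the factor in front.\<close>
  define A where "A = C + C' * Suc C"
  have "conj_growth G S n \<le> A * conj_growth ?K T (A * Suc n)" for n
  proof -
    have "carrier G \<inter> word_ball G S n = word_ball G S n" using word_ball_closed[OF Sp(2)] by blast
    then have "conj_growth G S n \<le> C * A.H_count (C * Suc n)" using C[of n] by (simp add: conj_growth_eq[OF S])
    moreover have "A.H_count (C * Suc n) \<le> conj_growth ?K T (C' * Suc (C * Suc n))"
    proof -
      have "N \<inter> word_ball G S (C * Suc n) \<subseteq> word_ball G T (C' * Suc (C * Suc n))"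
        using C'[of "C * Suc n"] A.H(2) by blast
      then show ?thesis
        unfolding A.H_count_def GH.conj_growth_eq[OF T] word_ball_subgroup[OF HG Tp(2)]
        by (intro card_mono finite_imageI finite_word_ball[OF Tp(1)] image_mono)
    qed
    moreover have "conj_growth ?K T (C' * Suc (C * Suc n)) \<le> conj_growth ?K T (A * Suc n)"
    proof (rule GH.conj_growth_mono[OF T])
      have "C' * Suc (C * Suc n) \<le> C' * (Suc C * Suc n)" by (intro mult_left_mono) auto
      also have "\<dots> \<le> A * Suc n" unfolding A_def mult.assoc[symmetric] by (intro mult_right_mono) auto
      finally show "C' * Suc (C * Suc n) \<le> A * Suc n" .
    qed
    ultimately have "conj_growth G S n \<le> C * conj_growth ?K T (A * Suc n)"
      by (meson le_trans mult_le_mono2)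
    also have "\<dots> \<le> A * conj_growth ?K T (A * Suc n)" by (intro mult_right_mono) (auto simp: A_def)
    finally show ?thesis .
  qed
  note le = this
  show ?thesis by (rule growth_leI[where C = A]) (erule GH.conj_growth_mono[OF T], rule le)
qed

section \<open>Finite generation, and the hypotheses on \<open>H\<close> in the form of
  \<open>class2\<close>\<close>

lemma finitely_generated_fin_idx:
  assumes H: "subgroup H G" "fin_idx G H" and fg: "finitely_generated (G\<lparr>carrier := H\<rparr>)"
  shows "finitely_generated G"
proof -
  obtain T where T: "fin_gen_set (G\<lparr>carrier := H\<rparr>) T" using fg by (auto simp: finitely_generated_def)
  have Tp: "finite T" "T \<subseteq> H" using T by (auto simp: fin_gen_set_def)
  have Tg: "generate G T = H" using T generate_consistent[OF Tp(2) H(1)] by (simp add: fin_gen_set_def)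
  have TG: "T \<subseteq> carrier G" using Tp subgroup.subset[OF H(1)] by blast
  obtain R where R: "finite R" "R \<subseteq> carrier G" "\<And>g. g \<in> carrier G \<Longrightarrow> \<exists>r\<in>R. \<exists>x\<in>H. g = x \<otimes> r"
    using H(2) by (auto simp: fin_idx_def)
  have "carrier G \<subseteq> generate G (T \<union> R)"
  proof
    fix g assume "g \<in> carrier G"
    then obtain r x where rx: "r \<in> R" "x \<in> H" "g = x \<otimes> r" using R(3) by blast
    have "x \<in> generate G (T \<union> R)" using rx(2) mono_generate[of T "T \<union> R"] Tg by blast
    moreover have "r \<in> generate G (T \<union> R)" using rx(1) by (intro generate.incl) auto
    ultimately show "g \<in> generate G (T \<union> R)" unfolding rx(3) by (rule generate.eng)
  qed
  moreover have "generate G (T \<union> R) \<subseteq> carrier G" using generate_incl[of "T \<union> R"] TG R(2) by blast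
  ultimately have "fin_gen_set G (T \<union> R)" using Tp R TG by (auto simp: fin_gen_set_def)
  then show ?thesis by (auto simp: finitely_generated_def)
qed

text \<open>Class 2 makes every single commutator central in \<open>H\<close>, hence all of the
  derived subgroup, whose generator \<open>w\<close> is the central element sought. A relation
  \<open>w^i = 1\<close> with nonzero \<open>i\<close> would make the derived subgroup finite, and
  commutativity of \<open>H\<close> would make it trivial; both contradict its being
  infinite.\<close>

lemma nilpotent2_class2:
  assumes H: "subgroup H G" and nil: "nilpotent_of_class (G\<lparr>carrier := H\<rparr>) 2"
    and cyc: "cyclic_group (G\<lparr>carrier := derived G H\<rparr>)" and inf: "infinite (derived G H)"
  shows "\<exists>w. class2 G H w \<and> (\<exists>x\<in>H. \<exists>y\<in>H. x \<otimes> y \<noteq> y \<otimes> x)"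
proof -
  have HG: "H \<subseteq> carrier G" by (rule subgroup.subset[OF H])
  have Hc: "x \<in> carrier G" if "x \<in> H" for x using that HG by blast
  let ?D = "derived G H"
  have D: "subgroup ?D G" by (rule derived_is_subgroup[OF HG])
  have DH: "?D \<subseteq> H" by (rule derived_incl[OF subset_refl H])
  interpret GD: group "G\<lparr>carrier := ?D\<rparr>" by (rule subgroup_imp_group[OF D])
  obtain w where w: "w \<in> ?D" "?D = range (\<lambda>n::int. w [^]\<^bsub>G\<lparr>carrier := ?D\<rparr>\<^esub> n)"
    using cyc GD.cyclic_group by auto
  have wD: "?D = range (\<lambda>n::int. w [^] n)" using w(2) int_pow_consistent[OF D w(1)] by simp
  have wH: "w \<in> H" using w(1) DH by blast
  have wc: "w \<in> carrier G" using Hc[OF wH] .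
  have comm_in: "x \<otimes> y \<otimes> inv x \<otimes> inv y \<in> ?D" if "x \<in> H" "y \<in> H" for x y
    unfolding derived_def by (rule generate.incl) (use that in blast)
  let ?K = "G\<lparr>carrier := H\<rparr>"
  have inv_eq: "inv\<^bsub>?K\<^esub> x = inv x" if "x \<in> H" for x using m_inv_consistent[OF H that] .
  have cH: "x \<otimes> y \<otimes> inv x \<otimes> inv y \<in> H" if "x \<in> H" "y \<in> H" for x y
    using comm_in[OF that] DH by blast
  have l1: "x \<otimes> y \<otimes> inv x \<otimes> inv y \<in> lower_central ?K (Suc 0)" if xy: "x \<in> H" "y \<in> H" for x y
  proof -
    have "x \<otimes> y \<otimes> inv x \<otimes> inv y = x \<otimes>\<^bsub>?K\<^esub> y \<otimes>\<^bsub>?K\<^esub> inv\<^bsub>?K\<^esub> x \<otimes>\<^bsub>?K\<^esub> inv\<^bsub>?K\<^esub> y"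
      using xy inv_eq by simp
    then show ?thesis unfolding lower_central.simps
      by (intro generate.incl) (use xy in auto)
  qed
  have l2: "c \<otimes> h = h \<otimes> c" if c: "c \<in> lower_central ?K (Suc 0)" "c \<in> H" and h: "h \<in> H" for c h
  proof -
    have "c \<otimes> h \<otimes> inv c \<otimes> inv h = c \<otimes>\<^bsub>?K\<^esub> h \<otimes>\<^bsub>?K\<^esub> inv\<^bsub>?K\<^esub> c \<otimes>\<^bsub>?K\<^esub> inv\<^bsub>?K\<^esub> h"
      using c(2) h inv_eq by simp
    then have "c \<otimes> h \<otimes> inv c \<otimes> inv h \<in> lower_central ?K (Suc (Suc 0))"
      unfolding lower_central.simps(2)[of _ "Suc 0"]
      by (intro generate.incl) (use c(1) h in auto)
    moreover have "lower_central ?K (Suc (Suc 0)) = {\<one>}"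
      using nil by (simp add: nilpotent_of_class_def numeral_2_eq_2 del: lower_central.simps)
    ultimately have one: "c \<otimes> h \<otimes> inv c \<otimes> inv h = \<one>" by blast
    have "c \<otimes> h = (c \<otimes> h \<otimes> inv c \<otimes> inv h) \<otimes> (h \<otimes> c)"
      using Hc[OF c(2)] Hc[OF h] by (simp add: word_simps)
    then show ?thesis unfolding one using Hc[OF c(2)] Hc[OF h] by simp
  qed
  have Dcent: "d \<otimes> h = h \<otimes> d" if d: "d \<in> ?D" and h: "h \<in> H" for d h
    using d unfolding derived_def
  proof (induction rule: generate.induct)
    case one
    then show ?case using Hc[OF h] by simp
  next
    case (incl d)
    then obtain x y where "x \<in> H" "y \<in> H" "d = x \<otimes> y \<otimes> inv x \<otimes> inv y" by blast
    then show ?case using l2[OF l1 cH h] by blast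
  next
    case (inv d)
    then obtain x y where xy: "x \<in> H" "y \<in> H" "d = x \<otimes> y \<otimes> inv x \<otimes> inv y" by blast
    have dc: "d \<in> carrier G" using Hc[OF cH[OF xy(1,2)]] xy(3) by simp
    have dh: "d \<otimes> h = h \<otimes> d" unfolding xy(3) by (rule l2[OF l1[OF xy(1,2)] cH[OF xy(1,2)] h])
    have "inv d \<otimes> h = inv d \<otimes> (h \<otimes> d) \<otimes> inv d" using dc Hc[OF h] by (simp add: word_simps)
    also have "\<dots> = h \<otimes> inv d" unfolding dh[symmetric] using dc Hc[OF h] by (simp add: word_simps)
    finally show ?case .
  next
    case (eng a b)
    have c: "a \<in> carrier G" "b \<in> carrier G"
      using eng(1,2) subgroup.subset[OF D] unfolding derived_def by blast+
    have "a \<otimes> b \<otimes> h = a \<otimes> (b \<otimes> h)" using c Hc[OF h] by (simp add: m_assoc)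
    also have "\<dots> = (a \<otimes> h) \<otimes> b" unfolding eng(4) using c Hc[OF h] by (simp add: m_assoc)
    also have "\<dots> = h \<otimes> (a \<otimes> b)" unfolding eng(3) using c Hc[OF h] by (simp add: m_assoc)
    finally show ?case .
  qed
  have winf: "i = 0" if "w [^] (i::int) = \<one>" for i
  proof (rule ccontr)
    assume i: "i \<noteq> 0"
    have "w [^] n \<in> (\<lambda>n::int. w [^] n) ` {0..<\<bar>i\<bar>}" for n :: int
    proof -
      have wi: "w [^] \<bar>i\<bar> = \<one>" using that wc by (cases "i \<ge> 0") (simp_all add: int_pow_neg)
      have "w [^] n = w [^] (\<bar>i\<bar> * (n div \<bar>i\<bar>) + n mod \<bar>i\<bar>)" by simp
      also have "\<dots> = (w [^] \<bar>i\<bar>) [^] (n div \<bar>i\<bar>) \<otimes> w [^] (n mod \<bar>i\<bar>)"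
        unfolding int_pow_mult[OF wc, symmetric] int_pow_pow[OF wc] ..
      also have "\<dots> = w [^] (n mod \<bar>i\<bar>)" unfolding wi using wc by simp
      finally show ?thesis using i by (intro image_eqI[of _ _ "n mod \<bar>i\<bar>"]) auto
    qed
    then have "?D \<subseteq> (\<lambda>n::int. w [^] n) ` {0..<\<bar>i\<bar>}" unfolding wD by blast
    then show False using inf finite_subset by blast
  qed
  have "class2 G H w"
  proof (intro class2.intro class2_axioms.intro)
    show "group G" by (rule is_group)
    show "subgroup H G" "w \<in> H" by (rule H, rule wH)
    show "x \<otimes> w = w \<otimes> x" if "x \<in> H" for x using Dcent[OF w(1) that] by simp
    show "i = 0" if "w [^] (i::int) = \<one>" for i using winf[OF that] .
    show "\<exists>i::int. x \<otimes> y = y \<otimes> x \<otimes> w [^] i" if xy: "x \<in> H" "y \<in> H" for x y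
    proof -
      let ?d = "x \<otimes> y \<otimes> inv x \<otimes> inv y"
      obtain i :: int where i: "?d = w [^] i" using comm_in[OF xy] wD by blast
      have yx: "y \<otimes> x \<in> H" using subgroup.m_closed[OF H xy(2,1)] .
      have "x \<otimes> y = ?d \<otimes> (y \<otimes> x)" using Hc[OF xy(1)] Hc[OF xy(2)] by (simp add: word_simps)
      also have "\<dots> = y \<otimes> x \<otimes> ?d" by (rule Dcent[OF comm_in[OF xy] yx])
      finally show ?thesis unfolding i by blast
    qed
  qed
  moreover have "\<exists>x\<in>H. \<exists>y\<in>H. x \<otimes> y \<noteq> y \<otimes> x"
  proof (rule ccontr)
    assume "\<not> ?thesis"
    then have ab: "x \<otimes> y = y \<otimes> x" if "x \<in> H" "y \<in> H" for x y using that by blast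
    have "x \<otimes> y \<otimes> inv x \<otimes> inv y = \<one>" if xy: "x \<in> H" "y \<in> H" for x y
      unfolding ab[OF xy] using Hc[OF xy(1)] Hc[OF xy(2)] by (simp add: word_simps)
    then have "derived_set G H \<subseteq> {\<one>}" by blast
    then have "?D \<subseteq> {\<one>}" unfolding derived_def
      by (rule generate_subgroup_incl) (rule triv_subgroup)
    then show False using inf finite_subset by blast
  qed
  ultimately show ?thesis by blast
qed

end

theorem theorem5p3:
  fixes G :: "('a, 'b) monoid_scheme" and H :: "'a set"
  assumes "group G"
    and "subgroup H G"
    and "finite (rcosets\<^bsub>G\<^esub> H)"
    and "finitely_generated (G\<lparr>carrier := H\<rparr>)"
    and "nilpotent_of_class (G\<lparr>carrier := H\<rparr>) 2"
    and "cyclic_group (G\<lparr>carrier := derived G H\<rparr>)"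
    and "infinite (derived G H)"
  shows "equiv_conj_growth G (G\<lparr>carrier := H\<rparr>)"
proof -
  interpret group G by (rule assms(1))
  have fin: "fin_idx G H" by (rule fin_idx_rcosets[OF assms(2,3)])
  obtain w x y where w: "class2 G H w" "x \<in> H" "y \<in> H" "x \<otimes>\<^bsub>G\<^esub> y \<noteq> y \<otimes>\<^bsub>G\<^esub> x"
    using nilpotent2_class2[OF assms(2,5,6,7)] by blast
  have "growth_equiv (conj_growth G S) (conj_growth (G\<lparr>carrier := H\<rparr>) T)"
    if "fin_gen_set G S" "fin_gen_set (G\<lparr>carrier := H\<rparr>) T" for S T
    unfolding growth_equiv_def
    using growth_le_class2[OF w(1) fin w(2-4) that(2,1)] growth_le_subgroup[OF assms(2) fin that(2,1)] by blast
  then show ?thesis unfolding equiv_conj_growth_def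
    using finitely_generated_fin_idx[OF assms(2) fin assms(4)] assms(4) by blast
qed

end
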